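(* Let $M$ be a smooth manifold of dimension $m$, let $\mathcal{H}\subset TM$ be a smooth $k$-dimensional distribution on $M$, and let $\mathcal{D}_{\mathcal{H}}:C^\infty(M,\mathbb{R}^q)\to\Gamma_{\mathcal{H}}$, $\mathcal{D}_{\mathcal{H}}(f)=f^*g_{can}|_{\mathcal{H}}$. Then the operator $\mathcal{D}_{\mathcal{H}}$ is infinitesimally invertible over the set of $\mathcal{H}$-free maps $f:M\to\mathbb{R}^q$. Moreover, if $q\ge m+k+s_k$, where $s_k=\frac{k(k+1)}{2}$, then a generic map $M\to\mathbb{R}^q$ is $\mathcal{H}$-free, i.e. the set of $\mathcal{H}$-free maps is open and dense in $C^\infty(M,\mathbb{R}^q)$.
   Context: $g_{can}=\delta_{ij}dx^idx^j$ is the Euclidean metric on $\mathbb{R}^q$; $\Gamma_{\mathcal{H}}$ is the space of smooth quadratic differential forms on $\mathcal{H}$ (smooth sections of $S^2\mathcal{H}^*$). In a local frame $\xi_1,\dots,\xi_k$ of $\mathcal{H}$, $\mathcal{D}_{\mathcal{H}}(f)(\xi_a,\xi_b)=\sum_{i=1}^q L_{\xi_a}f^i\,L_{\xi_b}f^i$. The spaces $C^\infty(M,\mathbb{R}^q)$ and $\Gamma_{\mathcal{H}}$ carry the fine (Whitney) $C^\infty$ topology. $\mathcal{H}$-free map: a smooth map $f=(f^1,\dots,f^q):M\to\mathbb{R}^q$ is $\mathcal{H}$-free if every $x\in M$ has a neighbourhood with a local frame $\xi_1,\dots,\xi_k$ of $\mathcal{H}$ such that at every point of it the $k+s_k$ vectors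 of $\mathbb{R}^q$ given by $(L_{\xi_a}f^i)_{i=1}^q$, $1\le a\le k$, and $(L_{\xi_a}L_{\xi_b}f^i+L_{\xi_b}L_{\xi_a}f^i)_{i=1}^q$, $1\le a\le b\le k$, are linearly independent. Infinitesimally invertible (Gromov): let $\mathcal{D}:C^\infty(M,\mathbb{R}^q)\to\Gamma(E)$ be a smooth differential operator with values in sections of a vector bundle $E\to M$, and let $L_f:C^\infty(M,\mathbb{R}^q)\to\Gamma(E)$, $L_f(u)=\frac{d}{d\epsilon}\big|_{\epsilon=0}\mathcal{D}(f+\epsilon u)$, be its linearization at $f$. $\mathcal{D}$ is infinitesimally invertible over a set $\mathcal{A}\subset C^\infty(M,\mathbb{R}^q)$ if, for some integers $d,s\ge0$, (1) $\mathcal{A}$ is the set of smooth maps whose $d$-jets lie everywhere in some open subset $A$ of the jet space $J^d(M,\mathbb{R}^q)$; (2) for each $f\in\mathcal{A}$ there is a linear differential operator $M_f:\Gamma(E)\to C^\infty(M,\mathbb{R}^q)$ of order $s$, such that $(f,g)\mapsto M_f(g)$ is a differential operator of order $d$ in $f$, given by a smooth bundle map defined on the fibre product over $M$ of $A$ with the bundle $J^s(E)$ of $s$-jets of sections of $E$; and (3) $L_f(M_f(g))=g$ for all $f\in\mathcal{A}$ and $g\in\Gamma(E)$. *)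

theory Defs
  imports "HOL-Analysis.Analysis" "HOL-Library.Function_Algebras" "HOL-Library.Multiset"
begin

text \<open>Real-valued functions form a real vector space under pointwise operations; tangent vectors,
  bilinear forms and coordinate families of jets below are all functions of this kind.\<close>

instantiation "fun" :: (type, real_vector) real_vector
begin
definition scaleR_fun :: "real \<Rightarrow> ('a \<Rightarrow> 'b) \<Rightarrow> 'a \<Rightarrow> 'b" where
  "scaleR_fun c f = (\<lambda>x. c *\<^sub>R f x)"
instance
  by standard (auto simp: scaleR_fun_def plus_fun_def scaleR_add_left scaleR_add_right)
end


section \<open>Smooth functions on finite-dimensional spaces\<close>

definition dir_deriv ::
    "'x \<Rightarrow> ('x::real_vector \<Rightarrow> 'y::real_normed_vector) \<Rightarrow> 'x \<Rightarrow> 'y" where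
  "dir_deriv w F = (\<lambda>x. vector_derivative (\<lambda>t. F (x + t *\<^sub>R w)) (at 0))"

text \<open>\<open>Ck_on n W S F\<close>: all iterated directional derivatives of \<open>F\<close> of order at most \<open>n\<close>, in
  directions from \<open>W\<close>, exist and are continuous on \<open>S\<close>. It is used with \<open>W\<close> a finite-dimensional
  linear subspace carrying its Euclidean topology (\<open>W = UNIV\<close> for \<open>real^'m\<close>) and \<open>S\<close> relatively open
  in \<open>W\<close>, where it is the usual notion of a \<open>C^n\<close> function. Subspaces are needed because the
  dimensions of jet spaces depend on the order of the jets and so cannot be types.\<close>

primrec Ck_on ::
    "nat \<Rightarrow> 'x set \<Rightarrow> 'x set \<Rightarrow>
     ('x::{real_vector,topological_space} \<Rightarrow> 'y::real_normed_vector) \<Rightarrow> bool" where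
  "Ck_on 0 W S F \<longleftrightarrow> continuous_on S F"
| "Ck_on (Suc n) W S F \<longleftrightarrow> continuous_on S F \<and>
     (\<forall>w\<in>W. (\<forall>x\<in>S. (\<lambda>t. F (x + t *\<^sub>R w)) differentiable (at (0::real))) \<and>
             Ck_on n W S (dir_deriv w F))"

definition smooth_on ::
    "'x set \<Rightarrow> 'x set \<Rightarrow>
     ('x::{real_vector,topological_space} \<Rightarrow> 'y::real_normed_vector) \<Rightarrow> bool" where
  "smooth_on W S F \<longleftrightarrow> (\<forall>n. Ck_on n W S F)"

text \<open>The partial derivative with multi-index \<open>\<alpha>\<close>; a multi-index is the multiset of the coordinate
  directions to differentiate in. It is applied to smooth functions only, for which the order of
  differentiation (the choice of the list) is irrelevant.\<close>

definition partial_deriv ::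
    "'m multiset \<Rightarrow> (real^'m::finite \<Rightarrow> real) \<Rightarrow> real^'m \<Rightarrow> real" where
  "partial_deriv \<alpha> F = fold (\<lambda>i G. dir_deriv (axis i 1) G) (SOME is. mset is = \<alpha>) F"

text \<open>Linear independence of an indexed family, so repeated vectors count as dependent.\<close>

definition lin_indep_family :: "'i set \<Rightarrow> ('i \<Rightarrow> 'v::real_vector) \<Rightarrow> bool" where
  "lin_indep_family I v \<longleftrightarrow>
     (\<forall>c. (\<Sum>i\<in>I. c i *\<^sub>R v i) = 0 \<longrightarrow> (\<forall>i\<in>I. c i = (0::real)))"


section \<open>Smooth manifolds\<close>

text \<open>The underlying space of the manifold is the whole type \<open>'a\<close>; its dimension is \<open>CARD('m)\<close>.\<close>

type_synonym ('a, 'm) chart = "'a set \<times> ('a \<Rightarrow> real^'m)"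

definition smooth_atlas ::
    "('a::{t2_space,second_countable_topology}, 'm::finite) chart set \<Rightarrow> bool" where
  "smooth_atlas \<A> \<longleftrightarrow>
     (\<forall>(U, \<phi>)\<in>\<A>. open U \<and> open (\<phi> ` U) \<and> homeomorphism U (\<phi> ` U) \<phi> (inv_into U \<phi>)) \<and>
     (\<forall>x. \<exists>(U, \<phi>)\<in>\<A>. x \<in> U) \<and>
     (\<forall>(U, \<phi>)\<in>\<A>. \<forall>(V, \<psi>)\<in>\<A>. smooth_on UNIV (\<phi> ` (U \<inter> V)) (\<psi> \<circ> inv_into U \<phi>))"

definition smooth_fun ::
    "('a::topological_space, 'm::finite) chart set \<Rightarrow> 'a set \<Rightarrow> ('a \<Rightarrow> real) \<Rightarrow> bool" where
  "smooth_fun \<A> S f \<longleftrightarrow> (\<forall>(U, \<phi>)\<in>\<A>. smooth_on UNIV (\<phi> ` (U \<inter> S)) (f \<circ> inv_into U \<phi>))"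

definition smooth_near ::
    "('a::topological_space, 'm::finite) chart set \<Rightarrow> 'a \<Rightarrow> ('a \<Rightarrow> real) \<Rightarrow> bool" where
  "smooth_near \<A> x f \<longleftrightarrow> (\<exists>S. open S \<and> x \<in> S \<and> smooth_fun \<A> S f)"

text \<open>Tangent vectors are derivations of functions smooth near the point. Such a derivation depends
  only on the germ of its argument: indicator functions of neighbourhoods are smooth near the point.
  The value \<open>0\<close> at all other functions makes derivations with equal values on germs equal.\<close>

type_synonym 'a tangent_vector = "('a \<Rightarrow> real) \<Rightarrow> real"

definition tangent_space ::
    "('a::topological_space, 'm::finite) chart set \<Rightarrow> 'a \<Rightarrow> 'a tangent_vector set" where
  "tangent_space \<A> x = {v.
     (\<forall>f. \<not> smooth_near \<A> x f \<longrightarrow> v f = 0) \<and>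
     (\<forall>f c. smooth_near \<A> x f \<longrightarrow> v (\<lambda>y. c * f y) = c * v f) \<and>
     (\<forall>f g. smooth_near \<A> x f \<and> smooth_near \<A> x g \<longrightarrow>
        v (\<lambda>y. f y + g y) = v f + v g \<and>
        v (\<lambda>y. f y * g y) = f x * v g + g x * v f)}"

definition smooth_vector_field ::
    "('a::topological_space, 'm::finite) chart set \<Rightarrow> 'a set \<Rightarrow> ('a \<Rightarrow> 'a tangent_vector) \<Rightarrow> bool"
  where
  "smooth_vector_field \<A> U \<xi> \<longleftrightarrow>
     (\<forall>x\<in>U. \<xi> x \<in> tangent_space \<A> x) \<and>
     (\<forall>V f. open V \<and> V \<subseteq> U \<and> smooth_fun \<A> V f \<longrightarrow> smooth_fun \<A> V (\<lambda>x. \<xi> x f))"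


section \<open>Vector bundles\<close>

text \<open>A vector bundle is given by its fibres (linear subspaces of a real vector space), a finite
  index set \<open>J\<close> whose cardinality is the rank, and local trivializations \<open>(U, c)\<close>, where \<open>c x\<close> maps
  the fibre at \<open>x \<in> U\<close> isomorphically to \<open>\<real>\<^sup>J\<close>.\<close>

record ('a, 'v, 'j) vbundle =
  fibre :: "'a \<Rightarrow> 'v set"
  idx :: "'j set"
  trivs :: "('a set \<times> ('a \<Rightarrow> 'v \<Rightarrow> 'j \<Rightarrow> real)) set"

definition local_sections ::
    "('a::topological_space, 'm::finite) chart set \<Rightarrow> ('a, 'v, 'j) vbundle \<Rightarrow> 'a set \<Rightarrow>
     ('a \<Rightarrow> 'v) set" where
  "local_sections \<A> E S = {g. (\<forall>x\<in>S. g x \<in> fibre E x) \<and>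
     (\<forall>(U, c)\<in>trivs E. \<forall>j\<in>idx E. smooth_fun \<A> (U \<inter> S) (\<lambda>x. c x (g x) j))}"

abbreviation sections ::
    "('a::topological_space, 'm::finite) chart set \<Rightarrow> ('a, 'v, 'j) vbundle \<Rightarrow> ('a \<Rightarrow> 'v) set" where
  "sections \<A> E \<equiv> local_sections \<A> E UNIV"

text \<open>The product bundle with fibre \<open>\<real>\<^sup>q\<close>. Smooth maps \<open>M \<rightarrow> \<real>\<^sup>q\<close>, i.e. maps with smooth components,
  are its sections, and \<open>J\<^sup>d(M, \<real>\<^sup>q)\<close> is its jet bundle.\<close>

definition product_bundle :: "('a, real^'q, 'q::finite) vbundle" where
  "product_bundle = \<lparr>fibre = (\<lambda>x. UNIV), idx = UNIV, trivs = {(UNIV, \<lambda>x v j. v $ j)}\<rparr>"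

abbreviation C_inf ::
    "('a::topological_space, 'm::finite) chart set \<Rightarrow> ('a \<Rightarrow> real^'q::finite) set" where
  "C_inf \<A> \<equiv> sections \<A> product_bundle"


section \<open>Jets\<close>

text \<open>The fibre coordinates of the \<open>d\<close>-jet at \<open>x\<close> of a section \<open>g\<close>, in a chart and a
  trivialization.\<close>

fun taylor ::
    "('a, 'v, 'j) vbundle \<Rightarrow> nat \<Rightarrow> ('a, 'm::finite) chart \<Rightarrow> ('a \<Rightarrow> 'v \<Rightarrow> 'j \<Rightarrow> real) \<Rightarrow>
     ('a \<Rightarrow> 'v) \<Rightarrow> 'a \<Rightarrow> 'm multiset \<Rightarrow> 'j \<Rightarrow> real" where
  "taylor E d (U, \<phi>) c g x \<alpha> j =
     (if size \<alpha> \<le> d \<and> j \<in> idx E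
      then partial_deriv \<alpha> ((\<lambda>y. c y (g y) j) \<circ> inv_into U \<phi>) (\<phi> x) else 0)"

definition section_near ::
    "('a::topological_space, 'm::finite) chart set \<Rightarrow> ('a, 'v, 'j) vbundle \<Rightarrow> 'a \<Rightarrow>
     ('a \<Rightarrow> 'v) \<Rightarrow> bool" where
  "section_near \<A> E x g \<longleftrightarrow> (\<exists>S. open S \<and> x \<in> S \<and> g \<in> local_sections \<A> E S)"

text \<open>A \<open>d\<close>-jet is a point together with a class of local sections which agree there to order
  \<open>d\<close>.\<close>

type_synonym ('a, 'v) jet = "'a \<times> ('a \<Rightarrow> 'v) set"

definition jet_of ::
    "('a::topological_space, 'm::finite) chart set \<Rightarrow> ('a, 'v, 'j) vbundle \<Rightarrow> nat \<Rightarrow>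
     ('a \<Rightarrow> 'v) \<Rightarrow> 'a \<Rightarrow> ('a, 'v) jet" where
  "jet_of \<A> E d g x = (x, {h. section_near \<A> E x h \<and>
     (\<forall>(U, \<phi>)\<in>\<A>. \<forall>(V, c)\<in>trivs E. x \<in> U \<inter> V \<longrightarrow>
        taylor E d (U, \<phi>) c h x = taylor E d (U, \<phi>) c g x)})"

definition jet_bundle ::
    "('a::topological_space, 'm::finite) chart set \<Rightarrow> ('a, 'v, 'j) vbundle \<Rightarrow> nat \<Rightarrow>
     ('a, 'v) jet set" where
  "jet_bundle \<A> E d = {jet_of \<A> E d g x | g x. section_near \<A> E x g}"

definition jet_fibre_coords ::
    "('a, 'v, 'j) vbundle \<Rightarrow> nat \<Rightarrow> ('a, 'm::finite) chart \<Rightarrow> ('a \<Rightarrow> 'v \<Rightarrow> 'j \<Rightarrow> real) \<Rightarrow>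
     ('a, 'v) jet \<Rightarrow> 'm multiset \<Rightarrow> 'j \<Rightarrow> real" where
  "jet_fibre_coords E d ch c p = taylor E d ch c (SOME h. h \<in> snd p) (fst p)"

definition jet_model ::
    "('a, 'v, 'j) vbundle \<Rightarrow> nat \<Rightarrow> ('m multiset \<Rightarrow> 'j \<Rightarrow> real) set" where
  "jet_model E d = {y. \<forall>\<alpha> j. \<not> (size \<alpha> \<le> d \<and> j \<in> idx E) \<longrightarrow> y \<alpha> j = 0}"

definition open_in_jet_bundle ::
    "('a::topological_space, 'm::finite) chart set \<Rightarrow> ('a, 'v, 'j) vbundle \<Rightarrow> nat \<Rightarrow>
     ('a, 'v) jet set \<Rightarrow> bool" where
  "open_in_jet_bundle \<A> E d A \<longleftrightarrow> A \<subseteq> jet_bundle \<A> E d \<and>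
     (\<forall>(U, \<phi>)\<in>\<A>. \<forall>(V, c)\<in>trivs E.
        openin (top_of_set (UNIV \<times> jet_model E d))
          ((\<lambda>p. (\<phi> (fst p), jet_fibre_coords E d (U, \<phi>) c p)) ` {p\<in>A. fst p \<in> U \<inter> V}))"

definition sections_with_jets_in ::
    "('a::topological_space, 'm::finite) chart set \<Rightarrow> ('a, 'v, 'j) vbundle \<Rightarrow> nat \<Rightarrow>
     ('a, 'v) jet set \<Rightarrow> ('a \<Rightarrow> 'v) set" where
  "sections_with_jets_in \<A> E d A = {g \<in> sections \<A> E. \<forall>x. jet_of \<A> E d g x \<in> A}"

text \<open>The generating sets, with \<open>r\<close> ranging over all orders, form a basis: the set for jets of order
  \<open>r\<close> is also a set for jets of any higher order.\<close>

definition whitney_topology ::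
    "('a::topological_space, 'm::finite) chart set \<Rightarrow> ('a, 'v, 'j) vbundle \<Rightarrow>
     ('a \<Rightarrow> 'v) topology" where
  "whitney_topology \<A> E = topology_generated_by
     {sections_with_jets_in \<A> E r A | r A. open_in_jet_bundle \<A> E r A}"


section \<open>Infinitesimally invertible operators\<close>

text \<open>\<open>v\<close> is the derivative at \<open>\<epsilon> = 0\<close> of \<open>\<epsilon> \<mapsto> D (f + \<epsilon>u)\<close>, that is, \<open>v = L\<^sub>f(u)\<close>. The derivative is
  taken in each fibre, in linear coordinates.\<close>

definition is_linearization ::
    "('a, 'v, 'j) vbundle \<Rightarrow> (('a \<Rightarrow> real^'q::finite) \<Rightarrow> 'a \<Rightarrow> 'v) \<Rightarrow>
     ('a \<Rightarrow> real^'q) \<Rightarrow> ('a \<Rightarrow> real^'q) \<Rightarrow> ('a \<Rightarrow> 'v) \<Rightarrow> bool" where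
  "is_linearization E D f u v \<longleftrightarrow> (\<forall>x. v x \<in> fibre E x \<and>
     (\<forall>(V, c)\<in>trivs E. x \<in> V \<longrightarrow> (\<forall>j\<in>idx E.
        ((\<lambda>\<epsilon>. c x (D (\<lambda>y. f y + \<epsilon> *\<^sub>R u y) x) j) has_real_derivative c x (v x) j) (at 0))))"

text \<open>\<open>\<Psi>\<close> is a smooth bundle map over \<open>M\<close> from the fibre product over \<open>M\<close> of
  \<open>A \<subseteq> J\<^sup>d(M, \<real>\<^sup>q)\<close> with \<open>J\<^sup>s(E)\<close> to \<open>M \<times> \<real>\<^sup>q\<close>. Only the \<open>\<real>\<^sup>q\<close> component of \<open>\<Psi>\<close> is given; \<open>G\<close> is its
  expression in local coordinates.\<close>

definition smooth_bundle_map ::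
    "('a::topological_space, 'm::finite) chart set \<Rightarrow> ('a, 'v, 'j) vbundle \<Rightarrow> nat \<Rightarrow> nat \<Rightarrow>
     ('a, real^'q::finite) jet set \<Rightarrow> (('a, real^'q) jet \<Rightarrow> ('a, 'v) jet \<Rightarrow> real^'q) \<Rightarrow> bool" where
  "smooth_bundle_map \<A> E d s A \<Psi> \<longleftrightarrow>
     (\<forall>(U, \<phi>)\<in>\<A>. \<forall>(V, c)\<in>trivs E.
       let P = {(p, r). p \<in> A \<and> r \<in> jet_bundle \<A> E s \<and> fst p = fst r \<and> fst p \<in> U \<inter> V};
           coords = (\<lambda>(p, r). (\<phi> (fst p),
                       jet_fibre_coords product_bundle d (U, \<phi>) (\<lambda>x v j. v $ j) p,
                       jet_fibre_coords E s (U, \<phi>) c r))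
       in \<exists>G. smooth_on (UNIV \<times> jet_model (product_bundle :: ('a, real^'q, 'q) vbundle) d
                          \<times> jet_model E s) (coords ` P) G \<and>
              (\<forall>(p, r)\<in>P. \<Psi> p r = G (coords (p, r))))"

definition infinitesimally_invertible ::
    "('a::topological_space, 'm::finite) chart set \<Rightarrow> ('a, 'v::real_vector, 'j) vbundle \<Rightarrow>
     (('a \<Rightarrow> real^'q::finite) \<Rightarrow> 'a \<Rightarrow> 'v) \<Rightarrow> ('a \<Rightarrow> real^'q) set \<Rightarrow> bool" where
  "infinitesimally_invertible \<A> E D \<F> \<longleftrightarrow>
     (\<forall>f\<in>C_inf \<A>. D f \<in> sections \<A> E) \<and>
     (\<exists>d s A \<Psi> M.
        open_in_jet_bundle \<A> product_bundle d A \<and>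
        \<F> = sections_with_jets_in \<A> product_bundle d A \<and>
        smooth_bundle_map \<A> E d s A \<Psi> \<and>
        (\<forall>f\<in>\<F>.
           (\<forall>g\<in>sections \<A> E. M f g \<in> C_inf \<A> \<and>
              (\<forall>x. M f g x = \<Psi> (jet_of \<A> product_bundle d f x) (jet_of \<A> E s g x)) \<and>
              is_linearization E D f (M f g) g) \<and>
           (\<forall>g\<in>sections \<A> E. \<forall>h\<in>sections \<A> E. \<forall>a b.
              M f (\<lambda>x. a *\<^sub>R g x + b *\<^sub>R h x) = (\<lambda>x. a *\<^sub>R M f g x + b *\<^sub>R M f h x))))"


section \<open>Distributions and free maps\<close>

definition local_frame ::
    "('a::topological_space, 'm::finite) chart set \<Rightarrow> ('a \<Rightarrow> 'a tangent_vector set) \<Rightarrow> nat \<Rightarrow>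
     'a set \<Rightarrow> (nat \<Rightarrow> 'a \<Rightarrow> 'a tangent_vector) \<Rightarrow> bool" where
  "local_frame \<A> H k U \<xi> \<longleftrightarrow> open U \<and> (\<forall>a<k. smooth_vector_field \<A> U (\<xi> a)) \<and>
     (\<forall>x\<in>U. lin_indep_family {..<k} (\<lambda>a. \<xi> a x) \<and> H x = span ((\<lambda>a. \<xi> a x) ` {..<k}))"

definition smooth_distribution ::
    "('a::topological_space, 'm::finite) chart set \<Rightarrow> nat \<Rightarrow> ('a \<Rightarrow> 'a tangent_vector set) \<Rightarrow> bool"
  where
  "smooth_distribution \<A> k H \<longleftrightarrow> (\<forall>x. \<exists>U \<xi>. x \<in> U \<and> local_frame \<A> H k U \<xi>)"

text \<open>The bundle \<open>S\<^sup>2H\<^sup>*\<close>: the fibre consists of the symmetric bilinear forms on \<open>H x\<close>, extended by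
  \<open>0\<close>; a local frame of \<open>H\<close> trivializes it by the components \<open>g(\<xi>\<^sub>a, \<xi>\<^sub>b)\<close>, \<open>a \<le> b\<close>.\<close>

definition quadratic_forms ::
    "('a::topological_space, 'm::finite) chart set \<Rightarrow> nat \<Rightarrow> ('a \<Rightarrow> 'a tangent_vector set) \<Rightarrow>
     ('a, 'a tangent_vector \<Rightarrow> 'a tangent_vector \<Rightarrow> real, nat \<times> nat) vbundle" where
  "quadratic_forms \<A> k H =
     \<lparr>fibre = (\<lambda>x. {g. (\<forall>v w. v \<notin> H x \<or> w \<notin> H x \<longrightarrow> g v w = 0) \<and>
                       (\<forall>v\<in>H x. \<forall>w\<in>H x. g v w = g w v) \<and>
                       (\<forall>u\<in>H x. \<forall>v\<in>H x. \<forall>w\<in>H x. g (u + v) w = g u w + g v w) \<and>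
                       (\<forall>v\<in>H x. \<forall>w\<in>H x. \<forall>r. g (r *\<^sub>R v) w = r * g v w)}),
      idx = {(a, b). a \<le> b \<and> b < k},
      trivs = {(U, \<lambda>x g (a, b). g (\<xi> a x) (\<xi> b x)) | U \<xi>. local_frame \<A> H k U \<xi>}\<rparr>"

definition differential ::
    "('a \<Rightarrow> real^'q::finite) \<Rightarrow> 'a tangent_vector \<Rightarrow> real^'q" where
  "differential f v = (\<chi> i. v (\<lambda>y. f y $ i))"

definition pullback_metric ::
    "('a \<Rightarrow> 'a tangent_vector set) \<Rightarrow> ('a \<Rightarrow> real^'q::finite) \<Rightarrow>
     'a \<Rightarrow> 'a tangent_vector \<Rightarrow> 'a tangent_vector \<Rightarrow> real" where
  "pullback_metric H f x v w =
     (if v \<in> H x \<and> w \<in> H x then inner (differential f v) (differential f w) else 0)"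

definition lie_derivative ::
    "('a \<Rightarrow> 'a tangent_vector) \<Rightarrow> ('a \<Rightarrow> real^'q::finite) \<Rightarrow> 'a \<Rightarrow> real^'q" where
  "lie_derivative \<xi> f x = differential f (\<xi> x)"

definition free_maps ::
    "('a::topological_space, 'm::finite) chart set \<Rightarrow> nat \<Rightarrow> ('a \<Rightarrow> 'a tangent_vector set) \<Rightarrow>
     ('a \<Rightarrow> real^'q::finite) set" where
  "free_maps \<A> k H = {f \<in> C_inf \<A>. \<forall>x. \<exists>U \<xi>. x \<in> U \<and> local_frame \<A> H k U \<xi> \<and>
     (\<forall>y\<in>U. lin_indep_family ({..<k} <+> {(a, b). a \<le> b \<and> b < k})
        (case_sum (\<lambda>a. lie_derivative (\<xi> a) f y)
           (\<lambda>(a, b). lie_derivative (\<xi> a) (lie_derivative (\<xi> b) f) y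
                   + lie_derivative (\<xi> b) (lie_derivative (\<xi> a) f) y)))}"

end

theory Submission
  imports Defs
begin

text \<open>For a frame \<open>\<xi>\<^sub>1, \<dots>, \<xi>\<^sub>k\<close> the linearized operator is
  \<open>u \<mapsto> L\<^sub>a u \<bullet> L\<^sub>b f + L\<^sub>a f \<bullet> L\<^sub>b u\<close>. If \<open>u \<bullet> L\<^sub>a f = 0\<close> for all \<open>a\<close>, differentiating these equations turns it into
  \<open>- u \<bullet> (L\<^sub>a L\<^sub>b f + L\<^sub>b L\<^sub>a f)\<close>, so it suffices to solve a linear system for \<open>u\<close> whose coefficient
  vectors are exactly those required to be independent for a free map \<open>f\<close>. The solution in their span
  is unique, hence independent of the frame, and depends smoothly on the 2-jet of \<open>f\<close>.

  Freeness is an open condition on 2-jets. For density, add to \<open>f\<close>, in a chart, quadratic polynomials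
  times a bump function. Dependence at a point \<open>z\<close> with coefficients \<open>c\<close> (normalized) is \<open>q\<close> equations
  on the parameters, while \<open>(z, c)\<close> ranges over \<open>m + k + s\<^sub>k - 1 < q\<close> dimensions, so almost all
  parameters are good. Arbitrarily small such corrections along an exhaustion by compact sets give a
  free map in any given Whitney neighbourhood.\<close>

section \<open>Functions of class \<open>C\<^sup>k\<close>\<close>

text \<open>Jet coordinates live in function spaces that carry a topology but no norm, so smoothness
  is tested along lines. The calculus is therefore built on directional derivatives over sets
  satisfying \<open>line_open\<close>, which contain a short piece of every line in the directions
  of W; Frechet derivatives enter only for functions on Euclidean spaces, where the chain rule needs
  them. A second obstacle is choice: jets are classes defined over all charts, and the symbol of the
  right inverse picks a frame at each point. Invariance removes both. Flatness of a difference
  survives composition with a chart transition, and the solution in the span is fixed by conditions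
  that transform along with the frame. The density argument avoids Sard's theorem. The count of
  dimensions leaves at least one spare coordinate, so the bad parameters lie in smooth images of
  hyperplane pieces of the parameter space itself, and differentiable maps between spaces of equal
  dimension preserve null sets. Linear and quadratic monomials suffice as perturbations because a
  nonzero combination of the frame operators cannot annihilate all of them at a point.\<close>

definition line_open :: "'x::real_vector set \<Rightarrow> 'x set \<Rightarrow> bool" where
  "line_open W S \<longleftrightarrow> (\<forall>x\<in>S. \<forall>w\<in>W. \<forall>\<^sub>F t in nhds (0::real). x + t *\<^sub>R w \<in> S)"

lemma line_open_UNIV: "open S \<Longrightarrow> line_open UNIV (S :: 'x::real_normed_vector set)"
  unfolding line_open_def
proof (intro ballI)
  fix x w :: 'x assume S: "open S" "x \<in> S"
  have "((\<lambda>t. x + t *\<^sub>R w) \<longlongrightarrow> x + 0 *\<^sub>R w) (nhds (0::real))"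
    by (intro tendsto_intros filterlim_ident)
  with S show "\<forall>\<^sub>F t in nhds (0::real). x + t *\<^sub>R w \<in> S"
    by (auto intro: topological_tendstoD)
qed

lemma dir_deriv_eqI:
  "((\<lambda>t. F (x + t *\<^sub>R w)) has_vector_derivative D) (at 0) \<Longrightarrow> dir_deriv w F x = D"
  by (simp add: dir_deriv_def vector_derivative_at)

lemma Ck_on_continuous: "Ck_on n W S F \<Longrightarrow> continuous_on S F"
  by (cases n) auto

lemma Ck_on_has_dir_deriv:
  "Ck_on (Suc n) W S F \<Longrightarrow> w \<in> W \<Longrightarrow> x \<in> S \<Longrightarrow>
    ((\<lambda>t. F (x + t *\<^sub>R w)) has_vector_derivative dir_deriv w F x) (at 0)"
  by (auto simp: dir_deriv_def vector_derivative_works)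

lemma Ck_on_dir_deriv: "Ck_on (Suc n) W S F \<Longrightarrow> w \<in> W \<Longrightarrow> Ck_on n W S (dir_deriv w F)"
  by simp

text \<open>The derivative at x sees values off x along the line, so agreement on S suffices because
  S contains the line for small t.\<close>

lemma has_dir_deriv_cong:
  assumes "line_open W S" "x \<in> S" "w \<in> W" "\<And>x. x \<in> S \<Longrightarrow> F x = G x"
  shows "((\<lambda>t. F (x + t *\<^sub>R w)) has_vector_derivative D) (at 0) \<longleftrightarrow>
    ((\<lambda>t. G (x + t *\<^sub>R w)) has_vector_derivative D) (at 0)"
proof (rule has_vector_derivative_cong_ev)
  have "\<forall>\<^sub>F t in nhds (0::real). x + t *\<^sub>R w \<in> S"
    using assms by (auto simp: line_open_def)
  then show "\<forall>\<^sub>F t in nhds 0. t \<in> UNIV \<longrightarrow> F (x + t *\<^sub>R w) = G (x + t *\<^sub>R w)"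
    by eventually_elim (use assms in auto)
qed (use assms in auto)

lemma dir_deriv_cong:
  assumes "line_open W S" "x \<in> S" "w \<in> W" "\<And>x. x \<in> S \<Longrightarrow> F x = G x"
  shows "dir_deriv w F x = dir_deriv w G x"
proof -
  have "((\<lambda>t. F (x + t *\<^sub>R w)) has_vector_derivative D) (at 0) \<longleftrightarrow>
    ((\<lambda>t. G (x + t *\<^sub>R w)) has_vector_derivative D) (at 0)" for D
    using assms by (rule has_dir_deriv_cong)
  then show ?thesis by (simp add: dir_deriv_def vector_derivative_def)
qed

lemma Ck_on_cong:
  assumes "line_open W S" "\<And>x. x \<in> S \<Longrightarrow> F x = G x" "Ck_on n W S F"
  shows "Ck_on n W S G"
  using assms(2,3)
proof (induction n arbitrary: F G)
  case 0
  then show ?case by (simp cong: continuous_on_cong)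
next
  case (Suc n)
  have c: "continuous_on S G"
    using Ck_on_continuous[OF Suc.prems(2)] Suc.prems(1) by (simp cong: continuous_on_cong)
  have "(\<lambda>t. G (x + t *\<^sub>R w)) differentiable at 0" if "w \<in> W" "x \<in> S" for w x
    using Ck_on_has_dir_deriv[OF Suc.prems(2) that] that
      has_dir_deriv_cong[OF assms(1) that(2,1), of F G] Suc.prems(1)
    by (auto intro: differentiableI_vector)
  moreover have "Ck_on n W S (dir_deriv w G)" if "w \<in> W" for w
    using Suc.IH[of "dir_deriv w F" "dir_deriv w G"] Suc.prems
      dir_deriv_cong[OF assms(1) _ that, of _ F G] that by auto
  ultimately show ?case using c by auto
qed

text \<open>Lets a closed formula stand in for \<open>dir_deriv\<close>, which is only known to
  agree with it on S. All closure properties below are proved through this rule.\<close>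

lemma Ck_on_SucI:
  assumes "line_open W S" "continuous_on S F"
    and "\<And>w x. w \<in> W \<Longrightarrow> x \<in> S \<Longrightarrow> ((\<lambda>t. F (x + t *\<^sub>R w)) has_vector_derivative F' w x) (at 0)"
    and "\<And>w. w \<in> W \<Longrightarrow> Ck_on n W S (F' w)"
  shows "Ck_on (Suc n) W S F"
proof -
  have "Ck_on n W S (dir_deriv w F)" if "w \<in> W" for w
    by (rule Ck_on_cong[OF assms(1) _ assms(4)[OF that]])
       (simp add: dir_deriv_eqI[OF assms(3)[OF that]])
  then show ?thesis
    using assms by (auto intro: differentiableI_vector)
qed

lemma Ck_on_Suc_imp: "Ck_on (Suc n) W S F \<Longrightarrow> Ck_on n W S F"
proof (induction n arbitrary: F)
  case (Suc n)
  have "Ck_on n W S (dir_deriv w F)" if "w \<in> W" for w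
    using Suc.IH[of "dir_deriv w F"] Suc.prems that by simp
  then show ?case using Suc.prems by auto
qed auto

lemma Ck_on_le: "Ck_on n W S F \<Longrightarrow> m \<le> n \<Longrightarrow> Ck_on m W S F"
  by (induction n) (auto simp: le_Suc_eq dest: Ck_on_Suc_imp simp del: Ck_on.simps)

lemma Ck_on_subset: "Ck_on n W S F \<Longrightarrow> T \<subseteq> S \<Longrightarrow> Ck_on n W T F"
proof (induction n arbitrary: F)
  case 0
  then show ?case by (auto intro: continuous_on_subset)
next
  case (Suc n)
  then show ?case by (auto intro: continuous_on_subset)
qed

lemma Ck_on_const:
  assumes "line_open W S" shows "Ck_on n W S (\<lambda>x. c)"
proof (induction n arbitrary: c)
  case (Suc n)
  show ?case by (rule Ck_on_SucI[OF assms, where F' = "\<lambda>_ _. 0"]) (auto intro: Suc.IH)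
qed auto

lemma Ck_on_linear:
  assumes "line_open W S" "linear L" "continuous_on S L" shows "Ck_on n W S L"
proof (cases n)
  case (Suc k)
  have "((\<lambda>t. L (x + t *\<^sub>R w)) has_vector_derivative L w) (at 0)" for x w
    using assms(2) by (auto simp: linear_add linear_scale intro!: derivative_eq_intros)
  then show ?thesis unfolding Suc
    by (intro Ck_on_SucI[OF assms(1,3), where F' = "\<lambda>w x. L w"] Ck_on_const[OF assms(1)]) auto
qed (use assms in auto)

lemma Ck_on_add:
  assumes "line_open W S" "Ck_on n W S F" "Ck_on n W S G"
  shows "Ck_on n W S (\<lambda>x. F x + G x)"
  using assms(2,3)
proof (induction n arbitrary: F G)
  case (Suc n)
  show ?case
  proof (rule Ck_on_SucI[OF assms(1), where F' = "\<lambda>w x. dir_deriv w F x + dir_deriv w G x"])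
    show "continuous_on S (\<lambda>x. F x + G x)"
      using Suc.prems by (auto intro!: continuous_intros)
    show "Ck_on n W S (\<lambda>x. dir_deriv w F x + dir_deriv w G x)" if "w \<in> W" for w
      using Suc.prems that by (auto intro: Suc.IH)
    show "((\<lambda>t. F (x + t *\<^sub>R w) + G (x + t *\<^sub>R w)) has_vector_derivative
        dir_deriv w F x + dir_deriv w G x) (at 0)" if "w \<in> W" "x \<in> S" for w x
      by (intro has_vector_derivative_add Suc.prems[THEN Ck_on_has_dir_deriv] that)
  qed
qed (auto intro: continuous_intros)

text \<open>One product rule serves multiplication, scaling and inner products. Each term pairs a
  derivative of one factor with the other factor itself, which must first be weakened from order
  \<open>Suc n\<close> to n.\<close>

lemma Ck_on_bounded_bilinear:
  assumes "bounded_bilinear b" "line_open W S" "Ck_on n W S F" "Ck_on n W S G"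
  shows "Ck_on n W S (\<lambda>x. b (F x) (G x))"
  using assms(3,4)
proof (induction n arbitrary: F G)
  case 0
  then show ?case using bounded_bilinear.continuous_on[OF assms(1)] by auto
next
  case (Suc n)
  note Ck_on.simps [simp del]
  show ?case
  proof (rule Ck_on_SucI[OF assms(2),
        where F' = "\<lambda>w x. b (F x) (dir_deriv w G x) + b (dir_deriv w F x) (G x)"])
    show "continuous_on S (\<lambda>x. b (F x) (G x))"
      using Suc.prems[THEN Ck_on_continuous] by (rule bounded_bilinear.continuous_on[OF assms(1)])
    show "Ck_on n W S (\<lambda>x. b (F x) (dir_deriv w G x) + b (dir_deriv w F x) (G x))"
      if "w \<in> W" for w
      using Suc.prems that
      by (intro Ck_on_add Suc.IH assms) (auto dest: Ck_on_Suc_imp Ck_on_dir_deriv)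
    show "((\<lambda>t. b (F (x + t *\<^sub>R w)) (G (x + t *\<^sub>R w))) has_vector_derivative
        b (F x) (dir_deriv w G x) + b (dir_deriv w F x) (G x)) (at 0)" if "w \<in> W" "x \<in> S" for w x
      using bounded_bilinear.has_vector_derivative[OF assms(1)
          Ck_on_has_dir_deriv[OF Suc.prems(1) that] Ck_on_has_dir_deriv[OF Suc.prems(2) that]]
      by simp
  qed
qed

lemma Ck_on_bounded_linear:
  assumes "bounded_linear L" "Ck_on n W S F" "line_open W S"
  shows "Ck_on n W S (\<lambda>x. L (F x))"
proof -
  \<comment> \<open>A linear map is a bilinear one with its first argument frozen at 1, so the
    product rule can be reused.\<close>
  have "Ck_on n W S (\<lambda>x. (1::real) *\<^sub>R L (F x))"
  proof (rule Ck_on_bounded_bilinear[where b = "\<lambda>r x. r *\<^sub>R L x"])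
    show "bounded_bilinear (\<lambda>(r::real) x. r *\<^sub>R L x)"
      using bounded_bilinear.comp[OF bounded_bilinear_scaleR bounded_linear_ident assms(1)] .
  qed (use assms Ck_on_const in auto)
  then show ?thesis by simp
qed

lemma Ck_on_sum:
  assumes "line_open W S" "\<And>i. i \<in> I \<Longrightarrow> Ck_on n W S (F i)"
  shows "Ck_on n W S (\<lambda>x. \<Sum>i\<in>I. F i x)"
  using assms(2)
  by (induction I rule: infinite_finite_induct) (auto intro: Ck_on_const Ck_on_add assms(1))

text \<open>The derivative of 1/F contains 1/F again, but only to one order less, which is what the
  induction supplies.\<close>

lemma Ck_on_inverse:
  fixes F :: "_ \<Rightarrow> real"
  assumes "line_open W S" "Ck_on n W S F" "\<And>x. x \<in> S \<Longrightarrow> F x \<noteq> 0"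
  shows "Ck_on n W S (\<lambda>x. inverse (F x))"
  using assms(2)
proof (induction n)
  case 0
  then show ?case using assms(3) by (auto intro!: continuous_intros)
next
  case (Suc n)
  note Ck_on.simps [simp del]
  show ?case
  proof (rule Ck_on_SucI[OF assms(1),
        where F' = "\<lambda>w x. - 1 * (inverse (F x) * inverse (F x) * dir_deriv w F x)"])
    show "continuous_on S (\<lambda>x. inverse (F x))"
      using Ck_on_continuous[OF Suc.prems] assms(3) by (auto intro!: continuous_intros)
    show "Ck_on n W S (\<lambda>x. - 1 * (inverse (F x) * inverse (F x) * dir_deriv w F x))" if "w \<in> W" for w
      using Suc that
      by (intro Ck_on_bounded_bilinear[OF bounded_bilinear_mult] Ck_on_const assms(1))
         (auto dest: Ck_on_Suc_imp Ck_on_dir_deriv)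
    show "((\<lambda>t. inverse (F (x + t *\<^sub>R w))) has_vector_derivative
        - 1 * (inverse (F x) * inverse (F x) * dir_deriv w F x)) (at 0)" if "w \<in> W" "x \<in> S" for w x
      using Ck_on_has_dir_deriv[OF Suc.prems that] assms(3)[OF that(2)]
      by (auto simp: has_real_derivative_iff_has_vector_derivative[symmetric] algebra_simps
               intro!: derivative_eq_intros)
  qed
qed

text \<open>A linear map sends lines to lines, so no chain rule and no norm on the source is
  involved. It transports smooth functions of the base point to the space of jet coordinates via
  \<open>fst\<close>.\<close>

lemma Ck_on_precompose_linear:
  assumes "linear L" "continuous_on S L" "L ` S \<subseteq> S'" "L ` W \<subseteq> W'" "Ck_on n W' S' F"
  shows "Ck_on n W S (\<lambda>x. F (L x))"
  using assms(5)
proof (induction n arbitrary: F)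
  case 0
  then show ?case using assms by (auto intro: continuous_on_compose2)
next
  case (Suc n)
  have L: "L (x + t *\<^sub>R w) = L x + t *\<^sub>R L w" for x w t
    using assms(1) by (simp add: linear_add linear_scale)
  have "dir_deriv w (\<lambda>x. F (L x)) = (\<lambda>x. dir_deriv (L w) F (L x))" for w
    by (simp add: dir_deriv_def L)
  then show ?case
    using Suc.prems assms(2-4) Suc.IH
    by (auto simp: L image_subset_iff intro: continuous_on_compose2)
qed

lemma Ck_on_locally:
  fixes F :: "'x::real_normed_vector \<Rightarrow> _"
  assumes "\<And>x. x \<in> S \<Longrightarrow> \<exists>T. open T \<and> x \<in> T \<and> Ck_on n UNIV (S \<inter> T) F"
  shows "Ck_on n UNIV S F"
  using assms
proof (induction n arbitrary: F)
  case 0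
  show ?case unfolding Ck_on.simps continuous_on_eq_continuous_within
  proof
    fix x assume "x \<in> S"
    with 0 obtain T where "open T" "x \<in> T" "continuous_on (S \<inter> T) F" by auto
    then have "continuous (at x within S \<inter> T) F"
      using \<open>x \<in> S\<close> by (simp add: continuous_on_eq_continuous_within)
    moreover have "at x within S \<inter> T = at x within S"
      using \<open>open T\<close> \<open>x \<in> T\<close> by (auto intro: at_within_nhd)
    ultimately show "continuous (at x within S) F" by (simp add: continuous_within)
  qed
next
  case (Suc n)
  have "Ck_on 0 UNIV S F"
    using Suc.prems by (intro Suc(1)[THEN Ck_on_le]) (auto dest: Ck_on_Suc_imp simp del: Ck_on.simps)
  moreover have "Ck_on n UNIV S (dir_deriv w F)" for w
    using Suc.prems by (intro Suc.IH) fastforce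
  moreover have "(\<lambda>t. F (x + t *\<^sub>R w)) differentiable at 0" if "x \<in> S" for x w
    using Suc.prems[OF that] that by auto
  ultimately show ?case by auto
qed

lemma has_vector_derivative_on_line:
  assumes "Ck_on (Suc n) W S F" "w \<in> W" "x + s *\<^sub>R w \<in> S"
  shows "((\<lambda>t. F (x + t *\<^sub>R w)) has_vector_derivative dir_deriv w F (x + s *\<^sub>R w)) (at s)"
proof -
  have "((\<lambda>t. F (x + s *\<^sub>R w + t *\<^sub>R w)) has_vector_derivative dir_deriv w F (x + s *\<^sub>R w)) (at (s - s))"
    using Ck_on_has_dir_deriv[OF assms] by simp
  moreover have "((\<lambda>t. t - s) has_vector_derivative 1) (at s)"
    by (auto intro!: derivative_eq_intros)
  ultimately show ?thesis
    using vector_diff_chain_at[of "\<lambda>t. t - s" 1 s "\<lambda>t. F (x + s *\<^sub>R w + t *\<^sub>R w)"]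
    by (simp add: o_def scaleR_diff_left)
qed

lemma norm_triangle3:
  "norm (a - b - p) \<le> A \<Longrightarrow> norm (p - q) \<le> B \<Longrightarrow> norm (b - c - r) \<le> C \<Longrightarrow>
    norm (a - c - r - q) \<le> A + B + C"
  by norm

text \<open>Continuous partial derivatives give total differentiability: coordinates are switched on
  one at a time, and each switch is controlled by a mean value inequality on a segment parallel to
  an axis.\<close>

lemma Ck_on_imp_has_derivative:
  fixes F :: "'e::euclidean_space \<Rightarrow> 'y::real_normed_vector"
  assumes "Ck_on (Suc 0) UNIV S F" "open S" "x \<in> S"
  shows "(F has_derivative (\<lambda>h. \<Sum>b\<in>Basis. (h \<bullet> b) *\<^sub>R dir_deriv b F x)) (at x)"
proof -
  let ?P = "\<lambda>I h. (\<Sum>b\<in>I. (h \<bullet> b) *\<^sub>R b)"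
  \<comment> \<open>Projections onto coordinate subspaces do not increase the norm, so every
    intermediate point stays as close to x as the final one.\<close>
  have nP: "norm (?P I h) \<le> norm h" if "I \<subseteq> Basis" for I and h :: 'e
  proof -
    have "norm (?P I h) ^ 2 = (\<Sum>b\<in>I. (h \<bullet> b)\<^sup>2)"
    proof -
      have "norm (?P I h) ^ 2 = (\<Sum>b\<in>I. \<Sum>c\<in>I. (h \<bullet> b) * (h \<bullet> c) * (b \<bullet> c))"
        by (simp add: power2_norm_eq_inner inner_sum_left inner_sum_right mult_ac sum_distrib_left inner_commute)
      also have "\<dots> = (\<Sum>b\<in>I. \<Sum>c\<in>I. if b = c then (h \<bullet> b)\<^sup>2 else 0)"
        using that by (intro sum.cong) (auto simp: inner_Basis power2_eq_square subset_iff)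
      also have "\<dots> = (\<Sum>b\<in>I. (h \<bullet> b)\<^sup>2)"
        using that finite_subset[OF that] by simp
      finally show ?thesis .
    qed
    also have "\<dots> \<le> (\<Sum>b\<in>Basis. (h \<bullet> b)\<^sup>2)"
      using that by (intro sum_mono2) auto
    also have "\<dots> = norm h ^ 2"
      unfolding power2_norm_eq_inner by (subst euclidean_inner[of h h]) (simp add: power2_eq_square)
    finally show ?thesis using power2_le_imp_le norm_ge_zero by blast
  qed
  have main: "\<exists>d>0. \<forall>h. norm h < d \<longrightarrow>
      norm (F (x + ?P I h) - F x - (\<Sum>b\<in>I. (h \<bullet> b) *\<^sub>R dir_deriv b F x)) \<le> e * norm h"
    if "I \<subseteq> Basis" "e > 0" for I e
    using finite_subset[OF that(1) finite_Basis] that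
  proof (induction I arbitrary: e rule: finite_induct)
    case empty
    then show ?case by (auto intro: exI[of _ 1])
  next
    case (insert c I)
    \<comment> \<open>The error e is shared out as e/4 for the coordinates already switched on, e/2
      for the variation along the new segment, and e/4 for moving the derivative from y back to
      x.\<close>
    obtain d1 where d1: "d1 > 0" "\<And>h. norm h < d1 \<Longrightarrow>
        norm (F (x + ?P I h) - F x - (\<Sum>b\<in>I. (h \<bullet> b) *\<^sub>R dir_deriv b F x)) \<le> e / 4 * norm h"
      using insert.IH[of "e/4"] insert.prems by auto
    obtain d2 where d2: "d2 > 0" "ball x d2 \<subseteq> S"
      using assms openE by blast
    have "continuous_on S (dir_deriv c F)"
      using assms(1) by simp
    then obtain d3 where d3: "d3 > 0"
      "\<And>y. y \<in> S \<Longrightarrow> dist y x < d3 \<Longrightarrow> dist (dir_deriv c F y) (dir_deriv c F x) < e/4"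
      using \<open>x \<in> S\<close> insert.prems(2) unfolding continuous_on_iff
      by (metis divide_pos_pos zero_less_numeral)
    define d where "d = min d1 (min d2 d3)"
    have "norm (F (x + ?P (insert c I) h) - F x - (\<Sum>b\<in>insert c I. (h \<bullet> b) *\<^sub>R dir_deriv b F x))
        \<le> e * norm h" if "norm h < d" for h
    proof -
      define y where "y = x + ?P I h"
      define T where "T = closed_segment 0 (h \<bullet> c)"
      \<comment> \<open>A point of the segment is a convex combination of the two projections
        \<open>?P I h\<close> and \<open>?P (insert c I) h\<close>, shifted by x.\<close>
      have near: "norm (y + t *\<^sub>R c - x) < d" if "t \<in> T" for t
      proof -
        have "y + t *\<^sub>R c - x = ?P (insert c I) (?P I h + t *\<^sub>R c)"
        proof -
          have "(?P I h + t *\<^sub>R c) \<bullet> b = (if b = c then t else h \<bullet> b)" if "b \<in> insert c I" for b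
          proof -
            have "?P I h \<bullet> b = (\<Sum>b'\<in>I. if b' = b then h \<bullet> b else 0)"
              unfolding inner_sum_left using that insert.prems
              by (intro sum.cong) (auto simp: inner_Basis subset_iff)
            then show ?thesis
              using that insert.prems insert.hyps
              by (auto simp: inner_add_left inner_Basis subset_iff)
          qed
          then have "?P (insert c I) (?P I h + t *\<^sub>R c) = (\<Sum>b\<in>insert c I. (if b = c then t else h \<bullet> b) *\<^sub>R b)"
            by (intro sum.cong) auto
          also have "\<dots> = t *\<^sub>R c + (\<Sum>b\<in>I. (if b = c then t else h \<bullet> b) *\<^sub>R b)"
            using insert.hyps by simp
          also have "(\<Sum>b\<in>I. (if b = c then t else h \<bullet> b) *\<^sub>R b) = ?P I h"
            using insert.hyps by (intro sum.cong) auto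
          finally show ?thesis by (simp add: y_def)
        qed
        obtain s where s: "0 \<le> s" "s \<le> 1" "t = s * (h \<bullet> c)"
          using \<open>t \<in> T\<close> by (auto simp: T_def in_segment)
        have "y + t *\<^sub>R c - x = (1 - s) *\<^sub>R ?P I h + s *\<^sub>R ?P (insert c I) h"
          using insert.hyps by (simp add: y_def s algebra_simps)
        then have "norm (y + t *\<^sub>R c - x) \<le> (1 - s) * norm (?P I h) + s * norm (?P (insert c I) h)"
          using s norm_triangle_ineq[of "(1 - s) *\<^sub>R ?P I h" "s *\<^sub>R ?P (insert c I) h"] by simp
        also have "\<dots> \<le> (1 - s) * norm h + s * norm h"
          using insert.prems s by (intro add_mono mult_left_mono nP) auto
        finally show ?thesis using \<open>norm h < d\<close> by (simp add: algebra_simps)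
      qed
      have inS: "y + t *\<^sub>R c \<in> S" and close: "dist (dir_deriv c F (y + t *\<^sub>R c)) (dir_deriv c F x) < e/4"
        if "t \<in> T" for t
      proof -
        have n: "dist (y + t *\<^sub>R c) x < d2" "dist (y + t *\<^sub>R c) x < d3"
          using near[OF that] by (auto simp: d_def dist_norm)
        then show "y + t *\<^sub>R c \<in> S" using d2 by (auto simp: dist_commute subset_iff)
        then show "dist (dir_deriv c F (y + t *\<^sub>R c)) (dir_deriv c F x) < e/4"
          using d3 n by blast
      qed
      have T0: "0 \<in> T" by (auto simp: T_def)
      have "norm (F (y + (h \<bullet> c) *\<^sub>R c) - F (y + 0 *\<^sub>R c) - (h \<bullet> c - 0) *\<^sub>R dir_deriv c F (y + 0 *\<^sub>R c))
          \<le> norm (h \<bullet> c - 0) * (e / 2)"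
      proof (rule vector_differentiable_bound_linearization[where S = T])
        show "((\<lambda>t. F (y + t *\<^sub>R c)) has_vector_derivative dir_deriv c F (y + t *\<^sub>R c)) (at t within T)"
          if "t \<in> T" for t
          by (rule has_vector_derivative_at_within, rule has_vector_derivative_on_line[OF assms(1)])
             (use inS[OF that] in auto)
        show "norm (dir_deriv c F (y + t *\<^sub>R c) - dir_deriv c F (y + 0 *\<^sub>R c)) \<le> e / 2" if "t \<in> T" for t
          using close[OF that] close[OF T0]
          by (simp add: dist_norm) norm
      qed (auto simp: T_def)
      then have "norm (F (y + (h \<bullet> c) *\<^sub>R c) - F y - (h \<bullet> c) *\<^sub>R dir_deriv c F y) \<le> norm (h \<bullet> c) * (e / 2)"
        by simp
      moreover have "norm ((h \<bullet> c) *\<^sub>R dir_deriv c F y - (h \<bullet> c) *\<^sub>R dir_deriv c F x) \<le> norm (h \<bullet> c) * (e/4)"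
      proof -
        have "norm (dir_deriv c F y - dir_deriv c F x) \<le> e / 4"
          using close[OF T0] by (simp add: dist_norm)
        then show ?thesis
          unfolding scaleR_diff_right[symmetric] norm_scaleR real_norm_def by (rule mult_left_mono) simp
      qed
      moreover have "norm (F y - F x - (\<Sum>b\<in>I. (h \<bullet> b) *\<^sub>R dir_deriv b F x)) \<le> e / 4 * norm h"
        using d1 that by (auto simp: d_def y_def)
      ultimately have "norm (F (y + (h \<bullet> c) *\<^sub>R c) - F x - (\<Sum>b\<in>I. (h \<bullet> b) *\<^sub>R dir_deriv b F x) - (h \<bullet> c) *\<^sub>R dir_deriv c F x)
          \<le> norm (h \<bullet> c) * (e / 2) + norm (h \<bullet> c) * (e / 4) + e / 4 * norm h"
        by (rule norm_triangle3)
      also have "\<dots> \<le> e * norm h"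
      proof -
        have "norm (h \<bullet> c) \<le> norm h"
          using insert.prems Basis_le_norm by auto
        then have "norm (h \<bullet> c) * e \<le> norm h * e"
          using insert.prems by (intro mult_right_mono) auto
        then show ?thesis by (simp add: mult.commute)
      qed
      also have "F (y + (h \<bullet> c) *\<^sub>R c) - F x - (\<Sum>b\<in>I. (h \<bullet> b) *\<^sub>R dir_deriv b F x) - (h \<bullet> c) *\<^sub>R dir_deriv c F x
         = F (x + ?P (insert c I) h) - F x - (\<Sum>b\<in>insert c I. (h \<bullet> b) *\<^sub>R dir_deriv b F x)"
        using insert.hyps by (simp add: y_def algebra_simps)
      finally show ?thesis .
    qed
    moreover have "d > 0" using d1 d2 d3 by (simp add: d_def)
    ultimately show ?case by blast
  qed
  show ?thesis
    unfolding has_derivative_at_alt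
  proof (intro conjI allI impI)
    show "bounded_linear (\<lambda>h. \<Sum>b\<in>Basis. (h \<bullet> b) *\<^sub>R dir_deriv b F x)"
      by (intro bounded_linear_sum bounded_linear_scaleR_const bounded_linear_inner_left)
    fix e :: real assume "e > 0"
    from main[OF order_refl this] obtain d where d: "d > 0" "\<And>h. norm h < d \<Longrightarrow>
        norm (F (x + h) - F x - (\<Sum>b\<in>Basis. (h \<bullet> b) *\<^sub>R dir_deriv b F x)) \<le> e * norm h"
      by (auto simp: euclidean_representation)
    then show "\<exists>d>0. \<forall>y. norm (y - x) < d \<longrightarrow>
        norm (F y - F x - (\<Sum>b\<in>Basis. ((y - x) \<bullet> b) *\<^sub>R dir_deriv b F x)) \<le> e * norm (y - x)"
      using d(1) d(2)[of "y - x" for y] by auto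
  qed
qed

section \<open>Chain rule, symmetry of derivatives and flatness\<close>

text \<open>Only the outer function lives on a Euclidean space. The inner one is used merely as the
  curve t \<mapsto> G (x + t w), so its domain may be any real vector space.\<close>

lemma has_dir_deriv_compose:
  fixes F :: "'e::euclidean_space \<Rightarrow> 'y::real_normed_vector" and G :: "'x::real_vector \<Rightarrow> 'e"
  assumes "Ck_on (Suc 0) UNIV T F" "open T" "G x \<in> T"
    and "((\<lambda>t. G (x + t *\<^sub>R w)) has_vector_derivative D) (at 0)"
  shows "((\<lambda>t. F (G (x + t *\<^sub>R w))) has_vector_derivative
      (\<Sum>b\<in>Basis. (D \<bullet> b) *\<^sub>R dir_deriv b F (G x))) (at 0)"
proof -
  have "(F has_derivative (\<lambda>h. \<Sum>b\<in>Basis. (h \<bullet> b) *\<^sub>R dir_deriv b F (G x)))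
      (at (G (x + 0 *\<^sub>R w)))"
    using Ck_on_imp_has_derivative[OF assms(1-3)] by (simp only: scaleR_zero_left add_0_right)
  from vector_derivative_diff_chain_within[OF assms(4) has_derivative_at_withinI[OF this]]
  show ?thesis by (simp add: o_def)
qed

lemma dir_deriv_basis_sum:
  fixes F :: "'e::euclidean_space \<Rightarrow> 'y::real_normed_vector"
  assumes "Ck_on (Suc 0) UNIV T F" "open T" "x \<in> T"
  shows "dir_deriv w F x = (\<Sum>b\<in>Basis. (w \<bullet> b) *\<^sub>R dir_deriv b F x)"
proof (rule dir_deriv_eqI)
  have "((\<lambda>t. x + t *\<^sub>R w) has_vector_derivative w) (at 0)"
    by (auto intro!: derivative_eq_intros)
  then show "((\<lambda>t. F (x + t *\<^sub>R w)) has_vector_derivative (\<Sum>b\<in>Basis. (w \<bullet> b) *\<^sub>R dir_deriv b F x)) (at 0)"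
    using has_dir_deriv_compose[OF assms(1,2), of "\<lambda>x. x" x w w] assms(3) by simp
qed

lemma Ck_on_compose:
  fixes F :: "'e::euclidean_space \<Rightarrow> 'y::real_normed_vector"
  assumes "Ck_on n UNIV T F" "open T" "G ` S \<subseteq> T" "Ck_on n W S G" "line_open W S"
  shows "Ck_on n W S (\<lambda>x. F (G x))"
  using assms(1,4)
proof (induction n arbitrary: F)
  case 0
  then show ?case using assms(3) by (auto intro: continuous_on_compose2)
next
  case (Suc n)
  note Ck_on.simps [simp del]
  show ?case
  proof (rule Ck_on_SucI[OF assms(5), where
        F' = "\<lambda>w x. \<Sum>b\<in>Basis. (dir_deriv w G x \<bullet> b) *\<^sub>R dir_deriv b F (G x)"])
    show "continuous_on S (\<lambda>x. F (G x))"
      using Suc.prems[THEN Ck_on_continuous] assms(3) by (auto intro: continuous_on_compose2)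
    show "((\<lambda>t. F (G (x + t *\<^sub>R w))) has_vector_derivative
        (\<Sum>b\<in>Basis. (dir_deriv w G x \<bullet> b) *\<^sub>R dir_deriv b F (G x))) (at 0)"
      if "w \<in> W" "x \<in> S" for w x
      using Suc.prems assms(2,3) that
      by (intro has_dir_deriv_compose[OF Ck_on_le[OF Suc.prems(1)]] Ck_on_has_dir_deriv) auto
    show "Ck_on n W S (\<lambda>x. \<Sum>b\<in>Basis. (dir_deriv w G x \<bullet> b) *\<^sub>R dir_deriv b F (G x))"
      if "w \<in> W" for w
      using Suc.prems that
      by (intro Ck_on_sum Ck_on_bounded_bilinear[OF bounded_bilinear_scaleR] assms(5) Suc.IH
          Ck_on_bounded_linear[OF bounded_linear_inner_left])
         (auto intro: Ck_on_dir_deriv dest: Ck_on_Suc_imp)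
  qed
qed

text \<open>The second difference over a parallelogram is symmetric in its two sides, yet the mean
  value theorem equates it, up to the factor h squared, with either mixed derivative at some nearby
  point. Continuity lets the parallelogram shrink to x.\<close>

lemma dir_deriv_commute:
  fixes F :: "'e::euclidean_space \<Rightarrow> real"
  assumes "Ck_on (Suc (Suc 0)) UNIV S F" "open S" "x \<in> S"
  shows "dir_deriv v (dir_deriv w F) x = dir_deriv w (dir_deriv v F) x"
proof -
  have key: "\<exists>y. norm (y - x) \<le> h * (norm v + norm w) \<and>
      F (x + h *\<^sub>R v + h *\<^sub>R w) - F (x + h *\<^sub>R v) - F (x + h *\<^sub>R w) + F x
        = h * (h * dir_deriv w (dir_deriv v F) y)"
    if h: "h > 0" "cball x (h * (norm v + norm w)) \<subseteq> S" for v w :: 'e and h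
  proof -
    have inS: "x + s *\<^sub>R v + t *\<^sub>R w \<in> cball x (h * (norm v + norm w))"
      if "0 \<le> s" "s \<le> h" "0 \<le> t" "t \<le> h" for s t
    proof -
      have "norm (s *\<^sub>R v + t *\<^sub>R w) \<le> norm (s *\<^sub>R v) + norm (t *\<^sub>R w)"
        by (rule norm_triangle_ineq)
      also have "\<dots> \<le> h * (norm v + norm w)"
        using that by (auto simp: distrib_left intro!: add_mono mult_right_mono)
      finally show ?thesis by (simp add: dist_norm algebra_simps norm_minus_commute)
    qed
    have d1: "((\<lambda>s. F (x + s *\<^sub>R v + t *\<^sub>R w)) has_real_derivative dir_deriv v F (x + s *\<^sub>R v + t *\<^sub>R w)) (at s)"
      if "0 \<le> s" "s \<le> h" "0 \<le> t" "t \<le> h" for s t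
    proof -
      have "((\<lambda>s. F ((x + t *\<^sub>R w) + s *\<^sub>R v)) has_vector_derivative dir_deriv v F ((x + t *\<^sub>R w) + s *\<^sub>R v)) (at s)"
        by (rule has_vector_derivative_on_line[OF Ck_on_le[OF assms(1)]])
           (use inS[OF that] h in \<open>auto simp: algebra_simps\<close>)
      then show ?thesis
        by (simp add: has_real_derivative_iff_has_vector_derivative algebra_simps)
    qed
    \<comment> \<open>Its increment from 0 to h is the second difference; one mean value step in
      direction v and a second one in direction w follow.\<close>
    define \<phi> where "\<phi> = (\<lambda>s. F (x + s *\<^sub>R v + h *\<^sub>R w) - F (x + s *\<^sub>R v + 0 *\<^sub>R w))"
    obtain s where s: "0 < s" "s < h" "\<phi> h - \<phi> 0 =
        (h - 0) * (dir_deriv v F (x + s *\<^sub>R v + h *\<^sub>R w) - dir_deriv v F (x + s *\<^sub>R v + 0 *\<^sub>R w))"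
      using MVT2[of 0 h \<phi> "\<lambda>s. dir_deriv v F (x + s *\<^sub>R v + h *\<^sub>R w) - dir_deriv v F (x + s *\<^sub>R v + 0 *\<^sub>R w)"]
        h unfolding \<phi>_def by (fastforce intro!: DERIV_diff d1)
    have d2: "((\<lambda>t. dir_deriv v F (x + s *\<^sub>R v + t *\<^sub>R w)) has_real_derivative
        dir_deriv w (dir_deriv v F) (x + s *\<^sub>R v + t *\<^sub>R w)) (at t)"
      if "0 \<le> t" "t \<le> h" for t
      unfolding has_real_derivative_iff_has_vector_derivative
      by (rule has_vector_derivative_on_line[OF Ck_on_dir_deriv[OF assms(1)]])
         (use inS[of s t] s that h in auto)
    obtain t where t: "0 < t" "t < h" "dir_deriv v F (x + s *\<^sub>R v + h *\<^sub>R w) - dir_deriv v F (x + s *\<^sub>R v + 0 *\<^sub>R w)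
        = (h - 0) * dir_deriv w (dir_deriv v F) (x + s *\<^sub>R v + t *\<^sub>R w)"
      using MVT2[OF h(1) d2] by auto
    have "norm (x + s *\<^sub>R v + t *\<^sub>R w - x) \<le> h * (norm v + norm w)"
      using inS[of s t] s t by (auto simp: dist_norm norm_minus_commute add.commute)
    then show ?thesis
      using s(3) t(3) by (intro exI[of _ "x + s *\<^sub>R v + t *\<^sub>R w"]) (simp add: \<phi>_def algebra_simps)
  qed
  have cont: "continuous_on S (dir_deriv v (dir_deriv w F))" "continuous_on S (dir_deriv w (dir_deriv v F))"
    using assms(1) by auto
  have "dist (dir_deriv v (dir_deriv w F) x) (dir_deriv w (dir_deriv v F) x) < e" if e: "e > 0" for e
  proof -
    obtain r where r: "r > 0" "ball x r \<subseteq> S"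
      using assms openE by blast
    obtain d1 where d1: "d1 > 0" "\<And>y. y \<in> S \<Longrightarrow> dist y x < d1 \<Longrightarrow>
        dist (dir_deriv v (dir_deriv w F) y) (dir_deriv v (dir_deriv w F) x) < e/2"
      using cont(1)[unfolded continuous_on_iff, rule_format, OF assms(3) half_gt_zero[OF e]] by blast
    obtain d2 where d2: "d2 > 0" "\<And>y. y \<in> S \<Longrightarrow> dist y x < d2 \<Longrightarrow>
        dist (dir_deriv w (dir_deriv v F) y) (dir_deriv w (dir_deriv v F) x) < e/2"
      using cont(2)[unfolded continuous_on_iff, rule_format, OF assms(3) half_gt_zero[OF e]] by blast
    define m where "m = min r (min d1 d2)"
    \<comment> \<open>The added 1 avoids a division by zero when v = w = 0 and makes the next bound
      strict.\<close>
    define h where "h = m / (norm v + norm w + 1)"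
    have m: "m > 0" using r d1 d2 by (simp add: m_def)
    have pos: "norm v + norm w + 1 > 0" by (smt (verit) norm_ge_zero)
    have h: "h > 0" "h * (norm v + norm w) < m"
      using m pos by (auto simp: h_def field_simps)
    have sub: "cball x (h * (norm v + norm w)) \<subseteq> S"
      using r h by (auto simp: m_def subset_iff)
    obtain y where y: "norm (y - x) \<le> h * (norm v + norm w)"
      "F (x + h *\<^sub>R v + h *\<^sub>R w) - F (x + h *\<^sub>R v) - F (x + h *\<^sub>R w) + F x
        = h * (h * dir_deriv w (dir_deriv v F) y)"
      using key[OF h(1) sub] by blast
    obtain z where z: "norm (z - x) \<le> h * (norm w + norm v)"
      "F (x + h *\<^sub>R w + h *\<^sub>R v) - F (x + h *\<^sub>R w) - F (x + h *\<^sub>R v) + F x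
        = h * (h * dir_deriv v (dir_deriv w F) z)"
      using key[of h w v] h(1) sub by (auto simp: add.commute)
    have "h * (h * dir_deriv w (dir_deriv v F) y) = h * (h * dir_deriv v (dir_deriv w F) z)"
      using y(2) z(2) by (simp add: algebra_simps)
    then have eq: "dir_deriv w (dir_deriv v F) y = dir_deriv v (dir_deriv w F) z"
      using h by simp
    have "dist y x < m" "dist z x < m"
      using y(1) z(1) h(2) by (auto simp: dist_norm add.commute)
    moreover from this have "y \<in> S" "z \<in> S"
      using r by (auto simp: m_def subset_iff dist_commute)
    ultimately have "dist (dir_deriv v (dir_deriv w F) z) (dir_deriv v (dir_deriv w F) x) < e/2"
      "dist (dir_deriv w (dir_deriv v F) y) (dir_deriv w (dir_deriv v F) x) < e/2"
      using d1 d2 by (auto simp: m_def)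
    then show ?thesis
      using eq unfolding dist_real_def by linarith
  qed
  then have "\<not> 0 < dist (dir_deriv v (dir_deriv w F) x) (dir_deriv w (dir_deriv v F) x)"
    by blast
  then show ?thesis by simp
qed

section \<open>Closure properties of smooth functions\<close>

lemma smooth_onI: "(\<And>n. Ck_on n W S F) \<Longrightarrow> smooth_on W S F"
  by (simp add: smooth_on_def)

lemma smooth_onD: "smooth_on W S F \<Longrightarrow> Ck_on n W S F"
  by (simp add: smooth_on_def)

lemma smooth_on_cong:
  "line_open W S \<Longrightarrow> (\<And>x. x \<in> S \<Longrightarrow> F x = G x) \<Longrightarrow> smooth_on W S F \<Longrightarrow> smooth_on W S G"
  by (auto simp: smooth_on_def intro: Ck_on_cong)

lemma smooth_on_subset: "smooth_on W S F \<Longrightarrow> T \<subseteq> S \<Longrightarrow> smooth_on W T F"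
  by (auto simp: smooth_on_def intro: Ck_on_subset)

lemma smooth_on_continuous: "smooth_on W S F \<Longrightarrow> continuous_on S F"
  by (auto simp: smooth_on_def intro: Ck_on_continuous)

lemma smooth_on_dir_deriv: "smooth_on W S F \<Longrightarrow> w \<in> W \<Longrightarrow> smooth_on W S (dir_deriv w F)"
  by (auto simp: smooth_on_def intro: Ck_on_dir_deriv)

lemma smooth_on_const: "line_open W S \<Longrightarrow> smooth_on W S (\<lambda>x. c)"
  by (auto simp: smooth_on_def intro: Ck_on_const)

lemma smooth_on_linear: "line_open W S \<Longrightarrow> linear L \<Longrightarrow> continuous_on S L \<Longrightarrow> smooth_on W S L"
  by (auto simp: smooth_on_def intro: Ck_on_linear)

lemma smooth_on_add:
  "line_open W S \<Longrightarrow> smooth_on W S F \<Longrightarrow> smooth_on W S G \<Longrightarrow> smooth_on W S (\<lambda>x. F x + G x)"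
  by (auto simp: smooth_on_def intro: Ck_on_add)

lemma smooth_on_sum:
  "line_open W S \<Longrightarrow> (\<And>i. i \<in> I \<Longrightarrow> smooth_on W S (F i)) \<Longrightarrow> smooth_on W S (\<lambda>x. \<Sum>i\<in>I. F i x)"
  by (auto simp: smooth_on_def intro: Ck_on_sum)

lemma smooth_on_bounded_bilinear:
  "bounded_bilinear b \<Longrightarrow> line_open W S \<Longrightarrow> smooth_on W S F \<Longrightarrow> smooth_on W S G \<Longrightarrow>
    smooth_on W S (\<lambda>x. b (F x) (G x))"
  by (auto simp: smooth_on_def intro: Ck_on_bounded_bilinear)

lemmas smooth_on_mult = smooth_on_bounded_bilinear[OF bounded_bilinear_mult]
  and smooth_on_scaleR = smooth_on_bounded_bilinear[OF bounded_bilinear_scaleR]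
  and smooth_on_inner = smooth_on_bounded_bilinear[OF bounded_bilinear_inner]

lemma smooth_on_bounded_linear:
  "bounded_linear L \<Longrightarrow> smooth_on W S F \<Longrightarrow> line_open W S \<Longrightarrow> smooth_on W S (\<lambda>x. L (F x))"
  by (auto simp: smooth_on_def intro: Ck_on_bounded_linear)

lemma smooth_on_diff:
  assumes "line_open W S" "smooth_on W S F" "smooth_on W S G"
  shows "smooth_on W S (\<lambda>x. F x - G x)"
  using smooth_on_add[OF assms(1,2) smooth_on_bounded_linear[OF bounded_linear_minus[OF bounded_linear_ident] assms(3,1)]]
  by simp

lemma smooth_on_inverse:
  fixes F :: "_ \<Rightarrow> real"
  shows "line_open W S \<Longrightarrow> smooth_on W S F \<Longrightarrow> (\<And>x. x \<in> S \<Longrightarrow> F x \<noteq> 0) \<Longrightarrow>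
    smooth_on W S (\<lambda>x. inverse (F x))"
  by (auto simp: smooth_on_def intro: Ck_on_inverse)

lemma smooth_on_compose:
  fixes F :: "'e::euclidean_space \<Rightarrow> 'y::real_normed_vector"
  shows "smooth_on UNIV T F \<Longrightarrow> open T \<Longrightarrow> G ` S \<subseteq> T \<Longrightarrow> smooth_on W S G \<Longrightarrow> line_open W S \<Longrightarrow>
    smooth_on W S (\<lambda>x. F (G x))"
  by (auto simp: smooth_on_def intro: Ck_on_compose)

lemma smooth_on_precompose_linear:
  "linear L \<Longrightarrow> continuous_on S L \<Longrightarrow> L ` S \<subseteq> S' \<Longrightarrow> L ` W \<subseteq> W' \<Longrightarrow> smooth_on W' S' F \<Longrightarrow>
    smooth_on W S (\<lambda>x. F (L x))"
  unfolding smooth_on_def by (intro allI) (rule Ck_on_precompose_linear[of L S S' W W' _ F]; simp)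

lemma smooth_on_locally:
  fixes F :: "'x::real_normed_vector \<Rightarrow> _"
  assumes "\<And>x. x \<in> S \<Longrightarrow> \<exists>T. open T \<and> x \<in> T \<and> smooth_on UNIV (S \<inter> T) F"
  shows "smooth_on UNIV S F"
  unfolding smooth_on_def
  by (intro allI Ck_on_locally) (use assms in \<open>auto simp: smooth_on_def\<close>)

lemma smooth_on_nth:
  "line_open W S \<Longrightarrow> smooth_on W S G \<Longrightarrow> smooth_on W S (\<lambda>x. G x $ i)"
  by (rule smooth_on_bounded_linear[OF bounded_linear_vec_nth])

lemma smooth_on_vec:
  fixes G :: "_ \<Rightarrow> real^'m::finite"
  assumes "line_open W S" "\<And>i. smooth_on W S (\<lambda>x. G x $ i)"
  shows "smooth_on W S G"
proof -
  have "smooth_on W S (\<lambda>x. \<Sum>i\<in>UNIV. (G x $ i) *\<^sub>R axis i (1::real))"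
    by (intro smooth_on_sum smooth_on_scaleR smooth_on_const assms)
  moreover have "(\<lambda>x. \<Sum>i\<in>UNIV. (G x $ i) *\<^sub>R axis i (1::real)) = G"
    by (simp add: vec_eq_iff axis_def fun_eq_iff if_distrib cong: if_cong)
  ultimately show ?thesis by simp
qed

lemma Basis_vec_real: "(Basis :: (real^'m::finite) set) = range (\<lambda>i. axis i 1)"
  by (auto simp: Basis_vec_def)

lemma sum_Basis_vec: "(\<Sum>b\<in>(Basis :: (real^'m::finite) set). f b) = (\<Sum>i\<in>UNIV. f (axis i 1))"
  unfolding Basis_vec_real by (subst sum.reindex) (auto simp: inj_on_def axis_eq_axis)

section \<open>Rules for directional and iterated partial derivatives\<close>

lemma has_dir_deriv_smooth_on:
  "smooth_on W S F \<Longrightarrow> w \<in> W \<Longrightarrow> x \<in> S \<Longrightarrow>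
    ((\<lambda>t. F (x + t *\<^sub>R w)) has_vector_derivative dir_deriv w F x) (at 0)"
  using Ck_on_has_dir_deriv smooth_onD by blast

lemma dir_deriv_add:
  "smooth_on W S F \<Longrightarrow> smooth_on W S G \<Longrightarrow> w \<in> W \<Longrightarrow> x \<in> S \<Longrightarrow>
    dir_deriv w (\<lambda>x. F x + G x) x = dir_deriv w F x + dir_deriv w G x"
  by (intro dir_deriv_eqI has_vector_derivative_add has_dir_deriv_smooth_on)

lemma dir_deriv_mult:
  fixes F G :: "_ \<Rightarrow> real"
  assumes "smooth_on W S F" "smooth_on W S G" "w \<in> W" "x \<in> S"
  shows "dir_deriv w (\<lambda>x. F x * G x) x = F x * dir_deriv w G x + dir_deriv w F x * G x"
  by (rule dir_deriv_eqI)
     (use has_vector_derivative_mult[OF has_dir_deriv_smooth_on[OF assms(1,3,4)]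
      has_dir_deriv_smooth_on[OF assms(2,3,4)]] in simp)

lemma dir_deriv_cmult:
  fixes F :: "_ \<Rightarrow> real"
  assumes "smooth_on W S F" "w \<in> W" "x \<in> S"
  shows "dir_deriv w (\<lambda>x. c * F x) x = c * dir_deriv w F x"
  by (intro dir_deriv_eqI has_vector_derivative_mult_right has_dir_deriv_smooth_on[OF assms])

lemma dir_deriv_const: "dir_deriv w (\<lambda>x. c) = (\<lambda>x. 0)"
  by (intro ext dir_deriv_eqI) auto

lemma dir_deriv_compose:
  fixes F :: "real^'m::finite \<Rightarrow> real"
  assumes "smooth_on UNIV T F" "open T" "G x \<in> T" "smooth_on W S G" "w \<in> W" "x \<in> S"
  shows "dir_deriv w (\<lambda>x. F (G x)) x =
    (\<Sum>i\<in>UNIV. dir_deriv (axis i 1) F (G x) * (dir_deriv w G x $ i))"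
proof (rule dir_deriv_eqI)
  show "((\<lambda>t. F (G (x + t *\<^sub>R w))) has_vector_derivative
      (\<Sum>i\<in>UNIV. dir_deriv (axis i 1) F (G x) * dir_deriv w G x $ i)) (at 0)"
    using has_dir_deriv_compose[OF smooth_onD[OF assms(1)] assms(2,3) has_dir_deriv_smooth_on[OF assms(4-6)]]
    by (simp add: sum_Basis_vec inner_axis mult.commute)
qed

text \<open>\<open>partial_deriv\<close> hides a list behind a choice; making the list explicit
  allows induction. The head of the list is the direction differentiated first.\<close>

definition pderivs :: "'m list \<Rightarrow> (real^'m::finite \<Rightarrow> real) \<Rightarrow> real^'m \<Rightarrow> real" where
  "pderivs is F = fold (\<lambda>i G. dir_deriv (axis i 1) G) is F"

lemma pderivs_Nil [simp]: "pderivs [] F = F"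
  and pderivs_Cons [simp]: "pderivs (i # is) F = pderivs is (dir_deriv (axis i 1) F)"
  by (auto simp: pderivs_def)

lemma smooth_on_pderivs: "smooth_on UNIV S F \<Longrightarrow> smooth_on UNIV S (pderivs is F)"
  by (induction "is" arbitrary: F) (auto intro: smooth_on_dir_deriv)

lemma pderivs_cong:
  assumes "open S" "x \<in> S" "\<And>x. x \<in> S \<Longrightarrow> F x = G x"
  shows "pderivs is F x = pderivs is G x"
  using assms(3)
proof (induction "is" arbitrary: F G)
  case (Cons i "is")
  show ?case unfolding pderivs_Cons
    by (rule Cons.IH) (use dir_deriv_cong[OF line_open_UNIV[OF assms(1)], of _ _ F G] Cons.prems in auto)
qed (use assms in auto)

lemma pderivs_add:
  assumes "open S" "x \<in> S" "smooth_on UNIV S F" "smooth_on UNIV S G"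
  shows "pderivs is (\<lambda>x. F x + G x) x = pderivs is F x + pderivs is G x"
  using assms(3,4)
proof (induction "is" arbitrary: F G)
  case (Cons i "is")
  have "pderivs is (dir_deriv (axis i 1) (\<lambda>x. F x + G x)) x =
      pderivs is (\<lambda>x. dir_deriv (axis i 1) F x + dir_deriv (axis i 1) G x) x"
    using dir_deriv_add[OF Cons.prems] by (intro pderivs_cong[OF assms(1,2)]) auto
  then show ?case using Cons by (simp add: smooth_on_dir_deriv)
qed auto

lemma pderivs_cmult:
  assumes "open S" "x \<in> S" "smooth_on UNIV S F"
  shows "pderivs is (\<lambda>x. c * F x) x = c * pderivs is F x"
  using assms(3)
proof (induction "is" arbitrary: F)
  case (Cons i "is")
  have "pderivs is (dir_deriv (axis i 1) (\<lambda>x. c * F x)) x =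
      pderivs is (\<lambda>x. c * dir_deriv (axis i 1) F x) x"
    using dir_deriv_cmult[OF Cons.prems] by (intro pderivs_cong[OF assms(1,2)]) auto
  then show ?case using Cons by (simp add: smooth_on_dir_deriv)
qed auto

lemma pderivs_zero: "pderivs is (\<lambda>x. 0) x = 0"
  by (induction "is") (auto simp: dir_deriv_const)

lemma pderivs_sum:
  assumes "open S" "x \<in> S" "\<And>l. l \<in> I \<Longrightarrow> smooth_on UNIV S (F l)"
  shows "pderivs is (\<lambda>x. \<Sum>l\<in>I. c l * F l x) x = (\<Sum>l\<in>I. c l * pderivs is (F l) x)"
  using assms(3)
proof (induction I rule: infinite_finite_induct)
  case (insert l I)
  have s: "smooth_on UNIV S (\<lambda>x. \<Sum>l\<in>I. c l * F l x)" "smooth_on UNIV S (\<lambda>x. c l * F l x)"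
    using insert.prems
    by (auto intro!: smooth_on_sum smooth_on_mult smooth_on_const line_open_UNIV assms(1))
  show ?case
    using insert pderivs_add[OF assms(1,2) s(2,1)] pderivs_cmult[OF assms(1,2), of "F l"] by simp
qed (auto simp: pderivs_zero)

text \<open>Repeated exchange of neighbouring directions brings i to the front; sorting lists this
  way proves independence of the order.\<close>

lemma pderivs_Cons_middle:
  assumes "open S" "x \<in> S" "smooth_on UNIV S F"
  shows "pderivs (is @ i # js) F x = pderivs (i # is @ js) F x"
  using assms(3)
proof (induction "is" arbitrary: F)
  case (Cons l "is")
  have "pderivs (is @ i # js) (dir_deriv (axis l 1) F) x =
      pderivs (is @ js) (dir_deriv (axis i 1) (dir_deriv (axis l 1) F)) x"
    using Cons.IH[of "dir_deriv (axis l 1) F"] Cons.prems by (simp add: smooth_on_dir_deriv)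
  also have "\<dots> = pderivs (is @ js) (dir_deriv (axis l 1) (dir_deriv (axis i 1) F)) x"
    using dir_deriv_commute[OF smooth_onD[OF Cons.prems] assms(1)]
    by (intro pderivs_cong[OF assms(1,2)])
  finally show ?case by simp
qed auto

lemma pderivs_permute:
  assumes "open S" "x \<in> S" "smooth_on UNIV S F" "mset is = mset js"
  shows "pderivs is F x = pderivs js F x"
  using assms(3,4)
proof (induction "is" arbitrary: F js)
  case (Cons i "is")
  then have "i \<in> set js" by (metis list.set_intros(1) mset_eq_setD)
  then obtain js1 js2 where js: "js = js1 @ i # js2" by (auto simp: in_set_conv_decomp)
  with Cons.prems have "mset is = mset (js1 @ js2)" by simp
  then have "pderivs is (dir_deriv (axis i 1) F) x = pderivs (js1 @ js2) (dir_deriv (axis i 1) F) x"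
    using Cons.prems by (intro Cons.IH) (auto intro: smooth_on_dir_deriv)
  then show ?case
    using pderivs_Cons_middle[OF assms(1,2) Cons.prems(1)] by (simp add: js)
qed auto

lemma partial_deriv_pderivs: "partial_deriv \<alpha> F = pderivs (SOME is. mset is = \<alpha>) F"
  by (simp add: partial_deriv_def pderivs_def)

text \<open>Removes the choice in \<open>partial_deriv\<close>: for smooth functions any enumeration
  of the multi-index gives the same value.\<close>

lemma partial_deriv_mset:
  assumes "open S" "x \<in> S" "smooth_on UNIV S F"
  shows "partial_deriv (mset is) F x = pderivs is F x"
  unfolding partial_deriv_pderivs
  by (rule pderivs_permute[OF assms]) (rule someI[of "\<lambda>js. mset js = mset is"], simp)

text \<open>Two smooth functions have the same n-jet exactly when their difference is flat to order
  n. In this form invariance under coordinate changes follows by induction, without a formula for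
  higher derivatives of a composition.\<close>

definition flat_at :: "nat \<Rightarrow> (real^'m::finite \<Rightarrow> real) \<Rightarrow> real^'m \<Rightarrow> bool" where
  "flat_at n F x \<longleftrightarrow> (\<forall>is. length is \<le> n \<longrightarrow> pderivs is F x = 0)"

lemma flat_at_0: "flat_at 0 F x \<longleftrightarrow> F x = 0"
  by (auto simp: flat_at_def)

lemma flat_at_Suc:
  "flat_at (Suc n) F x \<longleftrightarrow> F x = 0 \<and> (\<forall>i. flat_at n (dir_deriv (axis i 1) F) x)"
proof
  assume *: "F x = 0 \<and> (\<forall>i. flat_at n (dir_deriv (axis i 1) F) x)"
  show "flat_at (Suc n) F x" unfolding flat_at_def
  proof (intro allI impI)
    fix "is" :: "'a list" assume "length is \<le> Suc n"
    then show "pderivs is F x = 0" using * by (cases "is") (auto simp: flat_at_def)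
  qed
next
  assume *: "flat_at (Suc n) F x"
  have "pderivs (i # is) F x = 0" if "length is \<le> n" for i "is"
    using * that unfolding flat_at_def by (metis Suc_le_mono length_Cons)
  moreover have "pderivs [] F x = 0" using * unfolding flat_at_def by (metis le0 list.size(3))
  ultimately show "F x = 0 \<and> (\<forall>i. flat_at n (dir_deriv (axis i 1) F) x)"
    by (simp add: flat_at_def)
qed

lemma flat_at_SucD: "flat_at (Suc n) F x \<Longrightarrow> flat_at n F x"
  by (auto simp: flat_at_def)

lemma flat_at_cong:
  "open S \<Longrightarrow> x \<in> S \<Longrightarrow> (\<And>x. x \<in> S \<Longrightarrow> F x = G x) \<Longrightarrow> flat_at n F x \<Longrightarrow> flat_at n G x"
  unfolding flat_at_def using pderivs_cong[of S x F G] by metis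

lemma flat_at_add:
  "open S \<Longrightarrow> x \<in> S \<Longrightarrow> smooth_on UNIV S F \<Longrightarrow> smooth_on UNIV S G \<Longrightarrow>
    flat_at n F x \<Longrightarrow> flat_at n G x \<Longrightarrow> flat_at n (\<lambda>x. F x + G x) x"
  unfolding flat_at_def by (simp add: pderivs_add)

lemma flat_at_sum:
  assumes "open S" "x \<in> S" "\<And>i. i \<in> I \<Longrightarrow> smooth_on UNIV S (F i)"
    "\<And>i. i \<in> I \<Longrightarrow> flat_at n (F i) x"
  shows "flat_at n (\<lambda>x. \<Sum>i\<in>I. F i x) x"
  using assms(4) pderivs_sum[of S x I F _ "\<lambda>_. 1"] assms(1-3)
  unfolding flat_at_def by simp

text \<open>The flat functions form an ideal: the product rule leaves in each term either F, flat to
  a higher order than required, or a derivative of F, flat to one order less.\<close>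

lemma flat_at_mult:
  assumes "open S" "x \<in> S" "smooth_on UNIV S F" "smooth_on UNIV S G" "flat_at n F x"
  shows "flat_at n (\<lambda>x. F x * G x) x"
  using assms(3-5)
proof (induction n arbitrary: F G)
  case 0
  then show ?case by (auto simp: flat_at_0)
next
  case (Suc n)
  have "flat_at n (dir_deriv (axis i 1) (\<lambda>x. F x * G x)) x" for i
  proof (rule flat_at_cong[OF assms(1,2)])
    show "flat_at n (\<lambda>x. F x * dir_deriv (axis i 1) G x + dir_deriv (axis i 1) F x * G x) x"
      using Suc.prems assms(1,2)
      by (intro flat_at_add Suc.IH smooth_on_mult)
         (auto simp: flat_at_Suc line_open_UNIV intro: smooth_on_dir_deriv flat_at_SucD)
  qed (use dir_deriv_mult[OF Suc.prems(1,2)] in auto)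
  moreover have "F x * G x = 0" using Suc.prems by (simp add: flat_at_Suc)
  ultimately show ?case by (simp add: flat_at_Suc)
qed

text \<open>By the chain rule a first derivative is a sum of products whose factors
  \<open>dir_deriv (axis l 1) F (G x)\<close> are flat to one order less, so the ideal property
  finishes the induction.\<close>

lemma flat_at_compose:
  fixes G :: "real^'m::finite \<Rightarrow> real^'n::finite"
  assumes "open S" "x \<in> S" "open T" "G ` S \<subseteq> T" "smooth_on UNIV S G" "smooth_on UNIV T F"
    and "flat_at n F (G x)"
  shows "flat_at n (\<lambda>x. F (G x)) x"
  using assms(6,7)
proof (induction n arbitrary: F)
  case 0
  then show ?case by (auto simp: flat_at_0)
next
  case (Suc n)
  have "flat_at n (dir_deriv (axis i 1) (\<lambda>x. F (G x))) x" for i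
  proof (rule flat_at_cong[OF assms(1,2)])
    have sm: "smooth_on UNIV S (\<lambda>x. dir_deriv (axis l 1) F (G x))"
      "smooth_on UNIV S (\<lambda>x. dir_deriv (axis i 1) G x $ l)" for l
      using Suc.prems(1) assms(1-5)
      by (auto intro!: smooth_on_compose[where T = T] smooth_on_nth smooth_on_dir_deriv line_open_UNIV)
    show "flat_at n (\<lambda>x. \<Sum>l\<in>UNIV. dir_deriv (axis l 1) F (G x) * (dir_deriv (axis i 1) G x $ l)) x"
      using Suc.prems assms(1,2) sm
      by (intro flat_at_sum[OF assms(1,2)] flat_at_mult[OF assms(1,2)] Suc.IH smooth_on_mult)
         (auto simp: flat_at_Suc line_open_UNIV intro: smooth_on_dir_deriv)
    show "(\<Sum>l\<in>UNIV. dir_deriv (axis l 1) F (G y) * (dir_deriv (axis i 1) G y $ l)) =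
        dir_deriv (axis i 1) (\<lambda>x. F (G x)) y" if "y \<in> S" for y
      using dir_deriv_compose[OF Suc.prems(1) assms(3) _ assms(5) UNIV_I that] assms(4) that by auto
  qed
  moreover have "F (G x) = 0" using Suc.prems by (simp add: flat_at_Suc)
  ultimately show ?case by (simp add: flat_at_Suc)
qed

section \<open>Manifolds and derivations\<close>

text \<open>Hadamard's quotients are the case k = 0. The weight t^k makes the family closed under
  differentiation, since each derivative in z brings out one more factor t.\<close>

definition radial_integral ::
    "'e::euclidean_space \<Rightarrow> nat \<Rightarrow> ('e \<Rightarrow> real) \<Rightarrow> 'e \<Rightarrow> real" where
  "radial_integral p k F z = integral {0..1} (\<lambda>t. t ^ k * F (p + t *\<^sub>R (z - p)))"

lemma radial_in_ball:
  fixes p z :: "'e::real_normed_vector"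
  assumes "z \<in> ball p r" "t \<in> {0..1::real}" shows "p + t *\<^sub>R (z - p) \<in> ball p r"
proof -
  have "t * norm (z - p) \<le> 1 * norm (z - p)" using assms by (intro mult_right_mono) auto
  then show ?thesis using assms by (auto simp: dist_norm norm_minus_commute)
qed

lemma continuous_on_radial:
  fixes F :: "'e::real_normed_vector \<Rightarrow> real"
  assumes "continuous_on (ball p r) F"
  shows "continuous_on (ball p r \<times> {0..1}) (\<lambda>(z, t). t ^ k * F (p + t *\<^sub>R (z - p)))"
  unfolding split_def
proof (intro continuous_on_mult continuous_on_compose2[OF assms])
  show "(\<lambda>x. p + snd x *\<^sub>R (fst x - p)) ` (ball p r \<times> {0..1}) \<subseteq> ball p r"
    using radial_in_ball[of _ p r] by (fastforce simp del: mem_ball)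
qed (intro continuous_intros)+

text \<open>Differentiation under the integral sign turns the integral for k into the one for
  \<open>Suc k\<close>, hence the induction with k arbitrary.\<close>

lemma Ck_on_radial_integral:
  fixes F :: "'e::euclidean_space \<Rightarrow> real"
  assumes "Ck_on n UNIV (ball p r) F"
  shows "Ck_on n UNIV (ball p r) (radial_integral p k F)"
  using assms
proof (induction n arbitrary: F k)
  case 0
  then show ?case
    using integral_continuous_on_param[of "ball p r" 0 "1::real" "\<lambda>z t. t ^ k * F (p + t *\<^sub>R (z - p))"]
      continuous_on_radial[of p r F k]
    by (simp add: radial_integral_def[abs_def])
next
  case (Suc n)
  note Ck_on.simps [simp del]
  show ?case
  proof (rule Ck_on_SucI[OF line_open_UNIV[OF open_ball],
        where F' = "\<lambda>w. radial_integral p (Suc k) (dir_deriv w F)"])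
    show "continuous_on (ball p r) (radial_integral p k F)"
      using Suc.IH[OF Ck_on_Suc_imp[OF Suc.prems]] by (rule Ck_on_continuous)
    show "Ck_on n UNIV (ball p r) (radial_integral p (Suc k) (dir_deriv w F))" for w
      using Suc.IH[OF Ck_on_dir_deriv[OF Suc.prems UNIV_I]] .
    fix w z :: 'e assume z: "z \<in> ball p r"
    have "\<forall>\<^sub>F s in nhds (0::real). z + s *\<^sub>R w \<in> ball p r"
      using line_open_UNIV[OF open_ball, of p r] z unfolding line_open_def by blast
    then obtain e where e: "e > 0" "\<And>s. \<bar>s\<bar> < e \<Longrightarrow> z + s *\<^sub>R w \<in> ball p r"
      unfolding eventually_nhds_metric by (auto simp: dist_real_def simp del: mem_ball)
    \<comment> \<open>An open interval: Leibniz' rule asks for a convex parameter set, and openness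
      turns the derivative within it into a two-sided one.\<close>
    define U where "U = {-e<..<e}"
    have U: "open U" "convex U" "0 \<in> U" "\<And>s. s \<in> U \<Longrightarrow> z + s *\<^sub>R w \<in> ball p r"
      using e by (auto simp: U_def abs_less_iff)
    have "((\<lambda>s. integral (cbox 0 1) (\<lambda>t. t ^ k * F (p + t *\<^sub>R (z + s *\<^sub>R w - p)))) has_vector_derivative
        integral (cbox 0 1) (\<lambda>t. t ^ Suc k * dir_deriv w F (p + t *\<^sub>R (z + 0 *\<^sub>R w - p)))) (at 0 within U)"
    proof (rule leibniz_rule_vector_derivative[OF _ _ _ U(3,2), where fx =
          "\<lambda>s t. t ^ Suc k * dir_deriv w F (p + t *\<^sub>R (z + s *\<^sub>R w - p))"])
      show "((\<lambda>s. t ^ k * F (p + t *\<^sub>R (z + s *\<^sub>R w - p))) has_vector_derivative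
          t ^ Suc k * dir_deriv w F (p + t *\<^sub>R (z + s *\<^sub>R w - p))) (at s within U)"
        if "s \<in> U" "t \<in> cbox 0 1" for s t
      proof -
        \<comment> \<open>For fixed t the point moves in direction w with speed t, which produces
          the additional factor t.\<close>
        have eq: "p + t *\<^sub>R (z + s *\<^sub>R w - p) = (p + t *\<^sub>R (z - p)) + (t * s) *\<^sub>R w" for s
          by (simp add: algebra_simps)
        have "(p + t *\<^sub>R (z - p)) + (t * s) *\<^sub>R w \<in> ball p r"
          using radial_in_ball[OF U(4)[OF that(1)], of t] that(2) by (simp add: algebra_simps)
        from has_vector_derivative_on_line[OF Suc.prems UNIV_I this]
        have "((\<lambda>s. F ((p + t *\<^sub>R (z - p)) + s *\<^sub>R w)) has_vector_derivative
            dir_deriv w F ((p + t *\<^sub>R (z - p)) + (t * s) *\<^sub>R w)) (at (t * s))" .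
        moreover have "((\<lambda>s. t * s) has_vector_derivative t) (at s)"
          by (auto intro!: derivative_eq_intros)
        ultimately have "((\<lambda>s. F ((p + t *\<^sub>R (z - p)) + (t * s) *\<^sub>R w)) has_vector_derivative
            t *\<^sub>R dir_deriv w F ((p + t *\<^sub>R (z - p)) + (t * s) *\<^sub>R w)) (at s)"
          using vector_diff_chain_at[of "\<lambda>s. t * s" t s "\<lambda>s. F ((p + t *\<^sub>R (z - p)) + s *\<^sub>R w)"]
          by (simp add: o_def)
        then have "((\<lambda>s. F (p + t *\<^sub>R (z + s *\<^sub>R w - p))) has_vector_derivative
            t * dir_deriv w F (p + t *\<^sub>R (z + s *\<^sub>R w - p))) (at s within U)"
          unfolding eq by (auto intro: has_vector_derivative_at_within)
        from has_vector_derivative_mult_right[OF this, of "t ^ k"]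
        show ?thesis by (simp add: mult_ac)
      qed
      show "(\<lambda>t. t ^ k * F (p + t *\<^sub>R (z + s *\<^sub>R w - p))) integrable_on cbox 0 1" if "s \<in> U" for s
        by (intro integrable_continuous continuous_intros
            continuous_on_compose2[OF Ck_on_continuous[OF Suc.prems]])
           (use radial_in_ball[OF U(4)[OF that]] in auto)
      show "continuous_on (U \<times> cbox 0 1)
          (\<lambda>(s, t). t ^ Suc k * dir_deriv w F (p + t *\<^sub>R (z + s *\<^sub>R w - p)))"
        unfolding split_def
        by (intro continuous_intros
            continuous_on_compose2[OF Ck_on_continuous[OF Ck_on_dir_deriv[OF Suc.prems UNIV_I]]])
           (use radial_in_ball[OF U(4)] in auto)
    qed
    then show "((\<lambda>t. radial_integral p k F (z + t *\<^sub>R w)) has_vector_derivative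
        radial_integral p (Suc k) (dir_deriv w F) z) (at 0)"
      unfolding at_within_open[OF U(3,1)] radial_integral_def cbox_interval scaleR_zero_left add_0_right .
  qed
qed

text \<open>Integrate the derivative of F along the segment from p to z and pull the factors z_i -
  p_i out of the integral. The smooth remainders are what allows a derivation to be applied term by
  term.\<close>

lemma Hadamard_lemma:
  fixes F :: "real^'m::finite \<Rightarrow> real"
  assumes F: "smooth_on UNIV (ball p r) F"
  shows "\<exists>g. (\<forall>i. smooth_on UNIV (ball p r) (g i)) \<and>
    (\<forall>z\<in>ball p r. F z = F p + (\<Sum>i\<in>UNIV. (z $ i - p $ i) * g i z)) \<and>
    (\<forall>i. g i p = dir_deriv (axis i 1) F p)"
proof (intro exI conjI allI ballI)
  let ?D = "\<lambda>i. dir_deriv (axis i 1) F"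
  let ?g = "\<lambda>i. radial_integral p 0 (?D i)"
  show "smooth_on UNIV (ball p r) (?g i)" for i
    by (rule smooth_onI, rule Ck_on_radial_integral, rule smooth_onD, rule smooth_on_dir_deriv[OF F UNIV_I])
  show "?g i p = ?D i p" for i
    by (simp add: radial_integral_def)
  fix z assume z: "z \<in> ball p r"
  have ftc: "((\<lambda>t. dir_deriv (z - p) F (p + t *\<^sub>R (z - p))) has_integral
      F (p + 1 *\<^sub>R (z - p)) - F (p + 0 *\<^sub>R (z - p))) {0..1}"
  proof (rule fundamental_theorem_of_calculus)
    fix t :: real assume "t \<in> {0..1}"
    from has_vector_derivative_on_line[OF smooth_onD[OF F] UNIV_I radial_in_ball[OF z this]]
    show "((\<lambda>t. F (p + t *\<^sub>R (z - p))) has_vector_derivative dir_deriv (z - p) F (p + t *\<^sub>R (z - p)))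
        (at t within {0..1})" by (rule has_vector_derivative_at_within)
  qed simp
  have dd: "dir_deriv (z - p) F (p + t *\<^sub>R (z - p)) =
      (\<Sum>i\<in>UNIV. (z $ i - p $ i) * ?D i (p + t *\<^sub>R (z - p)))" if "t \<in> {0..1}" for t
    by (subst dir_deriv_basis_sum[OF smooth_onD[OF F] open_ball radial_in_ball[OF z that]])
       (simp add: sum_Basis_vec inner_axis)
  have "((\<lambda>t. \<Sum>i\<in>UNIV. (z $ i - p $ i) * ?D i (p + t *\<^sub>R (z - p))) has_integral F z - F p) {0..1}"
    using has_integral_eq[OF dd ftc] by simp
  moreover have "((\<lambda>t. \<Sum>i\<in>UNIV. (z $ i - p $ i) * ?D i (p + t *\<^sub>R (z - p))) has_integral
      (\<Sum>i\<in>UNIV. (z $ i - p $ i) * ?g i z)) {0..1}"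
  proof (intro has_integral_sum has_integral_mult_right finite)
    fix i
    have "continuous_on {0..1} (\<lambda>t. ?D i (p + t *\<^sub>R (z - p)))"
      by (rule continuous_on_compose2[OF smooth_on_continuous[OF smooth_on_dir_deriv[OF F UNIV_I]]])
         (use radial_in_ball[OF z] in \<open>auto intro!: continuous_intros\<close>)
    then show "((\<lambda>t. ?D i (p + t *\<^sub>R (z - p))) has_integral ?g i z) {0..1}"
      by (auto simp: radial_integral_def has_integral_integral[symmetric] intro: integrable_continuous_real)
  qed
  ultimately have "F z - F p = (\<Sum>i\<in>UNIV. (z $ i - p $ i) * ?g i z)"
    by (rule has_integral_unique)
  then show "F z = F p + (\<Sum>i\<in>UNIV. (z $ i - p $ i) * ?g i z)"
    by simp
qed

section \<open>Charts and smooth functions on the manifold\<close>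

locale smooth_manifold =
  fixes \<A> :: "('a::{t2_space,second_countable_topology}, 'm::finite) chart set"
  assumes smooth_atlas: "smooth_atlas \<A>"
begin

lemma chart_at: obtains U \<phi> where "(U, \<phi>) \<in> \<A>" "x \<in> U"
  using smooth_atlas unfolding smooth_atlas_def by blast

lemma chart_homeomorphism: "(U, \<phi>) \<in> \<A> \<Longrightarrow> homeomorphism U (\<phi> ` U) \<phi> (inv_into U \<phi>)"
  using smooth_atlas unfolding smooth_atlas_def by blast

lemma chart_open: "(U, \<phi>) \<in> \<A> \<Longrightarrow> open U"
  using smooth_atlas unfolding smooth_atlas_def by blast

lemma chart_continuous: "(U, \<phi>) \<in> \<A> \<Longrightarrow> continuous_on U \<phi>"
  using chart_homeomorphism homeomorphism_cont1 by blast

lemma chart_inv_continuous: "(U, \<phi>) \<in> \<A> \<Longrightarrow> continuous_on (\<phi> ` U) (inv_into U \<phi>)"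
  using chart_homeomorphism homeomorphism_cont2 by blast

lemma chart_inv: "(U, \<phi>) \<in> \<A> \<Longrightarrow> x \<in> U \<Longrightarrow> inv_into U \<phi> (\<phi> x) = x"
  using chart_homeomorphism homeomorphism_apply1 by blast

lemma chart_inj: "(U, \<phi>) \<in> \<A> \<Longrightarrow> inj_on \<phi> U"
  using chart_inv by (metis inj_onI)

lemma chart_image_open:
  assumes "(U, \<phi>) \<in> \<A>" "open S" shows "open (\<phi> ` (U \<inter> S))"
proof -
  have "openin (top_of_set U) (U \<inter> S)" using assms(2) by (simp add: openin_open_Int)
  then have "openin (top_of_set (\<phi> ` U)) (\<phi> ` (U \<inter> S))"
    by (rule homeomorphism_imp_open_map[OF chart_homeomorphism[OF assms(1)]])
  moreover have "open (\<phi> ` U)"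
    using assms(1) smooth_atlas unfolding smooth_atlas_def by blast
  ultimately show ?thesis by (simp add: openin_open_eq)
qed

lemma chart_line_open: "(U, \<phi>) \<in> \<A> \<Longrightarrow> open S \<Longrightarrow> line_open UNIV (\<phi> ` (U \<inter> S))"
  by (rule line_open_UNIV[OF chart_image_open])

lemma chart_transition:
  "(U, \<phi>) \<in> \<A> \<Longrightarrow> (V, \<psi>) \<in> \<A> \<Longrightarrow> smooth_on UNIV (\<phi> ` (U \<inter> V)) (\<lambda>z. \<psi> (inv_into U \<phi> z))"
  using smooth_atlas unfolding smooth_atlas_def o_def by fast

lemma smooth_funI:
  "(\<And>U \<phi>. (U, \<phi>) \<in> \<A> \<Longrightarrow> smooth_on UNIV (\<phi> ` (U \<inter> S)) (\<lambda>z. f (inv_into U \<phi> z))) \<Longrightarrow> smooth_fun \<A> S f"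
  by (auto simp: smooth_fun_def o_def)

lemma smooth_funD:
  "smooth_fun \<A> S f \<Longrightarrow> (U, \<phi>) \<in> \<A> \<Longrightarrow> smooth_on UNIV (\<phi> ` (U \<inter> S)) (\<lambda>z. f (inv_into U \<phi> z))"
  by (auto simp: smooth_fun_def o_def)

lemma smooth_fun_const: "open S \<Longrightarrow> smooth_fun \<A> S (\<lambda>x. c)"
  by (rule smooth_funI) (intro smooth_on_const chart_line_open)

lemma smooth_fun_add:
  "open S \<Longrightarrow> smooth_fun \<A> S f \<Longrightarrow> smooth_fun \<A> S g \<Longrightarrow> smooth_fun \<A> S (\<lambda>x. f x + g x)"
  by (rule smooth_funI) (intro smooth_on_add chart_line_open smooth_funD)

lemma smooth_fun_diff:
  "open S \<Longrightarrow> smooth_fun \<A> S f \<Longrightarrow> smooth_fun \<A> S g \<Longrightarrow> smooth_fun \<A> S (\<lambda>x. f x - g x)"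
  by (rule smooth_funI) (intro smooth_on_diff chart_line_open smooth_funD)

lemma smooth_fun_mult:
  "open S \<Longrightarrow> smooth_fun \<A> S f \<Longrightarrow> smooth_fun \<A> S g \<Longrightarrow> smooth_fun \<A> S (\<lambda>x. f x * g x)"
  by (rule smooth_funI) (intro smooth_on_mult chart_line_open smooth_funD)

lemma smooth_fun_sum:
  "open S \<Longrightarrow> (\<And>i. i \<in> I \<Longrightarrow> smooth_fun \<A> S (f i)) \<Longrightarrow> smooth_fun \<A> S (\<lambda>x. \<Sum>i\<in>I. f i x)"
  by (rule smooth_funI) (intro smooth_on_sum chart_line_open smooth_funD)

lemma smooth_fun_subset: "smooth_fun \<A> S f \<Longrightarrow> T \<subseteq> S \<Longrightarrow> smooth_fun \<A> T f"
  by (rule smooth_funI, rule smooth_on_subset[OF smooth_funD]) auto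

lemma smooth_fun_cong:
  assumes "open S" "\<And>x. x \<in> S \<Longrightarrow> f x = g x" "smooth_fun \<A> S f" shows "smooth_fun \<A> S g"
proof (rule smooth_funI)
  fix U \<phi> assume U: "(U, \<phi>) \<in> \<A>"
  show "smooth_on UNIV (\<phi> ` (U \<inter> S)) (\<lambda>z. g (inv_into U \<phi> z))"
    by (rule smooth_on_cong[OF chart_line_open[OF U assms(1)] _ smooth_funD[OF assms(3) U]])
       (use assms(2) chart_inv[OF U] in auto)
qed

lemma smooth_fun_locally:
  assumes "\<And>x. x \<in> S \<Longrightarrow> \<exists>T. open T \<and> x \<in> T \<and> smooth_fun \<A> (S \<inter> T) f"
  shows "smooth_fun \<A> S f"
proof (rule smooth_funI, rule smooth_on_locally)
  fix U \<phi> z assume U: "(U, \<phi>) \<in> \<A>" and "z \<in> \<phi> ` (U \<inter> S)"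
  then obtain x where x: "x \<in> U" "x \<in> S" "z = \<phi> x" by auto
  then obtain T where T: "open T" "x \<in> T" "smooth_fun \<A> (S \<inter> T) f" using assms by blast
  have "\<phi> ` (U \<inter> S) \<inter> \<phi> ` (U \<inter> T) = \<phi> ` (U \<inter> (S \<inter> T))"
    using chart_inj[OF U] by (auto simp: inj_on_def)
  with T x show "\<exists>T. open T \<and> z \<in> T \<and> smooth_on UNIV (\<phi> ` (U \<inter> S) \<inter> T) (\<lambda>z. f (inv_into U \<phi> z))"
    using chart_image_open[OF U T(1)] smooth_funD[OF T(3) U] by (intro exI[of _ "\<phi> ` (U \<inter> T)"]) auto
qed

text \<open>Smoothness in the one chart \<phi> is enough, because every other local expression
  arises from it by composing with a transition map.\<close>

lemma smooth_fun_chart_comp: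
  assumes "(U, \<phi>) \<in> \<A>" "open S" "S \<subseteq> U" "smooth_on UNIV (\<phi> ` S) F"
  shows "smooth_fun \<A> S (\<lambda>x. F (\<phi> x))"
proof (rule smooth_funI)
  fix V \<psi> assume V: "(V, \<psi>) \<in> \<A>"
  show "smooth_on UNIV (\<psi> ` (V \<inter> S)) (\<lambda>z. F (\<phi> (inv_into V \<psi> z)))"
  proof (rule smooth_on_compose[OF assms(4)])
    show "open (\<phi> ` S)" using chart_image_open[OF assms(1,2)] assms(3) by (simp add: Int_absorb1)
    show "smooth_on UNIV (\<psi> ` (V \<inter> S)) (\<lambda>z. \<phi> (inv_into V \<psi> z))"
      by (rule smooth_on_subset[OF chart_transition[OF V assms(1)]]) (use assms(3) in auto)
  qed (use chart_inv[OF V] chart_line_open[OF V assms(2)] in auto)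
qed

lemma smooth_fun_coord: "(U, \<phi>) \<in> \<A> \<Longrightarrow> smooth_fun \<A> U (\<lambda>x. \<phi> x $ i)"
  using chart_image_open[of U \<phi> UNIV]
  by (intro smooth_fun_chart_comp smooth_on_linear line_open_UNIV)
     (auto simp: chart_open linear_iff intro!: continuous_intros)

lemma smooth_fun_continuous:
  assumes "open S" "smooth_fun \<A> S f" shows "continuous_on S f"
proof -
  have "continuous (at x) f" if "x \<in> S" for x
  proof -
    obtain U \<phi> where U: "(U, \<phi>) \<in> \<A>" "x \<in> U" by (rule chart_at)
    have "continuous_on (U \<inter> S) (\<lambda>x. f (inv_into U \<phi> (\<phi> x)))"
      using smooth_on_continuous[OF smooth_funD[OF assms(2) U(1)]]
      by (rule continuous_on_compose2) (auto intro: continuous_on_subset[OF chart_continuous[OF U(1)]])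
    then have "continuous_on (U \<inter> S) f"
      using chart_inv[OF U(1)] by (subst (asm) continuous_on_cong[OF refl, of _ _ f]) auto
    then show ?thesis
      using that U chart_open[OF U(1)] assms(1) by (simp add: continuous_on_eq_continuous_at open_Int)
  qed
  then show ?thesis by (simp add: continuous_at_imp_continuous_on)
qed

lemma smooth_nearI: "open S \<Longrightarrow> x \<in> S \<Longrightarrow> smooth_fun \<A> S f \<Longrightarrow> smooth_near \<A> x f"
  by (auto simp: smooth_near_def)

lemma smooth_near_cong:
  assumes "smooth_near \<A> x f" "open S" "x \<in> S" "\<And>y. y \<in> S \<Longrightarrow> f y = g y"
  shows "smooth_near \<A> x g"
proof -
  obtain T where T: "open T" "x \<in> T" "smooth_fun \<A> T f"
    using assms(1) by (auto simp: smooth_near_def)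
  show ?thesis
    by (rule smooth_nearI[of "S \<inter> T"])
       (use T assms smooth_fun_cong[of "S \<inter> T" f g] smooth_fun_subset[of T f "S \<inter> T"] in auto)
qed

lemma smooth_near_common:
  assumes "smooth_near \<A> x f" "smooth_near \<A> x g"
  obtains S where "open S" "x \<in> S" "smooth_fun \<A> S f" "smooth_fun \<A> S g"
proof -
  obtain S T where "open S" "x \<in> S" "smooth_fun \<A> S f" "open T" "x \<in> T" "smooth_fun \<A> T g"
    using assms by (auto simp: smooth_near_def)
  then show ?thesis by (intro that[of "S \<inter> T"]) (auto intro: smooth_fun_subset)
qed

lemma smooth_near_const: "smooth_near \<A> x (\<lambda>y. c)"
  by (rule smooth_nearI[OF open_UNIV UNIV_I smooth_fun_const[OF open_UNIV]])

lemma smooth_near_add: "smooth_near \<A> x f \<Longrightarrow> smooth_near \<A> x g \<Longrightarrow> smooth_near \<A> x (\<lambda>y. f y + g y)"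
  by (erule (1) smooth_near_common) (rule smooth_nearI, assumption+, rule smooth_fun_add)

lemma smooth_near_mult: "smooth_near \<A> x f \<Longrightarrow> smooth_near \<A> x g \<Longrightarrow> smooth_near \<A> x (\<lambda>y. f y * g y)"
  by (erule (1) smooth_near_common) (rule smooth_nearI, assumption+, rule smooth_fun_mult)

lemma smooth_near_sum:
  "(\<And>i. i \<in> I \<Longrightarrow> smooth_near \<A> x (f i)) \<Longrightarrow> smooth_near \<A> x (\<lambda>y. \<Sum>i\<in>I. f i y)"
  by (induction I rule: infinite_finite_induct) (auto intro: smooth_near_const smooth_near_add)

section \<open>Tangent vectors as derivations\<close>

lemma tangent_add:
  "v \<in> tangent_space \<A> x \<Longrightarrow> smooth_near \<A> x f \<Longrightarrow> smooth_near \<A> x g \<Longrightarrow>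
    v (\<lambda>y. f y + g y) = v f + v g"
  by (simp add: tangent_space_def)

lemma tangent_mult:
  "v \<in> tangent_space \<A> x \<Longrightarrow> smooth_near \<A> x f \<Longrightarrow> smooth_near \<A> x g \<Longrightarrow>
    v (\<lambda>y. f y * g y) = f x * v g + g x * v f"
  by (simp add: tangent_space_def)

lemma tangent_cmult:
  "v \<in> tangent_space \<A> x \<Longrightarrow> smooth_near \<A> x f \<Longrightarrow> v (\<lambda>y. c * f y) = c * v f"
  by (simp add: tangent_space_def)

text \<open>The product rule for 1 * 1 gives v 1 = 2 v 1.\<close>

lemma tangent_const:
  assumes "v \<in> tangent_space \<A> x" shows "v (\<lambda>y. c) = 0"
proof -
  have "v (\<lambda>y. 1) = 0"
    using tangent_mult[OF assms smooth_near_const[of _ 1] smooth_near_const[of _ 1]] by simp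
  then show ?thesis
    using tangent_cmult[OF assms smooth_near_const[of _ 1], of c] by simp
qed

lemma tangent_sum:
  assumes "v \<in> tangent_space \<A> x" "\<And>i. i \<in> I \<Longrightarrow> smooth_near \<A> x (f i)"
  shows "v (\<lambda>y. \<Sum>i\<in>I. f i y) = (\<Sum>i\<in>I. v (f i))"
  using assms(2)
  by (induction I rule: infinite_finite_induct)
     (simp_all add: tangent_const[OF assms(1)] tangent_add[OF assms(1)] smooth_near_sum)

text \<open>Multiplying by the indicator of a neighbourhood makes two functions with the same germ
  equal, and a derivation is unaffected by this.\<close>

lemma tangent_local:
  assumes v: "v \<in> tangent_space \<A> x" and S: "open S" "x \<in> S" "\<And>y. y \<in> S \<Longrightarrow> f y = g y"
  shows "v f = v g"
proof (cases "smooth_near \<A> x f")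
  case False
  then have "\<not> smooth_near \<A> x g" using smooth_near_cong[of x g S f] S by auto
  with False v show ?thesis by (simp add: tangent_space_def)
next
  case True
  then have g: "smooth_near \<A> x g" by (rule smooth_near_cong) (use S in auto)
  let ?h = "\<lambda>y. if y \<in> S then 1 else 0 :: real"
  have h: "smooth_near \<A> x ?h"
    by (rule smooth_near_cong[OF smooth_near_const[of _ 1] S(1,2)]) auto
  \<comment> \<open>The indicator is idempotent with value 1 at x, so the product rule reads v h = 2
    v h.\<close>
  have "v ?h = 0"
    using tangent_mult[OF v h h] S(2) by (simp add: if_distrib cong: if_cong)
  then have "v (\<lambda>y. f y * ?h y) = v f" "v (\<lambda>y. g y * ?h y) = v g"
    using tangent_mult[OF v True h] tangent_mult[OF v g h] S(2) by auto
  moreover have "(\<lambda>y. f y * ?h y) = (\<lambda>y. g y * ?h y)" using S(3) by auto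
  ultimately show ?thesis by simp
qed

text \<open>In Hadamard's expansion the factors \<phi>_i - \<phi>_i(x) vanish at x, so the product
  rule keeps only v \<phi>_i times the remainder at x, which is the partial derivative. A tangent
  vector is thus determined by its values on coordinate functions.\<close>

lemma tangent_coords:
  assumes v: "v \<in> tangent_space \<A> x" and U: "(U, \<phi>) \<in> \<A>" "x \<in> U" and f: "smooth_near \<A> x f"
  shows "v f = (\<Sum>i\<in>UNIV. v (\<lambda>y. \<phi> y $ i) * dir_deriv (axis i 1) (\<lambda>z. f (inv_into U \<phi> z)) (\<phi> x))"
proof -
  obtain S where S: "open S" "x \<in> S" "smooth_fun \<A> S f"
    using f by (auto simp: smooth_near_def)
  let ?F = "\<lambda>z. f (inv_into U \<phi> z)"
  have "open (\<phi> ` (U \<inter> S))" "\<phi> x \<in> \<phi> ` (U \<inter> S)"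
    using chart_image_open[OF U(1) S(1)] U S by auto
  then obtain r where r: "r > 0" "ball (\<phi> x) r \<subseteq> \<phi> ` (U \<inter> S)"
    using openE by blast
  have "smooth_on UNIV (ball (\<phi> x) r) ?F"
    by (rule smooth_on_subset[OF smooth_funD[OF S(3) U(1)] r(2)])
  then obtain g where g: "\<And>i. smooth_on UNIV (ball (\<phi> x) r) (g i)"
    "\<And>z. z \<in> ball (\<phi> x) r \<Longrightarrow> ?F z = ?F (\<phi> x) + (\<Sum>i\<in>UNIV. (z $ i - \<phi> x $ i) * g i z)"
    "\<And>i. g i (\<phi> x) = dir_deriv (axis i 1) ?F (\<phi> x)"
    using Hadamard_lemma[of "\<phi> x" r ?F] by blast
  define T where "T = U \<inter> \<phi> -` ball (\<phi> x) r"
  have T: "open T" "x \<in> T" "T \<subseteq> U"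
    using continuous_open_preimage[OF chart_continuous[OF U(1)] chart_open[OF U(1)] open_ball] U r
    by (auto simp: T_def)
  have "\<phi> ` T \<subseteq> ball (\<phi> x) r" by (auto simp: T_def)
  then have gn: "smooth_near \<A> x (\<lambda>y. g i (\<phi> y))" for i
    by (intro smooth_nearI[OF T(1,2)] smooth_fun_chart_comp[OF U(1) T(1,3)] smooth_on_subset[OF g(1)])
  have cn: "smooth_near \<A> x (\<lambda>y. \<phi> y $ i)" for i
    using U chart_open by (intro smooth_nearI[OF _ _ smooth_fun_coord]) auto
  \<comment> \<open>The difference is written as a sum with a constant so that the additivity rules
    apply to it literally.\<close>
  have dn: "smooth_near \<A> x (\<lambda>y. \<phi> y $ i + - \<phi> x $ i)" for i
    by (intro smooth_near_add cn smooth_near_const)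
  have vd: "v (\<lambda>y. \<phi> y $ i + - \<phi> x $ i) = v (\<lambda>y. \<phi> y $ i)" for i
    using tangent_add[OF v cn[of i] smooth_near_const[of _ "- \<phi> x $ i"]]
      tangent_const[OF v, of "- \<phi> x $ i"] by simp
  have "v f = v (\<lambda>y. f x + (\<Sum>i\<in>UNIV. (\<phi> y $ i + - \<phi> x $ i) * g i (\<phi> y)))"
  proof (rule tangent_local[OF v T(1,2)])
    fix y assume "y \<in> T"
    then show "f y = f x + (\<Sum>i\<in>UNIV. (\<phi> y $ i + - \<phi> x $ i) * g i (\<phi> y))"
      using g(2)[of "\<phi> y"] chart_inv[OF U(1)] U(2) by (simp add: T_def)
  qed
  also have "\<dots> = v (\<lambda>y. \<Sum>i\<in>UNIV. (\<phi> y $ i + - \<phi> x $ i) * g i (\<phi> y))"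
  proof -
    have "smooth_near \<A> x (\<lambda>y. \<Sum>i\<in>UNIV. (\<phi> y $ i + - \<phi> x $ i) * g i (\<phi> y))"
      by (intro smooth_near_sum smooth_near_mult dn gn)
    from tangent_add[OF v smooth_near_const[of _ "f x"] this] show ?thesis
      using tangent_const[OF v, of "f x"] by simp
  qed
  also have "\<dots> = (\<Sum>i\<in>UNIV. v (\<lambda>y. (\<phi> y $ i + - \<phi> x $ i) * g i (\<phi> y)))"
    by (intro tangent_sum[OF v] smooth_near_mult dn gn)
  also have "\<dots> = (\<Sum>i\<in>UNIV. v (\<lambda>y. \<phi> y $ i) * g i (\<phi> x))"
    using tangent_mult[OF v dn gn] vd by (simp add: mult.commute)
  finally show ?thesis using g(3) by simp
qed

lemma chart_pull_smooth:
  assumes "(U, \<phi>) \<in> \<A>" "open S" "smooth_fun \<A> S f"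
  shows "smooth_fun \<A> (U \<inter> S) (\<lambda>x. pderivs is (\<lambda>z. f (inv_into U \<phi> z)) (\<phi> x))"
  using assms chart_open[OF assms(1)]
  by (intro smooth_fun_chart_comp[OF assms(1)] smooth_on_pderivs smooth_funD) auto

lemma vector_field_tangent: "smooth_vector_field \<A> V \<xi> \<Longrightarrow> x \<in> V \<Longrightarrow> \<xi> x \<in> tangent_space \<A> x"
  by (simp add: smooth_vector_field_def)

lemma vector_field_smooth:
  "smooth_vector_field \<A> V \<xi> \<Longrightarrow> open S \<Longrightarrow> S \<subseteq> V \<Longrightarrow> smooth_fun \<A> S f \<Longrightarrow>
    smooth_fun \<A> S (\<lambda>x. \<xi> x f)"
  by (simp add: smooth_vector_field_def)

text \<open>The outer field also differentiates the coefficients of the inner one, whence the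
  first-order terms. The formula shows that a second Lie derivative at x depends only on the 2-jet
  of f, linearly and with coefficients smooth in x.\<close>

lemma second_derivative_coords:
  assumes \<xi>: "smooth_vector_field \<A> V \<xi>" and \<eta>: "smooth_vector_field \<A> V \<eta>" and V: "open V" "x \<in> V"
    and U: "(U, \<phi>) \<in> \<A>" "x \<in> U" and f: "smooth_near \<A> x f"
  shows "\<xi> x (\<lambda>y. \<eta> y f) =
    (\<Sum>j\<in>UNIV. \<Sum>i\<in>UNIV. \<xi> x (\<lambda>y. \<phi> y $ i) * \<eta> x (\<lambda>y. \<phi> y $ j) *
        pderivs [j, i] (\<lambda>z. f (inv_into U \<phi> z)) (\<phi> x)) +
    (\<Sum>j\<in>UNIV. \<xi> x (\<lambda>y. \<eta> y (\<lambda>y. \<phi> y $ j)) * pderivs [j] (\<lambda>z. f (inv_into U \<phi> z)) (\<phi> x))"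
proof -
  obtain S where S: "open S" "x \<in> S" "smooth_fun \<A> S f"
    using f by (auto simp: smooth_near_def)
  let ?F = "\<lambda>z. f (inv_into U \<phi> z)"
  let ?D = "\<lambda>j. dir_deriv (axis j 1) ?F"
  have v: "\<xi> x \<in> tangent_space \<A> x" using vector_field_tangent[OF \<xi> V(2)] .
  have c: "smooth_near \<A> x (\<lambda>y. \<eta> y (\<lambda>y. \<phi> y $ j))" for j
    by (rule smooth_nearI[of "U \<inter> V"], use V U chart_open[OF U(1)] in \<open>auto intro!: vector_field_smooth[OF \<eta>]
        smooth_fun_subset[OF smooth_fun_coord[OF U(1)]]\<close>)
  have d: "smooth_near \<A> x (\<lambda>y. ?D j (\<phi> y))" for j
    using chart_pull_smooth[OF U(1) S(1,3), of "[j]"] chart_open[OF U(1)] U S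
    by (intro smooth_nearI[of "U \<inter> S"]) auto
  have e: "\<xi> x (\<lambda>y. ?D j (\<phi> y)) = (\<Sum>i\<in>UNIV. \<xi> x (\<lambda>y. \<phi> y $ i) * pderivs [j, i] ?F (\<phi> x))" for j
  proof -
    have "dir_deriv w (\<lambda>z. ?D j (\<phi> (inv_into U \<phi> z))) (\<phi> x) = dir_deriv w (?D j) (\<phi> x)" for w
      by (rule dir_deriv_cong[OF chart_line_open[OF U(1) open_UNIV]])
         (use U in \<open>auto simp: f_inv_into_f\<close>)
    then show ?thesis using tangent_coords[OF v U d] by simp
  qed
  \<comment> \<open>The coordinate expansion of \<eta> holds at all points near x, hence as an
    equality of germs that \<xi> may differentiate.\<close>
  have "\<xi> x (\<lambda>y. \<eta> y f) = \<xi> x (\<lambda>y. \<Sum>j\<in>UNIV. \<eta> y (\<lambda>y. \<phi> y $ j) * ?D j (\<phi> y))"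
  proof (rule tangent_local[OF v, of "U \<inter> (V \<inter> S)"])
    fix y assume "y \<in> U \<inter> (V \<inter> S)"
    then show "\<eta> y f = (\<Sum>j\<in>UNIV. \<eta> y (\<lambda>y. \<phi> y $ j) * ?D j (\<phi> y))"
      using S by (intro tangent_coords vector_field_tangent[OF \<eta>] U smooth_nearI[of S]) auto
  qed (use chart_open[OF U(1)] U V S in auto)
  also have "\<dots> = (\<Sum>j\<in>UNIV. \<eta> x (\<lambda>y. \<phi> y $ j) * \<xi> x (\<lambda>y. ?D j (\<phi> y)) +
      ?D j (\<phi> x) * \<xi> x (\<lambda>y. \<eta> y (\<lambda>y. \<phi> y $ j)))"
    by (simp only: tangent_sum[OF v smooth_near_mult[OF c d]] tangent_mult[OF v c d])
  also have "\<dots> = (\<Sum>j\<in>UNIV. \<eta> x (\<lambda>y. \<phi> y $ j) * (\<Sum>i\<in>UNIV. \<xi> x (\<lambda>y. \<phi> y $ i) * pderivs [j, i] ?F (\<phi> x)) +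
      ?D j (\<phi> x) * \<xi> x (\<lambda>y. \<eta> y (\<lambda>y. \<phi> y $ j)))"
    by (simp only: e)
  finally show ?thesis
    by (simp add: sum.distrib sum_distrib_left mult_ac)
qed

end

section \<open>Dual families and minimal solutions\<close>

lemma sum_fun_apply: "(\<Sum>i\<in>I. F i) x = (\<Sum>i\<in>I. F i x)"
  by (induction I rule: infinite_finite_induct) auto

lemma span_image_eq_range_sum:
  fixes v :: "'i \<Rightarrow> 'v::real_vector"
  assumes "finite I"
  shows "span (v ` I) = range (\<lambda>c. \<Sum>i\<in>I. c i *\<^sub>R v i)"
proof
  have "subspace (range (\<lambda>c. \<Sum>i\<in>I. c i *\<^sub>R v i))"
    unfolding subspace_def
  proof (intro conjI ballI allI)
    show "0 \<in> range (\<lambda>c. \<Sum>i\<in>I. c i *\<^sub>R v i)"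
      by (rule range_eqI[of _ _ "\<lambda>_. 0"]) simp
    fix x y assume "x \<in> range (\<lambda>c. \<Sum>i\<in>I. c i *\<^sub>R v i)" "y \<in> range (\<lambda>c. \<Sum>i\<in>I. c i *\<^sub>R v i)"
    then obtain c d where "x = (\<Sum>i\<in>I. c i *\<^sub>R v i)" "y = (\<Sum>i\<in>I. d i *\<^sub>R v i)" by auto
    then show "x + y \<in> range (\<lambda>c. \<Sum>i\<in>I. c i *\<^sub>R v i)"
      by (intro range_eqI[of _ _ "\<lambda>i. c i + d i"]) (simp add: scaleR_add_left sum.distrib)
  next
    fix r :: real and x assume "x \<in> range (\<lambda>c. \<Sum>i\<in>I. c i *\<^sub>R v i)"
    then obtain c where "x = (\<Sum>i\<in>I. c i *\<^sub>R v i)" by auto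
    then show "r *\<^sub>R x \<in> range (\<lambda>c. \<Sum>i\<in>I. c i *\<^sub>R v i)"
      by (intro range_eqI[of _ _ "\<lambda>i. r * c i"]) (simp add: scaleR_sum_right)
  qed
  moreover have "v ` I \<subseteq> range (\<lambda>c. \<Sum>i\<in>I. c i *\<^sub>R v i)"
  proof
    fix x assume "x \<in> v ` I"
    then obtain j where j: "j \<in> I" "x = v j" by auto
    have "(\<Sum>i\<in>I. (if i = j then 1 else 0) *\<^sub>R v i) = (\<Sum>i\<in>I. if i = j then v j else 0)"
      by (intro sum.cong) auto
    also have "\<dots> = v j"
      using assms j by simp
    finally show "x \<in> range (\<lambda>c. \<Sum>i\<in>I. c i *\<^sub>R v i)"
      using j by (intro range_eqI[of _ _ "\<lambda>i. if i = j then 1 else 0"]) simp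
  qed
  ultimately show "span (v ` I) \<subseteq> range (\<lambda>c. \<Sum>i\<in>I. c i *\<^sub>R v i)"
    by (rule span_minimal[rotated])
  show "range (\<lambda>c. \<Sum>i\<in>I. c i *\<^sub>R v i) \<subseteq> span (v ` I)"
    by (auto intro!: span_sum span_scale intro: span_base)
qed

text \<open>Injectivity records what passing to the image set forgets: a repeated vector is exposed
  by the coefficients 1 and -1 on its two indices.\<close>

lemma lin_indep_family_iff_independent:
  assumes "finite I"
  shows "lin_indep_family I v \<longleftrightarrow> inj_on v I \<and> independent (v ` I)"
proof
  assume L: "lin_indep_family I v"
  have inj: "inj_on v I"
  proof (rule inj_onI, rule ccontr)
    fix i j assume ij: "i \<in> I" "j \<in> I" "v i = v j" "i \<noteq> j"
    define c where "c = (\<lambda>l. if l = i then 1 else if l = j then -1 else 0 :: real)"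
    have "(\<Sum>l\<in>I. c l *\<^sub>R v l) = (\<Sum>l\<in>I. if l = i then v i else 0) + (\<Sum>l\<in>I. if l = j then - v j else 0)"
      unfolding sum.distrib[symmetric] using ij by (intro sum.cong) (auto simp: c_def)
    also have "\<dots> = 0" using ij assms by simp
    finally have "c i = 0" using L ij unfolding lin_indep_family_def by blast
    then show False by (simp add: c_def)
  qed
  moreover have "independent (v ` I)"
  proof (subst independent_explicit_finite_subsets, intro allI impI ballI)
    fix S u s assume S: "S \<subseteq> v ` I" "finite S" "(\<Sum>x\<in>S. u x *\<^sub>R x) = 0" "s \<in> S"
    define J where "J = {i \<in> I. v i \<in> S}"
    have vJ: "v ` J = S" and J: "J \<subseteq> I" "inj_on v J"
      using S inj by (auto simp: J_def inj_on_def)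
    have "(\<Sum>i\<in>I. (if i \<in> J then u (v i) else 0) *\<^sub>R v i) = (\<Sum>i\<in>J. u (v i) *\<^sub>R v i)"
      using J assms by (intro sum.mono_neutral_cong_right) auto
    also have "\<dots> = (\<Sum>x\<in>S. u x *\<^sub>R x)"
      unfolding vJ[symmetric] using J by (subst sum.reindex) auto
    finally have z: "(\<Sum>i\<in>I. (if i \<in> J then u (v i) else 0) *\<^sub>R v i) = 0"
      unfolding S(3) .
    have "\<forall>i\<in>I. (if i \<in> J then u (v i) else 0) = 0"
      using L[unfolded lin_indep_family_def, rule_format, OF z] by blast
    then show "u s = 0" using S(4) vJ J by (auto split: if_splits)
  qed
  ultimately show "inj_on v I \<and> independent (v ` I)" by simp
next
  assume R: "inj_on v I \<and> independent (v ` I)"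
  show "lin_indep_family I v" unfolding lin_indep_family_def
  proof (intro allI impI ballI)
    fix c i assume c: "(\<Sum>i\<in>I. c i *\<^sub>R v i) = 0" and i: "i \<in> I"
    have "(\<Sum>x\<in>v ` I. c (the_inv_into I v x) *\<^sub>R x) = (\<Sum>i\<in>I. c i *\<^sub>R v i)"
      using R by (subst sum.reindex) (auto simp: the_inv_into_f_f)
    then have "\<forall>x\<in>v ` I. c (the_inv_into I v x) = 0"
      using conjunct2[OF R, unfolded independent_explicit_finite_subsets, rule_format,
          of "v ` I" "\<lambda>x. c (the_inv_into I v x)"] c assms by auto
    then show "c i = 0" using R i by (auto simp: the_inv_into_f_f)
  qed
qed

lemma lin_indep_family_insertD:
  assumes "finite I" "a \<notin> I" "lin_indep_family (insert a I) v"
  shows "lin_indep_family I v" "v a \<notin> span (v ` I)"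
  using assms unfolding lin_indep_family_iff_independent[OF assms(1)]
    lin_indep_family_iff_independent[OF finite.insertI[OF assms(1)]]
  by (auto simp: independent_insert split: if_splits dest: span_base)

text \<open>A dimension count: \<open>card I\<close> vectors spanning a space of dimension at least
  \<open>card I\<close> must be independent. For two frames this transfers freeness from a single
  inclusion of spans.\<close>

lemma lin_indep_family_of_span:
  fixes v w :: "'i \<Rightarrow> 'v::euclidean_space"
  assumes "finite I" "lin_indep_family I w" "w ` I \<subseteq> span (v ` I)"
  shows "lin_indep_family I v" "span (v ` I) = span (w ` I)"
proof -
  have w: "inj_on w I" "independent (w ` I)"
    using assms(1,2) by (auto simp: lin_indep_family_iff_independent)
  have "card (w ` I) \<le> card (v ` I)"
    using independent_span_bound[OF _ w(2) assms(3)] assms(1) by simp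
  moreover have "card (w ` I) = card I" using w(1) by (rule card_image)
  ultimately have card: "card (v ` I) = card I"
    using card_image_le[OF assms(1), of v] by simp
  then have "inj_on v I" using assms(1) by (simp add: inj_on_iff_eq_card)
  have dim: "card (w ` I) \<le> dim (span (v ` I))"
    using dim_subset[OF assms(3)] dim_eq_card_independent[OF w(2)] by simp
  have "independent (v ` I)"
    using card dim \<open>card (w ` I) = card I\<close> assms(1)
    by (intro card_le_dim_spanning[of "v ` I" "span (v ` I)"]) (auto intro: span_base)
  with \<open>inj_on v I\<close> show "lin_indep_family I v"
    using assms(1) by (simp add: lin_indep_family_iff_independent)
  have "span (v ` I) \<subseteq> span (w ` I)"
    using assms(1,3) card \<open>card (w ` I) = card I\<close> w(2) dim_le_card[of "span (v ` I)" "v ` I"]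
    by (intro card_ge_dim_independent[of "w ` I" "span (v ` I)"]) auto
  moreover have "span (w ` I) \<subseteq> span (v ` I)"
    by (rule span_minimal[OF assms(3) subspace_span])
  ultimately show "span (v ` I) = span (w ` I)" by blast
qed

text \<open>Gram-Schmidt: a new vector only requires a division by the squared length of its component
  orthogonal to the previous ones, which does not vanish.\<close>

lemma smooth_dual_family:
  fixes v :: "'i \<Rightarrow> 'x::{real_vector,topological_space} \<Rightarrow> 'v::euclidean_space"
  assumes "finite I" and W: "line_open W S" and "\<And>i. i \<in> I \<Longrightarrow> smooth_on W S (v i)"
    and "\<And>x. x \<in> S \<Longrightarrow> lin_indep_family I (\<lambda>i. v i x)"
  shows "\<exists>d. \<forall>i\<in>I. smooth_on W S (d i) \<and> (\<forall>x\<in>S. d i x \<in> span ((\<lambda>i. v i x) ` I) \<and>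
    (\<forall>j\<in>I. d i x \<bullet> v j x = (if i = j then 1 else 0)))"
  using assms(1,3,4)
proof (induction I rule: finite_induct)
  case empty
  then show ?case by auto
next
  case (insert a I)
  let ?v = "\<lambda>x i. v i x"
  have ind: "lin_indep_family I (?v x)" and notin: "v a x \<notin> span (?v x ` I)" if "x \<in> S" for x
    using lin_indep_family_insertD[OF insert.hyps insert.prems(2)[OF that]] by auto
  obtain d where d: "\<And>i. i \<in> I \<Longrightarrow> smooth_on W S (d i)"
    "\<And>i x. i \<in> I \<Longrightarrow> x \<in> S \<Longrightarrow> d i x \<in> span (?v x ` I)"
    "\<And>i j x. i \<in> I \<Longrightarrow> j \<in> I \<Longrightarrow> x \<in> S \<Longrightarrow> d i x \<bullet> v j x = (if i = j then 1 else 0)"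
    using insert.IH[OF insert.prems(1)[OF insertI2] ind] by blast
  \<comment> \<open>The subtracted sum is the orthogonal projection of v_a onto the span of the
    other vectors: expanded in the dual family, its coefficients are inner products with the
    v_i.\<close>
  define e where "e = (\<lambda>x. v a x - (\<Sum>i\<in>I. (v a x \<bullet> v i x) *\<^sub>R d i x))"
  define da where "da = (\<lambda>x. inverse (e x \<bullet> e x) *\<^sub>R e x)"
  \<comment> \<open>The correction makes the old dual vectors orthogonal to v_a and leaves their
    other pairings alone, because \<open>da\<close> is orthogonal to every old v_j.\<close>
  define d' where "d' = (\<lambda>i x. if i = a then da x else d i x - (d i x \<bullet> v a x) *\<^sub>R da x)"
  have es: "smooth_on W S e" unfolding e_def
    using insert.prems(1) d(1)
    by (intro smooth_on_diff smooth_on_sum smooth_on_scaleR smooth_on_inner W) auto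
  have ev: "e x \<bullet> v j x = 0" if "j \<in> I" "x \<in> S" for j x
  proof -
    have "(\<Sum>i\<in>I. (v a x \<bullet> v i x) * (d i x \<bullet> v j x)) = (\<Sum>i\<in>I. if i = j then v a x \<bullet> v j x else 0)"
      using d(3)[OF _ that] by (intro sum.cong) auto
    then show ?thesis
      using that insert.hyps by (simp add: e_def inner_diff_left inner_sum_left)
  qed
  have psp: "(\<Sum>i\<in>I. (v a x \<bullet> v i x) *\<^sub>R d i x) \<in> span (?v x ` I)" if "x \<in> S" for x
    using d(2) that by (intro span_sum span_scale) auto
  have eperp: "e x \<bullet> y = 0" if "y \<in> span (?v x ` I)" "x \<in> S" for x y
    using that(1)
  proof (induction rule: span_induct_alt)
    case (step c z y)
    then show ?case using ev that(2) by (auto simp: inner_add_right)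
  qed simp
  have enz: "e x \<bullet> e x \<noteq> 0" if "x \<in> S" for x
  proof
    assume "e x \<bullet> e x = 0"
    then have "v a x = (\<Sum>i\<in>I. (v a x \<bullet> v i x) *\<^sub>R d i x)" by (simp add: e_def)
    then show False using psp[OF that] notin[OF that] by metis
  qed
  have eva: "e x \<bullet> v a x = e x \<bullet> e x" if "x \<in> S" for x
  proof -
    have "v a x = e x + (\<Sum>i\<in>I. (v a x \<bullet> v i x) *\<^sub>R d i x)" by (simp add: e_def)
    then show ?thesis
      using eperp[OF psp[OF that] that] by (metis add.right_neutral inner_add_right)
  qed
  have das: "smooth_on W S da" unfolding da_def
    by (intro smooth_on_scaleR smooth_on_inverse smooth_on_inner W es enz)
  have dav: "da x \<bullet> v j x = (if j = a then 1 else 0)" if "j \<in> insert a I" "x \<in> S" for j x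
    using that ev eva enz insert.hyps by (auto simp: da_def)
  have sub: "span (?v x ` I) \<subseteq> span (?v x ` insert a I)" for x
    by (intro span_mono) auto
  have "e x \<in> span (?v x ` insert a I)" if "x \<in> S" for x
    unfolding e_def using psp[OF that] sub by (intro span_diff) (auto intro: span_base)
  then have dasp: "da x \<in> span (?v x ` insert a I)" if "x \<in> S" for x
    using that unfolding da_def by (intro span_scale)
  have "smooth_on W S (d' i)" if "i \<in> insert a I" for i
  proof (cases "i = a")
    case True
    then show ?thesis using das by (simp add: d'_def)
  next
    case False
    then have "smooth_on W S (\<lambda>x. d i x - (d i x \<bullet> v a x) *\<^sub>R da x)"
      using that d(1) das insert.prems(1)
      by (intro smooth_on_diff smooth_on_scaleR smooth_on_inner W) auto
    then show ?thesis using False by (simp add: d'_def)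
  qed
  moreover have "d' i x \<in> span (?v x ` insert a I)" if "i \<in> insert a I" "x \<in> S" for i x
    using that d(2) sub dasp by (auto simp: d'_def intro!: span_diff span_scale)
  moreover have "d' i x \<bullet> v j x = (if i = j then 1 else 0)"
    if "i \<in> insert a I" "j \<in> insert a I" "x \<in> S" for i j x
    using that d(3) dav insert.hyps by (auto simp: d'_def inner_diff_left)
  ultimately show ?case by (intro exI[of _ d']) auto
qed

lemma dual_family:
  fixes v :: "'i \<Rightarrow> 'v::euclidean_space"
  assumes "finite I" "lin_indep_family I v"
  obtains d where "\<And>i. i \<in> I \<Longrightarrow> d i \<in> span (v ` I)"
    "\<And>i j. i \<in> I \<Longrightarrow> j \<in> I \<Longrightarrow> d i \<bullet> v j = (if i = j then 1 else 0)"
proof -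
  \<comment> \<open>A single family is treated as a constant, hence smooth, family over the real
    line.\<close>
  have "\<exists>d. \<forall>i\<in>I. smooth_on UNIV UNIV (d i) \<and> (\<forall>x::real\<in>UNIV. d i x \<in> span ((\<lambda>i. v i) ` I) \<and>
      (\<forall>j\<in>I. d i x \<bullet> v j = (if i = j then 1 else 0)))"
    by (rule smooth_dual_family[OF assms(1) line_open_UNIV[OF open_UNIV]])
       (rule smooth_on_const[OF line_open_UNIV[OF open_UNIV]], rule assms(2))
  then obtain d where d: "\<forall>i\<in>I. smooth_on UNIV UNIV (d i) \<and> (\<forall>x::real\<in>UNIV. d i x \<in> span ((\<lambda>i. v i) ` I) \<and>
      (\<forall>j\<in>I. d i x \<bullet> v j = (if i = j then 1 else 0)))" ..
  show ?thesis by (rule that[of "\<lambda>i. d i 0"]) (use d in simp_all)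
qed

text \<open>Paired with the dual family of the limit, the vectors give a matrix close to the
  identity; strict diagonal dominance makes it injective.\<close>

lemma eventually_lin_indep_family:
  fixes v :: "'b \<Rightarrow> 'i \<Rightarrow> 'v::euclidean_space"
  assumes "finite I" "lin_indep_family I l" "\<And>i. i \<in> I \<Longrightarrow> ((\<lambda>x. v x i) \<longlongrightarrow> l i) F"
  shows "\<forall>\<^sub>F x in F. lin_indep_family I (v x)"
proof -
  obtain d where d: "\<And>i j. i \<in> I \<Longrightarrow> j \<in> I \<Longrightarrow> d i \<bullet> l j = (if i = j then 1 else 0)"
    using dual_family[OF assms(1,2)] by metis
  \<comment> \<open>Any bound below 1 / \<open>card I\<close> would do; the added 1 also covers the
    empty index set.\<close>
  define e where "e = 1 / (real (card I) + 1)"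
  have "e > 0" by (simp add: e_def)
  have "\<forall>\<^sub>F x in F. \<bar>d j \<bullet> v x i - d j \<bullet> l i\<bar> < e" if "i \<in> I" "j \<in> I" for i j
    using tendstoD[OF tendsto_inner[OF tendsto_const assms(3)[OF that(1)]] \<open>e > 0\<close>]
    by (simp add: dist_real_def)
  then have "\<forall>\<^sub>F x in F. \<forall>i\<in>I. \<forall>j\<in>I. \<bar>d j \<bullet> v x i - d j \<bullet> l i\<bar> < e"
    using assms(1) by (simp add: eventually_ball_finite)
  then show ?thesis
  proof eventually_elim
    case (elim x)
    show ?case unfolding lin_indep_family_def
    proof (intro allI impI)
      fix c assume c: "(\<Sum>i\<in>I. c i *\<^sub>R v x i) = 0"
      show "\<forall>i\<in>I. c i = 0"
      proof (cases "I = {}")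
        case False
        \<comment> \<open>The row belonging to a coefficient of maximal size yields the
          contradiction.\<close>
        have "Max ((\<lambda>i. \<bar>c i\<bar>) ` I) \<in> (\<lambda>i. \<bar>c i\<bar>) ` I"
          using False assms(1) by (intro Max_in) auto
        then obtain j where "j \<in> I" and m: "Max ((\<lambda>i. \<bar>c i\<bar>) ` I) = \<bar>c j\<bar>" by auto
        moreover have "\<bar>c i\<bar> \<le> \<bar>c j\<bar>" if "i \<in> I" for i
          unfolding m[symmetric] using assms(1) that by (intro Max_ge) auto
        ultimately have j: "j \<in> I" "\<And>i. i \<in> I \<Longrightarrow> \<bar>c i\<bar> \<le> \<bar>c j\<bar>" by blast+
        have "0 = d j \<bullet> (\<Sum>i\<in>I. c i *\<^sub>R v x i)" using c by simp
        also have "\<dots> = (\<Sum>i\<in>I. c i * (d j \<bullet> l i)) + (\<Sum>i\<in>I. c i * (d j \<bullet> v x i - d j \<bullet> l i))"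
          by (simp add: inner_sum_right algebra_simps sum.distrib[symmetric])
        also have "(\<Sum>i\<in>I. c i * (d j \<bullet> l i)) = (\<Sum>i\<in>I. if j = i then c j else 0)"
          using d[OF j(1)] by (intro sum.cong) auto
        finally have "\<bar>c j\<bar> = \<bar>\<Sum>i\<in>I. c i * (d j \<bullet> v x i - d j \<bullet> l i)\<bar>"
          using j(1) assms(1) by simp
        also have "\<dots> \<le> (\<Sum>i\<in>I. \<bar>c j\<bar> * e)"
          using elim j by (intro order_trans[OF sum_abs] sum_mono)
             (unfold abs_mult, intro mult_mono, auto simp: less_imp_le)
        finally have "\<bar>c j\<bar> \<le> \<bar>c j\<bar> * (card I * e)" by (simp add: mult_ac)
        moreover have "card I * e < 1" by (simp add: e_def field_simps)
        ultimately have "\<not> 0 < \<bar>c j\<bar>"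
          using mult_strict_left_mono[of "card I * e" 1 "\<bar>c j\<bar>"] by linarith
        then have "c j = 0" by simp
        with j(2) show ?thesis by force
      qed simp
    qed
  qed
qed

text \<open>The solution of least norm of an underdetermined system. Its description mentions only
  the span and the equations, so it can be compared across frames; the explicit formula through a
  dual family comes later.\<close>

definition min_solution :: "'i set \<Rightarrow> ('i \<Rightarrow> 'v::euclidean_space) \<Rightarrow> ('i \<Rightarrow> real) \<Rightarrow> 'v" where
  "min_solution I v b = (THE u. u \<in> span (v ` I) \<and> (\<forall>i\<in>I. u \<bullet> v i = b i))"

text \<open>The difference of two such solutions lies in the span and is orthogonal to it, hence to
  itself.\<close>

lemma min_solution_eqI:
  assumes "u \<in> span (v ` I)" "\<And>i. i \<in> I \<Longrightarrow> u \<bullet> v i = b i"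
  shows "min_solution I v b = u"
  unfolding min_solution_def
proof (rule the_equality)
  fix u' assume u': "u' \<in> span (v ` I) \<and> (\<forall>i\<in>I. u' \<bullet> v i = b i)"
  have "(u' - u) \<bullet> y = 0" if "y \<in> span (v ` I)" for y
    using that
  proof (induction rule: span_induct_alt)
    case (step c z y)
    then show ?case using u' assms(2) by (auto simp: inner_add_right inner_diff_left)
  qed simp
  from this[of "u' - u"] show "u' = u" using u' assms(1) by (simp add: span_diff)
qed (use assms in auto)

lemma dual_sum_solution:
  assumes "finite I" "\<And>i. i \<in> I \<Longrightarrow> d i \<in> span (v ` I)"
    "\<And>i j. i \<in> I \<Longrightarrow> j \<in> I \<Longrightarrow> d i \<bullet> v j = (if i = j then 1 else 0)"
  shows "min_solution I v b = (\<Sum>i\<in>I. b i *\<^sub>R d i)"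
    and "(\<Sum>i\<in>I. b i *\<^sub>R d i) \<in> span (v ` I)"
    and "j \<in> I \<Longrightarrow> (\<Sum>i\<in>I. b i *\<^sub>R d i) \<bullet> v j = b j"
proof -
  show sp: "(\<Sum>i\<in>I. b i *\<^sub>R d i) \<in> span (v ` I)"
    using assms(2) by (intro span_sum span_scale)
  have eq: "(\<Sum>i\<in>I. b i *\<^sub>R d i) \<bullet> v j = b j" if "j \<in> I" for j
  proof -
    have "(\<Sum>i\<in>I. b i *\<^sub>R d i) \<bullet> v j = (\<Sum>i\<in>I. if i = j then b j else 0)"
      unfolding inner_sum_left using assms(3) that by (intro sum.cong) auto
    then show ?thesis using assms(1) that by simp
  qed
  then show "j \<in> I \<Longrightarrow> (\<Sum>i\<in>I. b i *\<^sub>R d i) \<bullet> v j = b j" .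
  show "min_solution I v b = (\<Sum>i\<in>I. b i *\<^sub>R d i)"
    using sp eq by (rule min_solution_eqI)
qed

lemma min_solution:
  assumes "finite I" "lin_indep_family I v"
  shows "min_solution I v b \<in> span (v ` I)" "i \<in> I \<Longrightarrow> min_solution I v b \<bullet> v i = b i"
proof -
  obtain d where d: "\<And>i. i \<in> I \<Longrightarrow> d i \<in> span (v ` I)"
    "\<And>i j. i \<in> I \<Longrightarrow> j \<in> I \<Longrightarrow> d i \<bullet> v j = (if i = j then 1 else 0)"
    using assms by (rule dual_family) auto
  show "min_solution I v b \<in> span (v ` I)" "i \<in> I \<Longrightarrow> min_solution I v b \<bullet> v i = b i"
    using dual_sum_solution[OF assms(1) d] by simp_all
qed

text \<open>On S the solution is \<Sum> b_i d_i for a dual family depending smoothly on the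
  point.\<close>

lemma smooth_on_min_solution:
  fixes v :: "'i \<Rightarrow> 'x::{real_vector,topological_space} \<Rightarrow> 'v::euclidean_space"
  assumes "finite I" "line_open W S" "\<And>i. i \<in> I \<Longrightarrow> smooth_on W S (v i)"
    "\<And>i. i \<in> I \<Longrightarrow> smooth_on W S (b i)" "\<And>x. x \<in> S \<Longrightarrow> lin_indep_family I (\<lambda>i. v i x)"
  shows "smooth_on W S (\<lambda>x. min_solution I (\<lambda>i. v i x) (\<lambda>i. b i x))"
proof -
  obtain d where d: "\<And>i. i \<in> I \<Longrightarrow> smooth_on W S (d i)"
    "\<And>i x. i \<in> I \<Longrightarrow> x \<in> S \<Longrightarrow> d i x \<in> span ((\<lambda>i. v i x) ` I)"
    "\<And>i j x. i \<in> I \<Longrightarrow> j \<in> I \<Longrightarrow> x \<in> S \<Longrightarrow> d i x \<bullet> v j x = (if i = j then 1 else 0)"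
    using smooth_dual_family[OF assms(1,2,3,5)] by blast
  show ?thesis
  proof (rule smooth_on_cong[OF assms(2)])
    show "smooth_on W S (\<lambda>x. \<Sum>i\<in>I. b i x *\<^sub>R d i x)"
      using assms d(1) by (intro smooth_on_sum smooth_on_scaleR) auto
    show "(\<Sum>i\<in>I. b i x *\<^sub>R d i x) = min_solution I (\<lambda>i. v i x) (\<lambda>i. b i x)" if "x \<in> S" for x
      using dual_sum_solution(1)[OF assms(1), of "\<lambda>i. d i x" "\<lambda>i. v i x"] d(2,3) that by simp
  qed
qed

section \<open>Change of frame\<close>

text \<open>The tags keep first-order and second-order vectors apart even where they coincide, as
  independence of an indexed family requires.\<close>

definition frame_index :: "nat \<Rightarrow> (nat + nat \<times> nat) set" where
  "frame_index k = {..<k} <+> {(a, b). a \<le> b \<and> b < k}"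

lemma finite_frame_index: "finite (frame_index k)"
proof -
  have "{(a, b). a \<le> b \<and> b < k} \<subseteq> {..<k} \<times> {..<k}" by auto
  then have "finite {(a, b). a \<le> b \<and> b < k}" by (rule finite_subset) simp
  then show ?thesis by (simp add: frame_index_def)
qed

lemma Inl_in_frame_index [simp]: "Inl a \<in> frame_index k \<longleftrightarrow> a < k"
  and Inr_in_frame_index [simp]: "Inr (a, b) \<in> frame_index k \<longleftrightarrow> a \<le> b \<and> b < k"
  by (auto simp: frame_index_def)

definition second_lie ::
    "(nat \<Rightarrow> 'a \<Rightarrow> 'a tangent_vector) \<Rightarrow> ('a \<Rightarrow> real^'q::finite) \<Rightarrow> 'a \<Rightarrow> nat \<Rightarrow> nat \<Rightarrow> real^'q" where
  "second_lie \<xi> f x a b = lie_derivative (\<xi> a) (lie_derivative (\<xi> b) f) x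
    + lie_derivative (\<xi> b) (lie_derivative (\<xi> a) f) x"

lemma second_lie_commute: "second_lie \<xi> f x a b = second_lie \<xi> f x b a"
  by (simp add: second_lie_def add.commute)

definition free_vectors ::
    "(nat \<Rightarrow> 'a \<Rightarrow> 'a tangent_vector) \<Rightarrow> ('a \<Rightarrow> real^'q::finite) \<Rightarrow> 'a \<Rightarrow> nat + nat \<times> nat \<Rightarrow> real^'q" where
  "free_vectors \<xi> f x = case_sum (\<lambda>a. lie_derivative (\<xi> a) f x) (\<lambda>(a, b). second_lie \<xi> f x a b)"

text \<open>The zeros express u \<bullet> L_a f = 0; the minus sign compensates the one that appears
  when these equations are differentiated.\<close>

definition form_rhs ::
    "(nat \<Rightarrow> 'a \<Rightarrow> 'a tangent_vector) \<Rightarrow> 'a \<Rightarrow> ('a tangent_vector \<Rightarrow> 'a tangent_vector \<Rightarrow> real) \<Rightarrow>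
      nat + nat \<times> nat \<Rightarrow> real" where
  "form_rhs \<xi> x g = case_sum (\<lambda>_. 0) (\<lambda>(a, b). - g (\<xi> a x) (\<xi> b x))"

text \<open>The free vectors expressed through the coordinates y of a 2-jet, by symmetrizing
  \<open>second_derivative_coords\<close>. Linear in y with coefficients smooth in x, they carry
  both the openness of freeness and the smoothness of the inverse.\<close>

definition jet_vectors ::
    "('a \<Rightarrow> real^'m) \<Rightarrow> (nat \<Rightarrow> 'a \<Rightarrow> 'a tangent_vector) \<Rightarrow> 'a \<Rightarrow>
      ('m::finite multiset \<Rightarrow> 'q::finite \<Rightarrow> real) \<Rightarrow> nat + nat \<times> nat \<Rightarrow> real^'q" where
  "jet_vectors \<phi> \<xi> x y = case_sum
    (\<lambda>a. \<chi> l. \<Sum>j\<in>UNIV. \<xi> a x (\<lambda>z. \<phi> z $ j) * y {#j#} l)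
    (\<lambda>(a, b). \<chi> l.
      (\<Sum>j\<in>UNIV. \<Sum>i\<in>UNIV. (\<xi> a x (\<lambda>z. \<phi> z $ i) * \<xi> b x (\<lambda>z. \<phi> z $ j)
        + \<xi> b x (\<lambda>z. \<phi> z $ i) * \<xi> a x (\<lambda>z. \<phi> z $ j)) * y {#j, i#} l)
      + (\<Sum>j\<in>UNIV. (\<xi> a x (\<lambda>z. \<xi> b z (\<lambda>z. \<phi> z $ j)) + \<xi> b x (\<lambda>z. \<xi> a z (\<lambda>z. \<phi> z $ j))) * y {#j#} l))"

lemma lie_derivative_nth: "lie_derivative \<xi> f x $ l = \<xi> x (\<lambda>z. f z $ l)"
  by (simp add: lie_derivative_def differential_def)

lemma lie_derivative_lie_derivative_nth:
  "lie_derivative \<xi> (lie_derivative \<eta> f) x $ l = \<xi> x (\<lambda>z. \<eta> z (\<lambda>z. f z $ l))"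
  by (simp add: lie_derivative_nth)

context smooth_manifold
begin

lemma frame_vector_field: "local_frame \<A> H k V \<xi> \<Longrightarrow> a < k \<Longrightarrow> smooth_vector_field \<A> V (\<xi> a)"
  and frame_open: "local_frame \<A> H k V \<xi> \<Longrightarrow> open V"
  and frame_span: "local_frame \<A> H k V \<xi> \<Longrightarrow> x \<in> V \<Longrightarrow> H x = span ((\<lambda>a. \<xi> a x) ` {..<k})"
  and frame_lin_indep: "local_frame \<A> H k V \<xi> \<Longrightarrow> x \<in> V \<Longrightarrow> lin_indep_family {..<k} (\<lambda>a. \<xi> a x)"
  by (auto simp: local_frame_def)

lemma frame_tangent:
  "local_frame \<A> H k V \<xi> \<Longrightarrow> a < k \<Longrightarrow> x \<in> V \<Longrightarrow> \<xi> a x \<in> tangent_space \<A> x"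
  using frame_vector_field vector_field_tangent by blast

lemma frame_mem: "local_frame \<A> H k V \<xi> \<Longrightarrow> a < k \<Longrightarrow> x \<in> V \<Longrightarrow> \<xi> a x \<in> H x"
  by (simp only: frame_span) (rule span_base, simp)

lemma smooth_near_coord: "(U, \<phi>) \<in> \<A> \<Longrightarrow> x \<in> U \<Longrightarrow> smooth_near \<A> x (\<lambda>y. \<phi> y $ i)"
  using chart_open smooth_fun_coord smooth_nearI by blast

lemma smooth_near_field:
  assumes "local_frame \<A> H k V \<xi>" "a < k" "x \<in> V" "smooth_near \<A> x f"
  shows "smooth_near \<A> x (\<lambda>y. \<xi> a y f)"
proof -
  obtain S where S: "open S" "x \<in> S" "smooth_fun \<A> S f" using assms(4) by (auto simp: smooth_near_def)
  show ?thesis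
    by (rule smooth_nearI[of "S \<inter> V"])
       (use S assms frame_open[OF assms(1)] smooth_fun_subset[OF S(3), of "S \<inter> V"] in
         \<open>auto intro!: vector_field_smooth[OF frame_vector_field[OF assms(1,2)]]\<close>)
qed

text \<open>A relation between coordinate vectors is a relation between the tangent vectors: on
  functions smooth near x by \<open>tangent_coords\<close>, and on all others because tangent
  vectors are 0 there.\<close>

lemma coord_vectors_lin_indep:
  assumes V: "local_frame \<A> H k V \<xi>" "x \<in> V" and U: "(U, \<phi>) \<in> \<A>" "x \<in> U"
  shows "lin_indep_family {..<k} (\<lambda>b. \<chi> i. \<xi> b x (\<lambda>z. \<phi> z $ i))"
  unfolding lin_indep_family_def
proof (intro allI impI)
  fix c :: "nat \<Rightarrow> real" assume "(\<Sum>b<k. c b *\<^sub>R (\<chi> i. \<xi> b x (\<lambda>z. \<phi> z $ i))) = 0"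
  then have c: "(\<Sum>b<k. c b * \<xi> b x (\<lambda>z. \<phi> z $ i)) = 0" for i
    by (auto simp: vec_eq_iff)
  have "(\<Sum>b<k. c b *\<^sub>R \<xi> b x) f = 0" for f
  proof (cases "smooth_near \<A> x f")
    case True
    let ?D = "\<lambda>i. dir_deriv (axis i 1) (\<lambda>z. f (inv_into U \<phi> z)) (\<phi> x)"
    have "(\<Sum>b<k. c b * \<xi> b x f) = (\<Sum>b<k. c b * (\<Sum>i\<in>UNIV. \<xi> b x (\<lambda>y. \<phi> y $ i) * ?D i))"
      using tangent_coords[OF frame_tangent[OF V(1) _ V(2)] U True] by simp
    also have "\<dots> = (\<Sum>i\<in>UNIV. (\<Sum>b<k. c b * \<xi> b x (\<lambda>y. \<phi> y $ i)) * ?D i)"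
      unfolding sum_distrib_left sum_distrib_right by (subst sum.swap) (simp add: mult_ac)
    finally show ?thesis using c by (simp add: sum_fun_apply scaleR_fun_def)
  next
    case False
    then have "\<xi> b x f = 0" if "b < k" for b
      using frame_tangent[OF V(1) that V(2)] by (simp add: tangent_space_def)
    then show ?thesis by (simp add: sum_fun_apply scaleR_fun_def)
  qed
  then have "(\<Sum>b<k. c b *\<^sub>R \<xi> b x) = 0" by auto
  then show "\<forall>b\<in>{..<k}. c b = 0"
    using frame_lin_indep[OF V] unfolding lin_indep_family_def by blast
qed

text \<open>The span condition gives coefficients only pointwise. They become smooth when they are
  read off by pairing the coordinate vectors of the new frame with a smooth dual family for those of
  the old one.\<close>

lemma frame_change:
  assumes V: "local_frame \<A> H k V \<xi>" "x \<in> V" and V': "local_frame \<A> H k V' \<xi>'" "x \<in> V'"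
  obtains N B where "open N" "x \<in> N" "N \<subseteq> V \<inter> V'"
    "\<And>a b. a < k \<Longrightarrow> b < k \<Longrightarrow> smooth_fun \<A> N (B a b)"
    "\<And>a y. a < k \<Longrightarrow> y \<in> N \<Longrightarrow> \<xi>' a y = (\<Sum>b<k. B a b y *\<^sub>R \<xi> b y)"
proof -
  obtain U \<phi> where U: "(U, \<phi>) \<in> \<A>" "x \<in> U" by (rule chart_at)
  define N where "N = U \<inter> (V \<inter> V')"
  have N: "open N" "x \<in> N" "N \<subseteq> U" "N \<subseteq> V" "N \<subseteq> V'"
    using V V' U chart_open[OF U(1)] frame_open[OF V(1)] frame_open[OF V'(1)] by (auto simp: N_def)
  let ?S = "\<phi> ` N"
  have oS: "open ?S"
    using chart_image_open[OF U(1), of "V \<inter> V'"] frame_open[OF V(1)] frame_open[OF V'(1)]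
    by (auto simp: N_def)
  define X where "X = (\<lambda>b y. \<chi> i. \<xi> b y (\<lambda>z. \<phi> z $ i))"
  define X' where "X' = (\<lambda>b y. \<chi> i. \<xi>' b y (\<lambda>z. \<phi> z $ i))"
  have coordN: "smooth_fun \<A> N (\<lambda>z. \<phi> z $ i)" for i
    using smooth_fun_coord[OF U(1)] N(3) by (rule smooth_fun_subset)
  have Xs: "smooth_fun \<A> N (\<lambda>y. X b y $ i)" "smooth_fun \<A> N (\<lambda>y. X' b y $ i)" if "b < k" for b i
    using vector_field_smooth[OF frame_vector_field[OF V(1) that] N(1,4) coordN]
      vector_field_smooth[OF frame_vector_field[OF V'(1) that] N(1,5) coordN]
    by (auto simp: X_def X'_def)
  have "\<exists>d. \<forall>b\<in>{..<k}. smooth_on UNIV ?S (d b) \<and> (\<forall>z\<in>?S. d b z \<in> span ((\<lambda>b. X b (inv_into U \<phi> z)) ` {..<k}) \<and>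
      (\<forall>c\<in>{..<k}. d b z \<bullet> X c (inv_into U \<phi> z) = (if b = c then 1 else 0)))"
  proof (rule smooth_dual_family[OF finite_lessThan line_open_UNIV[OF oS]])
    show "smooth_on UNIV ?S (\<lambda>z. X b (inv_into U \<phi> z))" if "b \<in> {..<k}" for b
      using smooth_funD[OF Xs(1) U(1)] that N(3)
      by (intro smooth_on_vec line_open_UNIV[OF oS]) (simp add: Int_absorb1)
    show "lin_indep_family {..<k} (\<lambda>b. X b (inv_into U \<phi> z))" if "z \<in> ?S" for z
    proof -
      obtain y where "y \<in> V" "y \<in> U" "z = \<phi> y" using \<open>z \<in> ?S\<close> N by auto
      then show ?thesis
        using coord_vectors_lin_indep[OF V(1) _ U(1), of y] chart_inv[OF U(1)] by (simp add: X_def)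
    qed
  qed
  then obtain d where d: "\<And>b. b < k \<Longrightarrow> smooth_on UNIV ?S (d b)"
    "\<And>b c z. b < k \<Longrightarrow> c < k \<Longrightarrow> z \<in> ?S \<Longrightarrow> d b z \<bullet> X c (inv_into U \<phi> z) = (if b = c then 1 else 0)"
    by auto
  define B where "B = (\<lambda>a b y. \<Sum>i\<in>UNIV. X' a y $ i * d b (\<phi> y) $ i)"
  have "smooth_fun \<A> N (B a b)" if "a < k" "b < k" for a b
    unfolding B_def
    by (intro smooth_fun_sum smooth_fun_mult Xs that N smooth_fun_chart_comp[OF U(1), where F = "\<lambda>z. d b z $ i" for i]
        smooth_on_nth line_open_UNIV[OF oS] d)
  moreover have "\<xi>' a y = (\<Sum>b<k. B a b y *\<^sub>R \<xi> b y)" if "a < k" "y \<in> N" for a y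
  proof -
    have y: "y \<in> U" "y \<in> V" "y \<in> V'" "\<phi> y \<in> ?S" using that N by auto
    have "\<xi>' a y \<in> span ((\<lambda>b. \<xi> b y) ` {..<k})"
      using frame_mem[OF V'(1) that(1) y(3)] frame_span[OF V(1) y(2)] by simp
    then obtain c where c: "\<xi>' a y = (\<Sum>b<k. c b *\<^sub>R \<xi> b y)"
      by (auto simp: span_image_eq_range_sum)
    then have "X' a y = (\<Sum>b<k. c b *\<^sub>R X b y)"
      by (auto simp: vec_eq_iff X_def X'_def sum_fun_apply scaleR_fun_def)
    moreover have "B a b y = d b (\<phi> y) \<bullet> X' a y" for b
      by (simp add: B_def inner_vec_def mult.commute)
    ultimately have B: "B a b y = (\<Sum>b'<k. c b' * (d b (\<phi> y) \<bullet> X b' y))" for b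
      by (simp add: inner_sum_right)
    have "B a b y = (\<Sum>b'<k. if b = b' then c b else 0)" if "b < k" for b
      unfolding B using d(2)[OF that _ y(4)] chart_inv[OF U(1) y(1)] by (intro sum.cong) auto
    then have "B a b y = c b" if "b < k" for b
      using that by simp
    then show ?thesis using c by simp
  qed
  ultimately show ?thesis
    using N by (intro that[of N B]) auto
qed

lemma tangent_frame_sum:
  assumes V: "local_frame \<A> H k V \<xi>" "x \<in> V" "c < k" and h: "smooth_near \<A> x h"
    and B: "\<And>d. d < k \<Longrightarrow> smooth_near \<A> x (B d)"
    and e: "open N" "x \<in> N" "\<And>y. y \<in> N \<Longrightarrow> \<eta> y = (\<Sum>d<k. B d y *\<^sub>R \<xi> d y)"
  shows "\<xi> c x (\<lambda>z. \<eta> z h) =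
    (\<Sum>d<k. B d x * \<xi> c x (\<lambda>z. \<xi> d z h)) + (\<Sum>d<k. \<xi> c x (B d) * \<xi> d x h)"
proof -
  have v: "\<xi> c x \<in> tangent_space \<A> x" using frame_tangent[OF V(1,3,2)] .
  have "\<xi> c x (\<lambda>z. \<eta> z h) = \<xi> c x (\<lambda>z. \<Sum>d<k. B d z * \<xi> d z h)"
    using e by (intro tangent_local[OF v e(1,2)]) (auto simp: sum_fun_apply scaleR_fun_def)
  also have "\<dots> = (\<Sum>d<k. \<xi> c x (\<lambda>z. B d z * \<xi> d z h))"
    using B smooth_near_field[OF V(1) _ V(2) h] by (intro tangent_sum[OF v] smooth_near_mult) auto
  also have "\<dots> = (\<Sum>d<k. B d x * \<xi> c x (\<lambda>z. \<xi> d z h) + \<xi> c x (B d) * \<xi> d x h)"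
    using B smooth_near_field[OF V(1) _ V(2) h]
    by (intro sum.cong refl) (simp add: tangent_mult[OF v] mult.commute)
  finally show ?thesis by (simp add: sum.distrib)
qed

text \<open>Modulo first-order Lie derivatives the second-order vectors transform like a quadratic
  form. Hence the span is preserved, and a vector orthogonal to all L_a f sees the same
  transformation law that a form g obeys.\<close>

lemma second_lie_change:
  fixes f :: "'a \<Rightarrow> real^'q::finite"
  assumes V: "local_frame \<A> H k V \<xi>" "x \<in> V" and N: "open N" "x \<in> N"
    and B: "\<And>a b. a < k \<Longrightarrow> b < k \<Longrightarrow> smooth_fun \<A> N (B a b)"
    and e: "\<And>a y. a < k \<Longrightarrow> y \<in> N \<Longrightarrow> \<xi>' a y = (\<Sum>b<k. B a b y *\<^sub>R \<xi> b y)"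
    and f: "\<And>l. smooth_near \<A> x (\<lambda>y. f y $ l)" and ab: "a < k" "b < k"
  shows "second_lie \<xi>' f x a b =
    (\<Sum>c<k. \<Sum>d<k. (B a c x * B b d x) *\<^sub>R second_lie \<xi> f x c d) +
    (\<Sum>d<k. (\<Sum>c<k. B a c x * \<xi> c x (B b d) + B b c x * \<xi> c x (B a d)) *\<^sub>R lie_derivative (\<xi> d) f x)"
proof -
  have Bn: "smooth_near \<A> x (B a b)" if "a < k" "b < k" for a b
    using B[OF that] N by (intro smooth_nearI)
  have half: "\<xi>' a x (\<lambda>z. \<xi>' b z h) = (\<Sum>c<k. \<Sum>d<k. B a c x * B b d x * \<xi> c x (\<lambda>z. \<xi> d z h)) +
      (\<Sum>d<k. (\<Sum>c<k. B a c x * \<xi> c x (B b d)) * \<xi> d x h)"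
    if "smooth_near \<A> x h" "a < k" "b < k" for a b h
  proof -
    have "\<xi>' a x (\<lambda>z. \<xi>' b z h) = (\<Sum>c<k. B a c x * \<xi> c x (\<lambda>z. \<xi>' b z h))"
      using e[OF that(2) N(2)] by (simp add: sum_fun_apply scaleR_fun_def)
    also have "\<dots> = (\<Sum>c<k. B a c x * ((\<Sum>d<k. B b d x * \<xi> c x (\<lambda>z. \<xi> d z h)) + (\<Sum>d<k. \<xi> c x (B b d) * \<xi> d x h)))"
      using tangent_frame_sum[OF V _ that(1), where N = N and \<eta> = "\<xi>' b" and B = "B b"] Bn that N e[OF that(3)]
      by (intro sum.cong refl) auto
    also have "\<dots> = (\<Sum>c<k. \<Sum>d<k. B a c x * B b d x * \<xi> c x (\<lambda>z. \<xi> d z h)) +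
        (\<Sum>c<k. \<Sum>d<k. B a c x * \<xi> c x (B b d) * \<xi> d x h)"
      by (simp add: distrib_left sum.distrib sum_distrib_left mult_ac)
    also have "(\<Sum>c<k. \<Sum>d<k. B a c x * \<xi> c x (B b d) * \<xi> d x h) =
        (\<Sum>d<k. (\<Sum>c<k. B a c x * \<xi> c x (B b d)) * \<xi> d x h)"
      by (subst sum.swap) (simp add: sum_distrib_right)
    finally show ?thesis .
  qed
  \<comment> \<open>Renaming c and d in the half with a and b exchanged brings both halves to the
    common coefficient B_ac B_bd.\<close>
  have swap: "(\<Sum>c<k. \<Sum>d<k. B b c x * B a d x * \<xi> c x (\<lambda>z. \<xi> d z h)) =
      (\<Sum>c<k. \<Sum>d<k. B a c x * B b d x * \<xi> d x (\<lambda>z. \<xi> c z h))" for h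
    by (subst sum.swap) (simp add: mult_ac)
  show ?thesis
    unfolding vec_eq_iff
    using half[OF f ab(1,2)] half[OF f ab(2,1), unfolded swap]
    by (simp add: second_lie_def lie_derivative_nth lie_derivative_lie_derivative_nth
        distrib_left distrib_right sum.distrib sum_distrib_left sum_distrib_right mult_ac)
qed

lemma lie_derivative_change:
  fixes f :: "'a \<Rightarrow> real^'q::finite"
  assumes "\<eta> x = (\<Sum>b<k. B b *\<^sub>R \<xi> b x)"
  shows "lie_derivative \<eta> f x = (\<Sum>b<k. B b *\<^sub>R lie_derivative (\<xi> b) f x)"
  by (simp add: vec_eq_iff lie_derivative_nth assms sum_fun_apply scaleR_fun_def)

lemma second_lie_in_span:
  "c < k \<Longrightarrow> d < k \<Longrightarrow> second_lie \<xi> f x c d \<in> span (free_vectors \<xi> f x ` frame_index k)"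
proof (induction c d rule: linorder_wlog)
  case (le c d)
  then have "free_vectors \<xi> f x (Inr (c, d)) \<in> free_vectors \<xi> f x ` frame_index k"
    by (intro imageI) (auto simp: frame_index_def)
  then show ?case by (simp add: free_vectors_def span_base)
qed (simp add: second_lie_commute)

lemma lie_in_span: "c < k \<Longrightarrow> lie_derivative (\<xi> c) f x \<in> span (free_vectors \<xi> f x ` frame_index k)"
proof -
  assume "c < k"
  then have "free_vectors \<xi> f x (Inl c) \<in> free_vectors \<xi> f x ` frame_index k"
    by (intro imageI) (auto simp: frame_index_def)
  then show ?thesis by (simp add: free_vectors_def span_base)
qed

lemma free_vectors_change_span:
  fixes f :: "'a \<Rightarrow> real^'q::finite"
  assumes V: "local_frame \<A> H k V \<xi>" "x \<in> V" and V': "local_frame \<A> H k V' \<xi>'" "x \<in> V'"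
    and f: "\<And>l. smooth_near \<A> x (\<lambda>y. f y $ l)"
  shows "free_vectors \<xi>' f x ` frame_index k \<subseteq> span (free_vectors \<xi> f x ` frame_index k)"
proof -
  obtain N B where N: "open N" "x \<in> N"
    and B: "\<And>a b. a < k \<Longrightarrow> b < k \<Longrightarrow> smooth_fun \<A> N (B a b)"
      "\<And>a y. a < k \<Longrightarrow> y \<in> N \<Longrightarrow> \<xi>' a y = (\<Sum>b<k. B a b y *\<^sub>R \<xi> b y)"
    using V V' by (rule frame_change) auto
  have "second_lie \<xi>' f x a b \<in> span (free_vectors \<xi> f x ` frame_index k)" if "a < k" "b < k" for a b
    by (simp only: second_lie_change[OF V N B f that])
       (intro span_add span_sum span_scale second_lie_in_span lie_in_span; simp)
  moreover have "lie_derivative (\<xi>' a) f x \<in> span (free_vectors \<xi> f x ` frame_index k)" if "a < k" for a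
    unfolding lie_derivative_change[where \<eta> = "\<xi>' a" and x = x and \<xi> = \<xi>, OF B(2)[OF that N(2)]]
    by (intro span_sum span_scale lie_in_span) auto
  ultimately show ?thesis
    by (auto simp: frame_index_def free_vectors_def)
qed

text \<open>Freeness at a single point, which is what a 2-jet can express. The neighbourhood
  demanded by \<open>free_maps\<close> is recovered in \<open>free_maps_eq\<close>.\<close>

definition free_at :: "nat \<Rightarrow> ('a \<Rightarrow> 'a tangent_vector set) \<Rightarrow> 'a \<Rightarrow> ('a \<Rightarrow> real^'q::finite) \<Rightarrow> bool" where
  "free_at k H x f \<longleftrightarrow> (\<exists>V \<xi>. x \<in> V \<and> local_frame \<A> H k V \<xi> \<and>
    lin_indep_family (frame_index k) (free_vectors \<xi> f x))"

text \<open>The vectors of the good frame lie in the span of those of the given frame, so the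
  dimension count applies.\<close>

lemma free_at_frame:
  assumes "free_at k H x f" "local_frame \<A> H k V \<xi>" "x \<in> V" "\<And>l. smooth_near \<A> x (\<lambda>y. f y $ l)"
  shows "lin_indep_family (frame_index k) (free_vectors \<xi> f x)"
proof -
  obtain V' \<xi>' where V': "x \<in> V'" "local_frame \<A> H k V' \<xi>'"
    and ind: "lin_indep_family (frame_index k) (free_vectors \<xi>' f x)"
    using assms(1) unfolding free_at_def by auto
  show ?thesis
    by (rule lin_indep_family_of_span(1)[OF finite_frame_index ind
        free_vectors_change_span[OF assms(2,3) V'(2,1) assms(4)]])
qed

lemma form_expand:
  assumes g: "g \<in> fibre (quadratic_forms \<A> k H) x" and V: "local_frame \<A> H k V \<xi>" "x \<in> V"
  shows "g (\<Sum>c<k. B c *\<^sub>R \<xi> c x) (\<Sum>d<k. C d *\<^sub>R \<xi> d x) = (\<Sum>c<k. \<Sum>d<k. (B c * C d) * g (\<xi> c x) (\<xi> d x))"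
proof -
  have H: "subspace (H x)" using frame_span[OF V] by simp
  have Hs: "(\<Sum>c\<in>I. B c *\<^sub>R \<xi> c x) \<in> H x" if "I \<subseteq> {..<k}" for B I
    using that frame_mem[OF V(1) _ V(2)] by (intro subspace_sum[OF H] subspace_scale[OF H]) auto
  have left: "g (\<Sum>c\<in>I. B c *\<^sub>R \<xi> c x) w = (\<Sum>c\<in>I. B c * g (\<xi> c x) w)"
    if "finite I" "I \<subseteq> {..<k}" "w \<in> H x" for B w I
    using that
  proof (induction I rule: finite_induct)
    case empty
    \<comment> \<open>Homogeneity with factor 0 is what makes the empty sum vanish under g.\<close>
    have "g (0 *\<^sub>R 0) w = 0 * g 0 w"
      using g subspace_0[OF H] empty.prems unfolding quadratic_forms_def by (fastforce simp del: scaleR_zero_left)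
    then show ?case by (simp only: sum.empty scaleR_zero_left mult_zero_left)
  next
    case (insert c I)
    have "g (B c *\<^sub>R \<xi> c x + (\<Sum>c\<in>I. B c *\<^sub>R \<xi> c x)) w = g (B c *\<^sub>R \<xi> c x) w + g (\<Sum>c\<in>I. B c *\<^sub>R \<xi> c x) w"
      using g Hs[of "{c}" B] Hs[of I B] insert.prems by (simp add: quadratic_forms_def)
    moreover have "g (B c *\<^sub>R \<xi> c x) w = B c * g (\<xi> c x) w"
      using g frame_mem[OF V(1) _ V(2)] insert.prems by (simp add: quadratic_forms_def)
    moreover have "g (\<Sum>c\<in>I. B c *\<^sub>R \<xi> c x) w = (\<Sum>c\<in>I. B c * g (\<xi> c x) w)"
      using insert.IH insert.prems by blast
    ultimately show ?case by (simp only: sum.insert[OF insert.hyps])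
  qed
  have sym: "g v w = g w v" if "v \<in> H x" "w \<in> H x" for v w
    using g that by (simp add: quadratic_forms_def)
  have "g (\<Sum>c<k. B c *\<^sub>R \<xi> c x) (\<Sum>d<k. C d *\<^sub>R \<xi> d x) = (\<Sum>c<k. B c * g (\<xi> c x) (\<Sum>d<k. C d *\<^sub>R \<xi> d x))"
    by (rule left) (auto intro: Hs)
  also have "\<dots> = (\<Sum>c<k. B c * (\<Sum>d<k. C d * g (\<xi> d x) (\<xi> c x)))"
  proof (intro sum.cong refl)
    fix c assume "c \<in> {..<k}"
    then have c: "\<xi> c x \<in> H x" using frame_mem[OF V(1) _ V(2)] by simp
    have "g (\<xi> c x) (\<Sum>d<k. C d *\<^sub>R \<xi> d x) = g (\<Sum>d<k. C d *\<^sub>R \<xi> d x) (\<xi> c x)"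
      by (intro sym c Hs) auto
    then show "B c * g (\<xi> c x) (\<Sum>d<k. C d *\<^sub>R \<xi> d x) = B c * (\<Sum>d<k. C d * g (\<xi> d x) (\<xi> c x))"
      using left[OF finite_lessThan order_refl c, of C] by simp
  qed
  also have "\<dots> = (\<Sum>c<k. \<Sum>d<k. (B c * C d) * g (\<xi> c x) (\<xi> d x))"
    unfolding sum_distrib_left using sym frame_mem[OF V(1) _ V(2)]
    by (intro sum.cong refl) (auto simp: mult_ac)
  finally show ?thesis .
qed

text \<open>The two spans coincide, and the solution for one frame satisfies the equations of the
  other: the first-order corrections drop out by orthogonality, and the remaining coefficients are
  those in the expansion of g.\<close>

lemma min_solution_frame_independent:
  fixes f :: "'a \<Rightarrow> real^'q::finite"
  assumes V: "local_frame \<A> H k V \<xi>" "x \<in> V" and V': "local_frame \<A> H k V' \<xi>'" "x \<in> V'"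
    and f: "\<And>l. smooth_near \<A> x (\<lambda>y. f y $ l)" and free: "free_at k H x f"
    and g: "g \<in> fibre (quadratic_forms \<A> k H) x"
  shows "min_solution (frame_index k) (free_vectors \<xi>' f x) (form_rhs \<xi>' x g) =
    min_solution (frame_index k) (free_vectors \<xi> f x) (form_rhs \<xi> x g)" (is "_ = ?u")
proof (rule min_solution_eqI)
  let ?I = "frame_index k"
  note ind = free_at_frame[OF free V f]
  show "?u \<in> span (free_vectors \<xi>' f x ` ?I)"
    using min_solution(1)[OF finite_frame_index ind]
      lin_indep_family_of_span(2)[OF finite_frame_index ind free_vectors_change_span[OF V' V f]] by simp
  obtain N B where N: "open N" "x \<in> N"
    and B: "\<And>a b. a < k \<Longrightarrow> b < k \<Longrightarrow> smooth_fun \<A> N (B a b)"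
      "\<And>a y. a < k \<Longrightarrow> y \<in> N \<Longrightarrow> \<xi>' a y = (\<Sum>b<k. B a b y *\<^sub>R \<xi> b y)"
    using V V' by (rule frame_change) auto
  have ul: "?u \<bullet> lie_derivative (\<xi> c) f x = 0" if "c < k" for c
    using min_solution(2)[OF finite_frame_index ind, of "Inl c" "form_rhs \<xi> x g"] that
    by (simp add: free_vectors_def form_rhs_def)
  have us: "?u \<bullet> second_lie \<xi> f x c d = - g (\<xi> c x) (\<xi> d x)" if "c < k" "d < k" for c d
    using that
  proof (induction c d rule: linorder_wlog)
    case (le c d)
    then show ?case
      using min_solution(2)[OF finite_frame_index ind, of "Inr (c, d)" "form_rhs \<xi> x g"]
      by (simp add: free_vectors_def form_rhs_def)
  next
    case (sym c d)
    have "g (\<xi> c x) (\<xi> d x) = g (\<xi> d x) (\<xi> c x)"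
      using g frame_mem[OF V(1) _ V(2)] sym(2,3) by (simp add: quadratic_forms_def)
    then show ?case using sym by (simp add: second_lie_commute[of \<xi> f x c d])
  qed
  have "?u \<bullet> lie_derivative (\<xi>' a) f x = 0" if "a < k" for a
    unfolding lie_derivative_change[where \<eta> = "\<xi>' a" and x = x and \<xi> = \<xi>, OF B(2)[OF that N(2)]] using ul by (simp add: inner_sum_right)
  moreover have "?u \<bullet> second_lie \<xi>' f x a b = - g (\<xi>' a x) (\<xi>' b x)" if "a < k" "b < k" for a b
    by (simp only: second_lie_change[OF V N B f that] B(2)[OF that(1) N(2)] B(2)[OF that(2) N(2)] form_expand[OF g V])
       (simp add: ul us inner_add_right inner_sum_right sum_negf)
  ultimately show "?u \<bullet> free_vectors \<xi>' f x i = form_rhs \<xi>' x g i" if "i \<in> ?I" for i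
    using that by (cases i) (auto simp: free_vectors_def form_rhs_def)
qed

lemma free_vectors_taylor:
  fixes f :: "'a \<Rightarrow> real^'q::finite"
  assumes V: "local_frame \<A> H k V \<xi>" "x \<in> V" and U: "(U, \<phi>) \<in> \<A>" "x \<in> U"
    and f: "\<And>l. smooth_near \<A> x (\<lambda>y. f y $ l)" and i: "i \<in> frame_index k"
  shows "free_vectors \<xi> f x i =
    jet_vectors \<phi> \<xi> x (taylor product_bundle 2 (U, \<phi>) (\<lambda>x v j. v $ j) f x) i"
proof -
  let ?F = "\<lambda>l z. f (inv_into U \<phi> z) $ l"
  have pd: "partial_deriv (mset is) (?F l) (\<phi> x) = pderivs is (?F l) (\<phi> x)" for l "is"
  proof -
    obtain S where S: "open S" "x \<in> S" "smooth_fun \<A> S (\<lambda>y. f y $ l)"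
      using f[of l] by (auto simp: smooth_near_def)
    show ?thesis
      by (rule partial_deriv_mset[OF chart_image_open[OF U(1) S(1)] _ smooth_funD[OF S(3) U(1)]])
         (use S U in auto)
  qed
  have y1: "taylor product_bundle 2 (U, \<phi>) (\<lambda>x v j. v $ j) f x {#j#} l = pderivs [j] (?F l) (\<phi> x)" for j l
    using pd[of "[j]" l] by (simp add: product_bundle_def o_def)
  have y2: "taylor product_bundle 2 (U, \<phi>) (\<lambda>x v j. v $ j) f x {#j, i#} l = pderivs [j, i] (?F l) (\<phi> x)" for j i l
    using pd[of "[j, i]" l] by (simp add: product_bundle_def o_def)
  have first: "\<xi> a x (\<lambda>z. f z $ l) = (\<Sum>j\<in>UNIV. \<xi> a x (\<lambda>z. \<phi> z $ j) * pderivs [j] (?F l) (\<phi> x))"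
    if "a < k" for a l
    using tangent_coords[OF frame_tangent[OF V(1) that V(2)] U f] by simp
  show ?thesis
  proof (cases i)
    case (Inl a)
    then show ?thesis using i first
      by (simp add: vec_eq_iff free_vectors_def jet_vectors_def lie_derivative_nth y1 del: taylor.simps pderivs_Cons)
  next
    case (Inr p)
    then obtain a b where p: "i = Inr (a, b)" "a < k" "b < k"
      using i by (cases p) (auto simp: frame_index_def)
    note sd = second_derivative_coords[OF frame_vector_field[OF V(1)] frame_vector_field[OF V(1)] frame_open[OF V(1)] V(2) U f]
    show ?thesis
      using sd[OF p(2,3)] sd[OF p(3,2)]
      by (simp add: vec_eq_iff p(1) free_vectors_def jet_vectors_def second_lie_def lie_derivative_nth
          lie_derivative_lie_derivative_nth y1 y2 sum.distrib distrib_right algebra_simps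
          del: taylor.simps pderivs_Cons)
  qed
qed

end

section \<open>Jets of free maps\<close>

abbreviation vec_triv :: "'a \<Rightarrow> real^'q::finite \<Rightarrow> 'q \<Rightarrow> real" where
  "vec_triv \<equiv> \<lambda>x v j. v $ j"

lemma trivs_product_bundle: "trivs product_bundle = {(UNIV, vec_triv)}"
  and idx_product_bundle [simp]: "idx product_bundle = UNIV"
  by (simp_all add: product_bundle_def)

lemma open_lin_indep_family:
  fixes v :: "'b::topological_space \<Rightarrow> 'i \<Rightarrow> 'v::euclidean_space"
  assumes "finite I" "open T" "\<And>i. i \<in> I \<Longrightarrow> continuous_on T (\<lambda>x. v x i)"
  shows "open {x \<in> T. lin_indep_family I (v x)}"
proof (subst open_subopen, intro ballI)
  fix x assume x: "x \<in> {x \<in> T. lin_indep_family I (v x)}"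
  have "((\<lambda>x. v x i) \<longlongrightarrow> v x i) (nhds x)" if "i \<in> I" for i
  proof -
    have "((\<lambda>x. v x i) \<longlongrightarrow> v x i) (at x within T)"
      using assms(3)[OF that] x by (simp add: continuous_on_def)
    then have "((\<lambda>x. v x i) \<longlongrightarrow> v x i) (at x)"
      using at_within_open[OF _ assms(2), of x] x by simp
    then show ?thesis by (rule iffD1[OF tendsto_at_iff_tendsto_nhds[of "\<lambda>x. v x i" x]])
  qed
  then have "\<forall>\<^sub>F y in nhds x. lin_indep_family I (v y)"
    using x by (intro eventually_lin_indep_family[OF assms(1), of "v x"]) auto
  moreover have "\<forall>\<^sub>F y in nhds x. y \<in> T"
    using assms(2) x by (intro eventually_nhds_in_open) auto
  ultimately have "\<forall>\<^sub>F y in nhds x. y \<in> {x \<in> T. lin_indep_family I (v x)}"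
    by eventually_elim simp
  then show "\<exists>N. open N \<and> x \<in> N \<and> N \<subseteq> {x \<in> T. lin_indep_family I (v x)}"
    unfolding eventually_nhds by blast
qed

lemma lin_indep_family_cong:
  "\<forall>i\<in>I. v i = w i \<Longrightarrow> lin_indep_family I v \<longleftrightarrow> lin_indep_family I w"
  unfolding lin_indep_family_def by (simp cong: sum.cong)

lemma min_solution_cong:
  "(\<And>i. i \<in> I \<Longrightarrow> v i = w i) \<Longrightarrow> (\<And>i. i \<in> I \<Longrightarrow> b i = c i) \<Longrightarrow> min_solution I v b = min_solution I w c"
  unfolding min_solution_def by (simp cong: image_cong)

text \<open>The Taylor polynomial at z with prescribed 2-jet y, showing that all coordinates in
  \<open>jet_model\<close> occur. The sum over ordered pairs meets each mixed term twice, whence the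
  division by 2.\<close>

definition quadratic :: "('m::finite multiset \<Rightarrow> 'q \<Rightarrow> real) \<Rightarrow> real^'m \<Rightarrow> 'q \<Rightarrow> real^'m \<Rightarrow> real" where
  "quadratic y z l w = y {#} l + (\<Sum>j\<in>UNIV. y {#j#} l * (w $ j - z $ j))
    + (\<Sum>i\<in>UNIV. \<Sum>j\<in>UNIV. y {#i, j#} l * (w $ i - z $ i) * (w $ j - z $ j)) / 2"

lemma smooth_on_vec_nth: "open S \<Longrightarrow> smooth_on UNIV S (\<lambda>w :: real^'m::finite. w $ i)"
  by (intro smooth_on_linear line_open_UNIV continuous_intros) (auto simp: linear_iff)

lemma smooth_on_quadratic: "open S \<Longrightarrow> smooth_on UNIV S (quadratic y z l)"
  unfolding quadratic_def[abs_def] divide_inverse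
  by (intro smooth_on_add smooth_on_sum smooth_on_mult smooth_on_diff smooth_on_const smooth_on_vec_nth
      line_open_UNIV)

lemma dir_deriv_quadratic:
  "dir_deriv (axis k 1) (quadratic y z l) = (\<lambda>w. y {#k#} l + (\<Sum>j\<in>UNIV. y {#k, j#} l * (w $ j - z $ j)))"
proof (rule ext, rule dir_deriv_eqI)
  fix w :: "real^'a"
  let ?a = "\<lambda>i. axis k (1::real) $ i :: real"
  have "((\<lambda>t. quadratic y z l (w + t *\<^sub>R axis k 1)) has_vector_derivative
      (\<Sum>j\<in>UNIV. y {#j#} l * ?a j) +
      (\<Sum>i\<in>UNIV. \<Sum>j\<in>UNIV. y {#i, j#} l * ?a i * (w $ j - z $ j) + y {#i, j#} l * (w $ i - z $ i) * ?a j) / 2) (at 0)"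
    unfolding quadratic_def has_real_derivative_iff_has_vector_derivative[symmetric]
    by (auto intro!: derivative_eq_intros sum.cong simp: algebra_simps)
  \<comment> \<open>Both halves of the product rule contribute equally since {#i, k#} = {#k, i#};
    the factor 2 cancels the division by 2.\<close>
  also have "(\<Sum>i\<in>UNIV. \<Sum>j\<in>UNIV. y {#i, j#} l * ?a i * (w $ j - z $ j) + y {#i, j#} l * (w $ i - z $ i) * ?a j)
      = 2 * (\<Sum>j\<in>UNIV. y {#k, j#} l * (w $ j - z $ j))"
  proof -
    have "(\<Sum>i\<in>UNIV. \<Sum>j\<in>UNIV. y {#i, j#} l * ?a i * (w $ j - z $ j)) = (\<Sum>j\<in>UNIV. y {#k, j#} l * (w $ j - z $ j))"
      by (subst sum.swap) (simp add: axis_def if_distrib[of "\<lambda>x. _ * x"] if_distrib[of "\<lambda>x. x * _"] cong: if_cong)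
    moreover have "(\<Sum>i\<in>UNIV. \<Sum>j\<in>UNIV. y {#i, j#} l * (w $ i - z $ i) * ?a j) = (\<Sum>j\<in>UNIV. y {#k, j#} l * (w $ j - z $ j))"
      by (simp add: axis_def if_distrib[of "\<lambda>x. _ * x"] add_mset_commute cong: if_cong)
    ultimately show ?thesis by (simp add: sum.distrib)
  qed
  also have "(\<Sum>j\<in>UNIV. y {#j#} l * ?a j) = y {#k#} l"
    by (simp add: axis_def if_distrib[of "\<lambda>x. _ * x"] cong: if_cong)
  finally show "((\<lambda>t. quadratic y z l (w + t *\<^sub>R axis k 1)) has_vector_derivative
      y {#k#} l + (\<Sum>j\<in>UNIV. y {#k, j#} l * (w $ j - z $ j))) (at 0)" by simp
qed

lemma dir_deriv2_quadratic:
  "dir_deriv (axis i 1) (dir_deriv (axis k 1) (quadratic y z l)) = (\<lambda>w. y {#k, i#} l)"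
  unfolding dir_deriv_quadratic
proof (rule ext, rule dir_deriv_eqI)
  fix w :: "real^'a"
  have "((\<lambda>t. y {#k#} l + (\<Sum>j\<in>UNIV. y {#k, j#} l * ((w + t *\<^sub>R axis i 1) $ j - z $ j))) has_vector_derivative
      (\<Sum>j\<in>UNIV. y {#k, j#} l * (axis i (1::real) $ j))) (at 0)"
    unfolding has_real_derivative_iff_has_vector_derivative[symmetric]
    by (auto intro!: derivative_eq_intros sum.cong simp: mult_ac)
  then show "((\<lambda>t. y {#k#} l + (\<Sum>j\<in>UNIV. y {#k, j#} l * ((w + t *\<^sub>R axis i 1) $ j - z $ j))) has_vector_derivative
      y {#k, i#} l) (at 0)"
    by (simp add: axis_def if_distrib[of "\<lambda>x. _ * x"] cong: if_cong)
qed

lemma partial_deriv_quadratic: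
  assumes "size \<alpha> \<le> 2" shows "partial_deriv \<alpha> (quadratic y z l) z = y \<alpha> l"
proof -
  obtain "is" where "is": "\<alpha> = mset is" using ex_mset by metis
  have eq: "partial_deriv \<alpha> (quadratic y z l) z = pderivs is (quadratic y z l) z"
    unfolding "is" by (rule partial_deriv_mset[OF open_UNIV UNIV_I smooth_on_quadratic[OF open_UNIV]])
  consider "is = []" | i where "is = [i]" | i j where "is = [i, j]"
    using assms "is" by (cases "is"; cases "tl is"; cases "tl (tl is)") auto
  then show ?thesis
  proof cases
    case 1
    then show ?thesis unfolding eq using "is" by (simp add: quadratic_def)
  next
    case 2
    then show ?thesis unfolding eq using "is" by (simp add: dir_deriv_quadratic)
  next
    case 3
    then show ?thesis unfolding eq using "is" by (simp add: dir_deriv2_quadratic)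
  qed
qed

lemma continuous_on_apply2: "continuous_on UNIV (\<lambda>y :: 'i \<Rightarrow> 'j \<Rightarrow> 'c::topological_space. y \<alpha> l)"
proof -
  have "continuous_on UNIV (\<lambda>y :: 'i \<Rightarrow> 'j \<Rightarrow> 'c. y \<alpha>)" and l: "continuous_on UNIV (\<lambda>y :: 'j \<Rightarrow> 'c. y l)"
    by (rule continuous_on_product_coordinates)+
  then show ?thesis using continuous_on_compose2[OF l, of UNIV "\<lambda>y. y \<alpha>"] by simp
qed

context smooth_manifold
begin

section \<open>Jets and their coordinates\<close>

lemma section_near_product_bundle:
  "section_near \<A> product_bundle x f \<longleftrightarrow> (\<forall>l. smooth_near \<A> x (\<lambda>y. f y $ l))"
proof
  assume "section_near \<A> product_bundle x f"
  then show "\<forall>l. smooth_near \<A> x (\<lambda>y. f y $ l)"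
    by (auto simp: section_near_def local_sections_def smooth_near_def product_bundle_def)
next
  assume "\<forall>l. smooth_near \<A> x (\<lambda>y. f y $ l)"
  then obtain S where S: "\<And>l. open (S l)" "\<And>l. x \<in> S l" "\<And>l. smooth_fun \<A> (S l) (\<lambda>y. f y $ l)"
    unfolding smooth_near_def by metis
  let ?S = "\<Inter>l. S l"
  have "open ?S" using S(1) by (intro open_INT) auto
  moreover have "smooth_fun \<A> ?S (\<lambda>y. f y $ l)" for l
    using S(3) by (rule smooth_fun_subset) auto
  ultimately show "section_near \<A> product_bundle x f"
    using S(2) unfolding section_near_def
    by (intro exI[of _ ?S]) (auto simp: local_sections_def product_bundle_def)
qed

lemma C_inf_iff: "f \<in> C_inf \<A> \<longleftrightarrow> (\<forall>l. smooth_fun \<A> UNIV (\<lambda>x. f x $ l))"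
  by (auto simp: local_sections_def product_bundle_def)

lemma C_inf_section_near: "f \<in> C_inf \<A> \<Longrightarrow> section_near \<A> product_bundle x f"
  unfolding section_near_def by blast

lemma C_inf_smooth_near: "f \<in> C_inf \<A> \<Longrightarrow> smooth_near \<A> x (\<lambda>y. f y $ l)"
  using C_inf_section_near section_near_product_bundle by blast

lemma jet_of_self: "section_near \<A> E x f \<Longrightarrow> f \<in> snd (jet_of \<A> E r f x)"
  by (simp add: jet_of_def)

lemma jet_ofD:
  assumes "h \<in> snd (jet_of \<A> E r f x)"
  shows "section_near \<A> E x h"
    "(U, \<phi>) \<in> \<A> \<Longrightarrow> (V, c) \<in> trivs E \<Longrightarrow> x \<in> U \<Longrightarrow> x \<in> V \<Longrightarrow>
      taylor E r (U, \<phi>) c h x = taylor E r (U, \<phi>) c f x"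
  using assms unfolding jet_of_def by fastforce+

lemma jet_of_SOME:
  assumes "section_near \<A> E x f"
  shows "(SOME h. h \<in> snd (jet_of \<A> E r f x)) \<in> snd (jet_of \<A> E r f x)"
  by (rule someI[of "\<lambda>h. h \<in> snd (jet_of \<A> E r f x)", OF jet_of_self[OF assms]])

lemma fst_jet_of [simp]: "fst (jet_of \<A> E r f x) = x"
  by (simp add: jet_of_def)

lemma jet_fibre_coords_jet_of:
  assumes "section_near \<A> E x f" "(U, \<phi>) \<in> \<A>" "(V, c) \<in> trivs E" "x \<in> U" "x \<in> V"
  shows "jet_fibre_coords E r (U, \<phi>) c (jet_of \<A> E r f x) = taylor E r (U, \<phi>) c f x"
  unfolding jet_fibre_coords_def fst_jet_of using jet_ofD(2)[OF jet_of_SOME[OF assms(1)] assms(2-5)] .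

lemma taylor_eq_iff_flat_at:
  fixes f g :: "'a \<Rightarrow> real^'q::finite"
  assumes "section_near \<A> product_bundle x f" "section_near \<A> product_bundle x g"
    and U: "(U, \<phi>) \<in> \<A>" "x \<in> U"
  shows "taylor product_bundle r (U, \<phi>) vec_triv f x = taylor product_bundle r (U, \<phi>) vec_triv g x \<longleftrightarrow>
    (\<forall>l. flat_at r (\<lambda>z. f (inv_into U \<phi> z) $ l - g (inv_into U \<phi> z) $ l) (\<phi> x))"
proof -
  let ?F = "\<lambda>f l z. f (inv_into U \<phi> z) $ l"
  have *: "partial_deriv (mset is) (?F f l) (\<phi> x) = pderivs is (?F f l) (\<phi> x)"
      "partial_deriv (mset is) (?F g l) (\<phi> x) = pderivs is (?F g l) (\<phi> x)"
      "pderivs is (\<lambda>z. ?F f l z - ?F g l z) (\<phi> x) = pderivs is (?F f l) (\<phi> x) - pderivs is (?F g l) (\<phi> x)"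
    for l "is"
  proof -
    have "smooth_near \<A> x (\<lambda>y. f y $ l)" "smooth_near \<A> x (\<lambda>y. g y $ l)"
      using assms by (auto simp: section_near_product_bundle)
    then obtain S where S: "open S" "x \<in> S" "smooth_fun \<A> S (\<lambda>y. f y $ l)" "smooth_fun \<A> S (\<lambda>y. g y $ l)"
      by (rule smooth_near_common)
    let ?S = "\<phi> ` (U \<inter> S)"
    have oS: "open ?S" "\<phi> x \<in> ?S" using chart_image_open[OF U(1) S(1)] U S by auto
    note sm = smooth_funD[OF S(3) U(1)] smooth_funD[OF S(4) U(1)]
    show "partial_deriv (mset is) (?F f l) (\<phi> x) = pderivs is (?F f l) (\<phi> x)"
      "partial_deriv (mset is) (?F g l) (\<phi> x) = pderivs is (?F g l) (\<phi> x)"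
      by (rule partial_deriv_mset[OF oS sm(1)] partial_deriv_mset[OF oS sm(2)])+
    have "smooth_on UNIV ?S (\<lambda>z. - 1 * ?F g l z)"
      by (intro smooth_on_mult smooth_on_const line_open_UNIV oS sm)
    from pderivs_add[OF oS sm(1) this] pderivs_cmult[OF oS sm(2), where c = "-1"]
    show "pderivs is (\<lambda>z. ?F f l z - ?F g l z) (\<phi> x) = pderivs is (?F f l) (\<phi> x) - pderivs is (?F g l) (\<phi> x)"
      by simp
  qed
  have "taylor product_bundle r (U, \<phi>) vec_triv f x = taylor product_bundle r (U, \<phi>) vec_triv g x \<longleftrightarrow>
      (\<forall>\<alpha> l. size \<alpha> \<le> r \<longrightarrow> partial_deriv \<alpha> (?F f l) (\<phi> x) = partial_deriv \<alpha> (?F g l) (\<phi> x))"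
    by (auto simp: fun_eq_iff o_def)
  also have "\<dots> \<longleftrightarrow> (\<forall>is l. length is \<le> r \<longrightarrow> pderivs is (?F f l) (\<phi> x) = pderivs is (?F g l) (\<phi> x))"
  proof safe
    fix "is" :: "'m list" and l assume L: "\<forall>\<alpha> l. size \<alpha> \<le> r \<longrightarrow> partial_deriv \<alpha> (?F f l) (\<phi> x) = partial_deriv \<alpha> (?F g l) (\<phi> x)"
      and "length is \<le> r"
    then show "pderivs is (?F f l) (\<phi> x) = pderivs is (?F g l) (\<phi> x)"
      using L[rule_format, of "mset is" l] by (simp only: * size_mset)
  next
    fix \<alpha> :: "'m multiset" and l
    assume R: "\<forall>is l. length is \<le> r \<longrightarrow> pderivs is (?F f l) (\<phi> x) = pderivs is (?F g l) (\<phi> x)" and "size \<alpha> \<le> r"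
    obtain "is" where "mset is = \<alpha>" using ex_mset by blast
    with \<open>size \<alpha> \<le> r\<close> show "partial_deriv \<alpha> (?F f l) (\<phi> x) = partial_deriv \<alpha> (?F g l) (\<phi> x)"
      using R[rule_format, of "is" l] *(1,2)[of "is" l] by auto
  qed
  also have "\<dots> \<longleftrightarrow> (\<forall>l. flat_at r (\<lambda>z. ?F f l z - ?F g l z) (\<phi> x))"
    unfolding flat_at_def * by auto
  finally show ?thesis .
qed

text \<open>In the second chart the difference f - g is the difference in the first chart composed
  with the transition map, and composition preserves flatness.\<close>

lemma taylor_eq_other_chart:
  fixes f g :: "'a \<Rightarrow> real^'q::finite"
  assumes f: "section_near \<A> product_bundle x f" and g: "section_near \<A> product_bundle x g"
    and U: "(U, \<phi>) \<in> \<A>" "x \<in> U" and V: "(V, \<psi>) \<in> \<A>" "x \<in> V"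
    and eq: "taylor product_bundle r (U, \<phi>) vec_triv f x = taylor product_bundle r (U, \<phi>) vec_triv g x"
  shows "taylor product_bundle r (V, \<psi>) vec_triv f x = taylor product_bundle r (V, \<psi>) vec_triv g x"
  unfolding taylor_eq_iff_flat_at[OF f g V]
proof
  fix l
  have "smooth_near \<A> x (\<lambda>y. f y $ l)" "smooth_near \<A> x (\<lambda>y. g y $ l)"
    using f g by (auto simp: section_near_product_bundle)
  then obtain S where S: "open S" "x \<in> S" "smooth_fun \<A> S (\<lambda>y. f y $ l)" "smooth_fun \<A> S (\<lambda>y. g y $ l)"
    by (rule smooth_near_common)
  let ?T = "\<phi> ` (U \<inter> S)" and ?S = "\<psi> ` (V \<inter> (U \<inter> S))"
  have T: "open ?T" "open ?S" "\<psi> x \<in> ?S"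
    using chart_image_open[OF U(1) S(1)] chart_image_open[OF V(1), of "U \<inter> S"] chart_open[OF U(1)] U V S by auto
  let ?d = "\<lambda>y. f y $ l - g y $ l"
  have d: "smooth_fun \<A> S ?d" by (intro smooth_fun_diff S)
  show "flat_at r (\<lambda>z. ?d (inv_into V \<psi> z)) (\<psi> x)"
  proof (rule flat_at_cong[OF T(2,3)])
    show "flat_at r (\<lambda>z. ?d (inv_into U \<phi> (\<phi> (inv_into V \<psi> z)))) (\<psi> x)"
    proof (rule flat_at_compose[OF T(2,3,1) _ _ smooth_funD[OF d U(1)], of "\<lambda>z. \<phi> (inv_into V \<psi> z)"])
      show "smooth_on UNIV ?S (\<lambda>z. \<phi> (inv_into V \<psi> z))"
        by (rule smooth_on_subset[OF chart_transition[OF V(1) U(1)]]) auto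
      show "flat_at r (\<lambda>z. ?d (inv_into U \<phi> z)) (\<phi> (inv_into V \<psi> (\<psi> x)))"
        using eq unfolding taylor_eq_iff_flat_at[OF f g U] chart_inv[OF V] by blast
    qed (use chart_inv[OF V(1)] in auto)
  qed (use chart_inv[OF V(1)] chart_inv[OF U(1)] in auto)
qed

text \<open>Although jets compare all charts, agreement in one chart is enough by the transition
  argument.\<close>

lemma jet_of_eqI:
  fixes f g :: "'a \<Rightarrow> real^'q::finite"
  assumes "section_near \<A> product_bundle x f" "section_near \<A> product_bundle x g"
    and "(U, \<phi>) \<in> \<A>" "x \<in> U"
    and "taylor product_bundle r (U, \<phi>) vec_triv f x = taylor product_bundle r (U, \<phi>) vec_triv g x"
  shows "jet_of \<A> product_bundle r f x = jet_of \<A> product_bundle r g x"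
proof -
  have "taylor product_bundle r (V, \<psi>) vec_triv f x = taylor product_bundle r (V, \<psi>) vec_triv g x"
    if "(V, \<psi>) \<in> \<A>" "x \<in> V" for V \<psi>
    using taylor_eq_other_chart[OF assms(1-4) that assms(5)] .
  then show ?thesis
    unfolding jet_of_def trivs_product_bundle by (auto simp del: taylor.simps)
qed

lemma jet_of_local:
  fixes f g :: "'a \<Rightarrow> real^'q::finite"
  assumes "open S" "x \<in> S" "\<And>y. y \<in> S \<Longrightarrow> f y = g y"
  shows "jet_of \<A> product_bundle r f x = jet_of \<A> product_bundle r g x"
proof -
  have "taylor product_bundle r (V, \<psi>) vec_triv f x = taylor product_bundle r (V, \<psi>) vec_triv g x"
    if V: "(V, \<psi>) \<in> \<A>" "x \<in> V" for V \<psi>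
  proof -
    have "partial_deriv \<alpha> (\<lambda>z. f (inv_into V \<psi> z) $ l) (\<psi> x) = partial_deriv \<alpha> (\<lambda>z. g (inv_into V \<psi> z) $ l) (\<psi> x)"
      for \<alpha> l
      unfolding partial_deriv_pderivs
      by (rule pderivs_cong[OF chart_image_open[OF V(1) assms(1)]])
         (use V assms chart_inv[OF V(1)] in auto)
    then show ?thesis by (auto simp: fun_eq_iff o_def)
  qed
  then show ?thesis
    unfolding jet_of_def trivs_product_bundle by (auto simp del: taylor.simps)
qed

lemma jet_of_eqD:
  assumes "section_near \<A> E x f" "jet_of \<A> E r f x = jet_of \<A> E r g y"
  shows "x = y" "(U, \<phi>) \<in> \<A> \<Longrightarrow> (V, c) \<in> trivs E \<Longrightarrow> x \<in> U \<Longrightarrow> x \<in> V \<Longrightarrow>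
    taylor E r (U, \<phi>) c f x = taylor E r (U, \<phi>) c g x"
proof -
  show xy: "x = y" using assms(2) by (metis fst_jet_of)
  have m: "f \<in> snd (jet_of \<A> E r g x)"
    using jet_of_self[OF assms(1), of r] assms(2) xy by simp
  show "taylor E r (U, \<phi>) c f x = taylor E r (U, \<phi>) c g x"
    if "(U, \<phi>) \<in> \<A>" "(V, c) \<in> trivs E" "x \<in> U" "x \<in> V"
    by (rule jet_ofD(2)[OF m that])
qed

lemma free_vectors_eq_of_jet_eq:
  fixes f g :: "'a \<Rightarrow> real^'q::finite"
  assumes V: "local_frame \<A> H k V \<xi>" "x \<in> V"
    and f: "section_near \<A> product_bundle x f" and g: "section_near \<A> product_bundle x g"
    and eq: "jet_of \<A> product_bundle 2 f x = jet_of \<A> product_bundle 2 g x" and i: "i \<in> frame_index k"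
  shows "free_vectors \<xi> f x i = free_vectors \<xi> g x i"
proof -
  obtain U \<phi> where U: "(U, \<phi>) \<in> \<A>" "x \<in> U" by (rule chart_at)
  have "taylor product_bundle 2 (U, \<phi>) vec_triv f x = taylor product_bundle 2 (U, \<phi>) vec_triv g x"
    using jet_of_eqD(2)[OF f eq U(1) _ U(2), of UNIV] by (simp add: trivs_product_bundle del: taylor.simps)
  then show ?thesis
    using free_vectors_taylor[OF V U _ i] f g unfolding section_near_product_bundle by metis
qed

text \<open>The open set A over which the operator is inverted, with d = 2. Membership of a jet is
  independent of its representative by \<open>jet_in_free_jets_iff\<close>.\<close>

definition free_jets :: "nat \<Rightarrow> ('a \<Rightarrow> 'a tangent_vector set) \<Rightarrow> ('a, real^'q::finite) jet set" where
  "free_jets k H = {jet_of \<A> product_bundle 2 f x | f x. section_near \<A> product_bundle x f \<and> free_at k H x f}"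

lemma jet_in_free_jets_iff:
  assumes f: "section_near \<A> product_bundle x f"
  shows "jet_of \<A> product_bundle 2 f x \<in> free_jets k H \<longleftrightarrow> free_at k H x f"
proof
  assume "jet_of \<A> product_bundle 2 f x \<in> free_jets k H"
  then obtain g y where g: "jet_of \<A> product_bundle 2 f x = jet_of \<A> product_bundle 2 g y"
    "section_near \<A> product_bundle y g" "free_at k H y g" by (auto simp: free_jets_def)
  have xy: "x = y" using jet_of_eqD(1)[OF f g(1)] .
  obtain V \<xi> where V: "x \<in> V" "local_frame \<A> H k V \<xi>" "lin_indep_family (frame_index k) (free_vectors \<xi> g x)"
    using g(3) unfolding free_at_def xy by auto
  have "free_vectors \<xi> g x i = free_vectors \<xi> f x i" if "i \<in> frame_index k" for i
    using free_vectors_eq_of_jet_eq[OF V(2,1) _ f _ that, of g] g xy by simp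
  then have "lin_indep_family (frame_index k) (free_vectors \<xi> f x)"
    using V(3) lin_indep_family_cong[of "frame_index k" "free_vectors \<xi> g x"] by blast
  then show "free_at k H x f" using V unfolding free_at_def by blast
qed (use f in \<open>auto simp: free_jets_def\<close>)

lemma smooth_fun_free_vectors:
  fixes f :: "'a \<Rightarrow> real^'q::finite"
  assumes V: "local_frame \<A> H k V \<xi>" and S: "open S" "S \<subseteq> V" "\<And>l. smooth_fun \<A> S (\<lambda>y. f y $ l)"
    and i: "i \<in> frame_index k"
  shows "smooth_fun \<A> S (\<lambda>y. free_vectors \<xi> f y i $ l)"
proof -
  have 1: "smooth_fun \<A> S (\<lambda>y. \<xi> a y (\<lambda>z. f z $ l))" if "a < k" for a
    by (rule vector_field_smooth[OF frame_vector_field[OF V that] S])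
  have 2: "smooth_fun \<A> S (\<lambda>y. \<xi> a y (\<lambda>z. \<xi> b z (\<lambda>z. f z $ l)))" if "a < k" "b < k" for a b
    by (rule vector_field_smooth[OF frame_vector_field[OF V that(1)] S(1,2) 1[OF that(2)]])
  show ?thesis
    using i 1 2
    by (cases i) (auto simp: free_vectors_def second_lie_def lie_derivative_nth intro!: smooth_fun_add S)
qed

lemma local_frame_subset:
  "local_frame \<A> H k V \<xi> \<Longrightarrow> open T \<Longrightarrow> T \<subseteq> V \<Longrightarrow> local_frame \<A> H k T \<xi>"
  unfolding local_frame_def smooth_vector_field_def by blast

text \<open>The passage from a point to a neighbourhood: the free vectors of a smooth map are
  continuous, independence is an open condition, and a frame may be restricted to a smaller open
  set.\<close>

lemma free_maps_eq:
  "free_maps \<A> k H = sections_with_jets_in \<A> product_bundle 2 (free_jets k H :: ('a, real^'q::finite) jet set)"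
proof -
  have eq: "free_maps \<A> k H = {f \<in> C_inf \<A>. \<forall>x. \<exists>U \<xi>. x \<in> U \<and> local_frame \<A> H k U \<xi> \<and>
      (\<forall>y\<in>U. lin_indep_family (frame_index k) (free_vectors \<xi> f y :: _ \<Rightarrow> real^'q))}"
    unfolding free_maps_def frame_index_def free_vectors_def second_lie_def ..
  have fa: "(\<exists>U \<xi>. x \<in> U \<and> local_frame \<A> H k U \<xi> \<and> (\<forall>y\<in>U. lin_indep_family (frame_index k) (free_vectors \<xi> f y)))
      \<longleftrightarrow> free_at k H x f" if f: "f \<in> C_inf \<A>" for x and f :: "'a \<Rightarrow> real^'q"
  proof
    assume "free_at k H x f"
    then obtain V \<xi> where V: "x \<in> V" "local_frame \<A> H k V \<xi>" "lin_indep_family (frame_index k) (free_vectors \<xi> f x)"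
      unfolding free_at_def by blast
    note oV = frame_open[OF V(2)]
    define T where "T = {y \<in> V. lin_indep_family (frame_index k) (free_vectors \<xi> f y)}"
    have "continuous_on V (\<lambda>y. free_vectors \<xi> f y i)" if "i \<in> frame_index k" for i
    proof -
      have "smooth_fun \<A> V (\<lambda>y. f y $ l)" for l
        using f unfolding C_inf_iff by (auto intro: smooth_fun_subset)
      then have "continuous_on V (\<lambda>y. free_vectors \<xi> f y i $ l)" for l
        using smooth_fun_free_vectors[OF V(2) oV order_refl _ that] smooth_fun_continuous[OF oV] by blast
      then show ?thesis
        using continuous_on_vec_lambda[of V "\<lambda>l y. free_vectors \<xi> f y i $ l"] by simp
    qed
    then have "open T" unfolding T_def by (intro open_lin_indep_family finite_frame_index oV)
    then show "\<exists>U \<xi>. x \<in> U \<and> local_frame \<A> H k U \<xi> \<and>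
        (\<forall>y\<in>U. lin_indep_family (frame_index k) (free_vectors \<xi> f y))"
      using V local_frame_subset[OF V(2), of T] by (intro exI[of _ T] exI[of _ \<xi>]) (auto simp: T_def)
  qed (auto simp: free_at_def)
  show ?thesis
    unfolding eq sections_with_jets_in_def
  proof (rule Collect_cong, rule conj_cong[OF refl], rule all_cong1)
    fix f :: "'a \<Rightarrow> real^'q" and x assume f: "f \<in> C_inf \<A>"
    show "(\<exists>U \<xi>. x \<in> U \<and> local_frame \<A> H k U \<xi> \<and>
        (\<forall>y\<in>U. lin_indep_family (frame_index k) (free_vectors \<xi> f y))) \<longleftrightarrow>
        jet_of \<A> product_bundle 2 f x \<in> free_jets k H"
      unfolding fa[OF f] jet_in_free_jets_iff[OF C_inf_section_near[OF f]] ..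
  qed
qed

lemma continuous_on_jet_vectors:
  assumes V: "local_frame \<A> H k V \<xi>" and U: "(U, \<phi>) \<in> \<A>" and i: "i \<in> frame_index k"
  shows "continuous_on (\<phi> ` (U \<inter> V) \<times> UNIV) (\<lambda>p. jet_vectors \<phi> \<xi> (inv_into U \<phi> (fst p)) (snd p) i)"
proof -
  have cU: "smooth_fun \<A> (U \<inter> V) (\<lambda>z. \<phi> z $ j)" for j
    using smooth_fun_coord[OF U] by (rule smooth_fun_subset) auto
  have oUV: "open (U \<inter> V)" using chart_open[OF U] frame_open[OF V] by auto
  have X: "smooth_fun \<A> (U \<inter> V) (\<lambda>x. \<xi> a x (\<lambda>z. \<phi> z $ j))" if "a < k" for a j
    by (rule vector_field_smooth[OF frame_vector_field[OF V that] oUV _ cU]) auto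
  have Y: "smooth_fun \<A> (U \<inter> V) (\<lambda>x. \<xi> a x (\<lambda>z. \<xi> b z (\<lambda>z. \<phi> z $ j)))" if "a < k" "b < k" for a b j
    by (rule vector_field_smooth[OF frame_vector_field[OF V that(1)] oUV _ X[OF that(2)]]) auto
  have c: "continuous_on (\<phi> ` (U \<inter> V) \<times> UNIV) (\<lambda>p. h (inv_into U \<phi> (fst p)))"
    if "smooth_fun \<A> (U \<inter> V) h" for h
  proof -
    have "smooth_on UNIV (\<phi> ` (U \<inter> V)) (\<lambda>z. h (inv_into U \<phi> z))"
      using smooth_funD[OF that U] by (simp add: Int_absorb)
    then show ?thesis
      by (rule continuous_on_compose2[OF smooth_on_continuous continuous_on_fst[OF continuous_on_id]]) auto
  qed
  have y: "continuous_on (\<phi> ` (U \<inter> V) \<times> UNIV) (\<lambda>p. snd p \<alpha> l :: real)" for \<alpha> :: "'m multiset" and l :: 'b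
    by (rule continuous_on_compose2[OF continuous_on_apply2 continuous_on_snd[OF continuous_on_id]]) auto
  show ?thesis
    using i by (cases i) (auto simp: jet_vectors_def intro!: continuous_intros c y X Y smooth_fun_add smooth_fun_mult oUV)
qed

text \<open>In coordinates the free jets are the union, over all local frames, of the open sets
  where \<open>jet_vectors\<close> is independent. The inclusion of this union in the image needs
  every coordinate tuple to be the jet of an actual map.\<close>

lemma open_free_jets:
  "open_in_jet_bundle \<A> product_bundle 2 (free_jets k H :: ('a, real^'q::finite) jet set)"
  unfolding open_in_jet_bundle_def
proof (intro conjI ballI)
  let ?E = "product_bundle :: ('a, real^'q, 'q) vbundle"
  let ?A = "free_jets k H :: ('a, real^'q) jet set"
  show "?A \<subseteq> jet_bundle \<A> ?E 2"
    by (auto simp: free_jets_def jet_bundle_def)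
  fix ch assume "ch \<in> \<A>"
  then obtain U \<phi> where ch: "ch = (U, \<phi>)" "(U, \<phi>) \<in> \<A>"
    by (cases ch) auto
  note U = ch(2)
  let ?im = "(\<lambda>p. (\<phi> (fst p), jet_fibre_coords ?E 2 (U, \<phi>) vec_triv p)) ` {p \<in> ?A. fst p \<in> U \<inter> UNIV}"
  define O' where "O' = (\<lambda>(V, \<xi>). {p \<in> \<phi> ` (U \<inter> V) \<times> UNIV.
    lin_indep_family (frame_index k) (jet_vectors \<phi> \<xi> (inv_into U \<phi> (fst p)) (snd p) :: _ \<Rightarrow> real^'q)})"
  have "open (O' (V, \<xi>))" if "local_frame \<A> H k V \<xi>" for V \<xi>
    unfolding O'_def split
    by (intro open_lin_indep_family finite_frame_index open_Times chart_image_open[OF U] frame_open[OF that]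
        continuous_on_jet_vectors[OF that U] open_UNIV)
  then have "openin (top_of_set (UNIV \<times> jet_model ?E 2))
      ((UNIV \<times> jet_model ?E 2) \<inter> (\<Union>(V, \<xi>)\<in>{(V, \<xi>). local_frame \<A> H k V \<xi>}. O' (V, \<xi>)))"
    by (intro openin_open_Int open_UN) auto
  moreover have "?im = (UNIV \<times> jet_model ?E 2) \<inter> (\<Union>(V, \<xi>)\<in>{(V, \<xi>). local_frame \<A> H k V \<xi>}. O' (V, \<xi>))"
  proof (intro equalityI subsetI)
    fix q assume "q \<in> ?im"
    then obtain f x where f: "section_near \<A> ?E x f" "free_at k H x f" and x: "x \<in> U"
      and q: "q = (\<phi> x, jet_fibre_coords ?E 2 (U, \<phi>) vec_triv (jet_of \<A> ?E 2 f x))"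
      by (auto simp: free_jets_def)
    have q': "q = (\<phi> x, taylor ?E 2 (U, \<phi>) vec_triv f x)"
      unfolding q using jet_fibre_coords_jet_of[OF f(1) U _ x, of UNIV] by (simp add: trivs_product_bundle)
    obtain V \<xi> where V: "x \<in> V" "local_frame \<A> H k V \<xi>" "lin_indep_family (frame_index k) (free_vectors \<xi> f x)"
      using f(2) unfolding free_at_def by blast
    have "free_vectors \<xi> f x i = jet_vectors \<phi> \<xi> x (taylor ?E 2 (U, \<phi>) vec_triv f x) i"
      if "i \<in> frame_index k" for i
      using free_vectors_taylor[OF V(2,1) U x _ that, of f] f(1) unfolding section_near_product_bundle by blast
    then have "lin_indep_family (frame_index k) (jet_vectors \<phi> \<xi> x (taylor ?E 2 (U, \<phi>) vec_triv f x))"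
      using V(3) lin_indep_family_cong[of "frame_index k" "free_vectors \<xi> f x"] by blast
    then have "q \<in> O' (V, \<xi>)"
      using V x chart_inv[OF U x] by (auto simp: O'_def q' simp del: taylor.simps)
    moreover have "q \<in> UNIV \<times> jet_model ?E 2"
      by (auto simp: q' jet_model_def)
    ultimately show "q \<in> (UNIV \<times> jet_model ?E 2) \<inter> (\<Union>(V, \<xi>)\<in>{(V, \<xi>). local_frame \<A> H k V \<xi>}. O' (V, \<xi>))"
      using V(2) by blast
  next
    fix q assume q: "q \<in> (UNIV \<times> jet_model ?E 2) \<inter> (\<Union>(V, \<xi>)\<in>{(V, \<xi>). local_frame \<A> H k V \<xi>}. O' (V, \<xi>))"
    then obtain V \<xi> where V: "local_frame \<A> H k V \<xi>" and "q \<in> O' (V, \<xi>)" by blast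
    then obtain x y where xy: "q = (\<phi> x, y)" "x \<in> U" "x \<in> V"
      and li: "lin_indep_family (frame_index k) (jet_vectors \<phi> \<xi> x y :: _ \<Rightarrow> real^'q)"
      using chart_inv[OF U] by (auto simp: O'_def)
    have y: "y \<in> jet_model ?E 2" using q xy by auto
    \<comment> \<open>A quadratic polynomial in the chart realizes the given coordinates y as a
      2-jet at x.\<close>
    define f where "f = (\<lambda>x'. \<chi> l. quadratic y (\<phi> x) l (\<phi> x'))"
    have sn: "section_near \<A> ?E x f"
      unfolding section_near_product_bundle f_def
      using chart_open[OF U] xy chart_image_open[OF U open_UNIV]
      by (auto intro!: smooth_nearI[of U] smooth_fun_chart_comp[OF U] smooth_on_quadratic)
    have ty: "taylor ?E 2 (U, \<phi>) vec_triv f x = y"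
    proof (intro ext)
      fix \<alpha> l
      have "partial_deriv \<alpha> (\<lambda>z. f (inv_into U \<phi> z) $ l) (\<phi> x) = partial_deriv \<alpha> (quadratic y (\<phi> x) l) (\<phi> x)"
        unfolding partial_deriv_pderivs
        by (rule pderivs_cong[OF chart_image_open[OF U open_UNIV]]) (use xy chart_inv[OF U] in \<open>auto simp: f_def\<close>)
      then show "taylor ?E 2 (U, \<phi>) vec_triv f x \<alpha> l = y \<alpha> l"
        using y partial_deriv_quadratic[of \<alpha> y "\<phi> x" l] by (simp add: jet_model_def o_def)
    qed
    have "free_vectors \<xi> f x i = jet_vectors \<phi> \<xi> x y i" if "i \<in> frame_index k" for i
      using free_vectors_taylor[OF V xy(3) U xy(2) _ that, of f] sn unfolding section_near_product_bundle ty by blast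
    then have "lin_indep_family (frame_index k) (free_vectors \<xi> f x)"
      using li lin_indep_family_cong[of "frame_index k" "free_vectors \<xi> f x"] by blast
    then have "jet_of \<A> ?E 2 f x \<in> ?A"
      using sn V xy by (auto simp: free_jets_def free_at_def)
    moreover have "q = (\<phi> x, jet_fibre_coords ?E 2 (U, \<phi>) vec_triv (jet_of \<A> ?E 2 f x))"
      using jet_fibre_coords_jet_of[OF sn U _ xy(2), of UNIV] ty xy(1) by (simp add: trivs_product_bundle del: taylor.simps)
    ultimately show "q \<in> ?im" using xy(2) by (intro image_eqI[of _ _ "jet_of \<A> ?E 2 f x"]) auto
  qed
  ultimately show "case ch of (U, \<phi>) \<Rightarrow> \<forall>(V, c)\<in>trivs ?E. openin (top_of_set (UNIV \<times> jet_model ?E 2))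
      ((\<lambda>p. (\<phi> (fst p), jet_fibre_coords ?E 2 (U, \<phi>) c p)) ` {p \<in> ?A. fst p \<in> U \<inter> V})"
    by (simp add: ch trivs_product_bundle)
qed

end

section \<open>The right inverse of the linearization\<close>

lemma partial_deriv_empty: "partial_deriv {#} F = F"
  by (simp add: partial_deriv_pderivs)

lemma subspace_jet_model: "subspace (jet_model E d)"
  by (auto simp: subspace_def jet_model_def scaleR_fun_def)

lemma subspace_scaleR_add_mem: "subspace W \<Longrightarrow> x \<in> W \<Longrightarrow> w \<in> W \<Longrightarrow> x + t *\<^sub>R w \<in> W"
  by (simp add: subspace_add subspace_scale)

text \<open>Function spaces carry the product topology, so continuity of a line is checked one
  coordinate at a time.\<close>

lemma continuous_on_line_jet_coords:
  fixes p w :: "(real^'m::finite) \<times> ('i \<Rightarrow> 'j \<Rightarrow> real) \<times> ('k \<Rightarrow> 'l \<Rightarrow> real)"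
  shows "continuous_on UNIV (\<lambda>t. p + t *\<^sub>R w)"
proof -
  have "continuous_on UNIV (\<lambda>t. fst p + t *\<^sub>R fst w)"
    by (intro continuous_intros)
  moreover have "continuous_on UNIV (\<lambda>t. fst (snd p) + t *\<^sub>R fst (snd w))"
    "continuous_on UNIV (\<lambda>t. snd (snd p) + t *\<^sub>R snd (snd w))"
    by (rule continuous_on_coordinatewise_then_product,
        rule continuous_on_coordinatewise_then_product,
        simp add: scaleR_fun_def, intro continuous_intros)+
  ultimately have "continuous_on UNIV (\<lambda>t. (fst p + t *\<^sub>R fst w, fst (snd p) + t *\<^sub>R fst (snd w),
      snd (snd p) + t *\<^sub>R snd (snd w)))"
    by (intro continuous_on_Pair)
  also have "(\<lambda>t. (fst p + t *\<^sub>R fst w, fst (snd p) + t *\<^sub>R fst (snd w),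
      snd (snd p) + t *\<^sub>R snd (snd w))) = (\<lambda>t. p + t *\<^sub>R w)"
    by (simp add: prod_eq_iff fun_eq_iff del: plus_fun_apply)
  finally show ?thesis .
qed

text \<open>Lines in directions of W never leave the subspace W, and by continuity they stay in T
  for small t.\<close>

lemma line_open_Int_open:
  fixes W :: "((real^'m::finite) \<times> ('i \<Rightarrow> 'j \<Rightarrow> real) \<times> ('k \<Rightarrow> 'l \<Rightarrow> real)) set"
  assumes "subspace W" "open T"
  shows "line_open W (T \<inter> W)"
  unfolding line_open_def
proof (intro ballI)
  fix p w assume p: "p \<in> T \<inter> W" "w \<in> W"
  have "open ((\<lambda>t. p + t *\<^sub>R w) -` T)"
    using open_vimage[OF assms(2) continuous_on_line_jet_coords] .
  moreover have "0 \<in> (\<lambda>t. p + t *\<^sub>R w) -` T" using p by simp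
  ultimately have "\<forall>\<^sub>F t in nhds 0. t \<in> (\<lambda>t. p + t *\<^sub>R w) -` T"
    by (rule eventually_nhds_in_open)
  then show "\<forall>\<^sub>F t in nhds 0. p + t *\<^sub>R w \<in> T \<inter> W"
    by eventually_elim (use p subspace_scaleR_add_mem[OF assms(1)] in auto)
qed

context smooth_manifold
begin

section \<open>Sections of the bundle of quadratic forms and the symbol of the inverse\<close>

lemma trivs_quadratic_forms:
  "(V, c) \<in> trivs (quadratic_forms \<A> k H) \<longleftrightarrow>
    (\<exists>\<xi>. local_frame \<A> H k V \<xi> \<and> c = (\<lambda>x g (a, b). g (\<xi> a x) (\<xi> b x)))"
  by (auto simp: quadratic_forms_def)

lemma idx_quadratic_forms: "idx (quadratic_forms \<A> k H) = {(a, b). a \<le> b \<and> b < k}"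
  by (simp add: quadratic_forms_def)

lemma frame_triv:
  "local_frame \<A> H k V \<xi> \<Longrightarrow> (V, \<lambda>x g (a, b). g (\<xi> a x) (\<xi> b x)) \<in> trivs (quadratic_forms \<A> k H)"
  unfolding trivs_quadratic_forms by blast

lemma section_smooth:
  assumes "g \<in> sections \<A> (quadratic_forms \<A> k H)" "local_frame \<A> H k V \<xi>" "a \<le> b" "b < k"
  shows "smooth_fun \<A> V (\<lambda>x. g x (\<xi> a x) (\<xi> b x))"
proof -
  have "\<forall>j\<in>idx (quadratic_forms \<A> k H). smooth_fun \<A> V (\<lambda>x. (\<lambda>(a, b). g x (\<xi> a x) (\<xi> b x)) j)"
    using assms(1) frame_triv[OF assms(2)] unfolding local_sections_def by fastforce
  then show ?thesis using assms(3,4) by (auto simp: idx_quadratic_forms)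
qed

lemma sectionI:
  assumes "\<And>x. g x \<in> fibre (quadratic_forms \<A> k H) x"
    and "\<And>V \<xi> a b. local_frame \<A> H k V \<xi> \<Longrightarrow> a \<le> b \<Longrightarrow> b < k \<Longrightarrow> smooth_fun \<A> V (\<lambda>x. g x (\<xi> a x) (\<xi> b x))"
  shows "g \<in> sections \<A> (quadratic_forms \<A> k H)"
  using assms unfolding local_sections_def by (auto simp: trivs_quadratic_forms idx_quadratic_forms)

lemma taylor_quadratic_forms:
  assumes "(U, \<phi>) \<in> \<A>" "x \<in> U" "a \<le> b" "b < k"
  shows "taylor (quadratic_forms \<A> k H) 0 (U, \<phi>) (\<lambda>x g (a, b). g (\<xi> a x) (\<xi> b x)) g x {#} (a, b) =
    g x (\<xi> a x) (\<xi> b x)"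
  using assms chart_inv[OF assms(1,2)] by (simp add: partial_deriv_empty idx_quadratic_forms)

lemma section_near_of_section: "g \<in> sections \<A> E \<Longrightarrow> section_near \<A> E x g"
  unfolding section_near_def by blast

lemma section_near_fibre: "section_near \<A> E x g \<Longrightarrow> g x \<in> fibre E x"
  by (auto simp: section_near_def local_sections_def)

text \<open>The value does not depend on the choices (\<open>min_solution_frame_independent\<close>), which makes it
  smooth.\<close>

definition inverse_symbol :: "nat \<Rightarrow> ('a \<Rightarrow> 'a tangent_vector set) \<Rightarrow> ('a, real^'q::finite) jet \<Rightarrow>
    ('a, 'a tangent_vector \<Rightarrow> 'a tangent_vector \<Rightarrow> real) jet \<Rightarrow> real^'q" where
  "inverse_symbol k H p r = (let x = fst p; \<xi> = (SOME \<xi>. \<exists>V. x \<in> V \<and> local_frame \<A> H k V \<xi>) in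
     min_solution (frame_index k) (free_vectors \<xi> (SOME f. f \<in> snd p) x)
       (form_rhs \<xi> x ((SOME g. g \<in> snd r) x)))"

text \<open>Three hidden choices are eliminated: representatives of the jets of f and g, because the
  system uses only a 2-jet and a value, and the frame, by frame independence.\<close>

lemma inverse_symbol_eq:
  fixes f :: "'a \<Rightarrow> real^'q::finite"
  assumes V: "local_frame \<A> H k V \<xi>" "x \<in> V"
    and f: "section_near \<A> product_bundle x f" and free: "free_at k H x f"
    and g: "section_near \<A> (quadratic_forms \<A> k H) x g"
  shows "inverse_symbol k H (jet_of \<A> product_bundle 2 f x) (jet_of \<A> (quadratic_forms \<A> k H) 0 g x) =
    min_solution (frame_index k) (free_vectors \<xi> f x) (form_rhs \<xi> x (g x))"
proof -
  let ?Q = "quadratic_forms \<A> k H"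
  let ?p = "jet_of \<A> product_bundle 2 f x" and ?r = "jet_of \<A> ?Q 0 g x"
  define \<eta> where "\<eta> = (SOME \<xi>. \<exists>V. x \<in> V \<and> local_frame \<A> H k V \<xi>)"
  define f' where "f' = (SOME f. f \<in> snd ?p)"
  define g' where "g' = (SOME g. g \<in> snd ?r)"
  have "\<exists>V. x \<in> V \<and> local_frame \<A> H k V \<eta>"
    unfolding \<eta>_def using V by (intro someI[of "\<lambda>\<xi>. \<exists>V. x \<in> V \<and> local_frame \<A> H k V \<xi>" \<xi>]) auto
  then obtain V' where V': "local_frame \<A> H k V' \<eta>" "x \<in> V'" by blast
  have f': "f' \<in> snd ?p" unfolding f'_def by (rule jet_of_SOME[OF f])
  have g': "g' \<in> snd ?r" unfolding g'_def by (rule jet_of_SOME[OF g])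
  obtain U \<phi> where U: "(U, \<phi>) \<in> \<A>" "x \<in> U" by (rule chart_at)
  note f'n = jet_ofD(1)[OF f'] and g'n = jet_ofD(1)[OF g']
  have jeq: "jet_of \<A> product_bundle 2 f' x = ?p"
    using jet_of_eqI[OF f'n f U] jet_ofD(2)[OF f' U(1) _ U(2), of UNIV] by (simp add: trivs_product_bundle del: taylor.simps)
  \<comment> \<open>A 0-jet fixes the components with a \<le> b only, and these are the ones
    entering \<open>form_rhs\<close>.\<close>
  have gcomp: "g' x (\<eta> a x) (\<eta> b x) = g x (\<eta> a x) (\<eta> b x)" if "a \<le> b" "b < k" for a b
  proof -
    have "taylor ?Q 0 (U, \<phi>) (\<lambda>x g (a, b). g (\<eta> a x) (\<eta> b x)) g' x =
        taylor ?Q 0 (U, \<phi>) (\<lambda>x g (a, b). g (\<eta> a x) (\<eta> b x)) g x"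
      by (rule jet_ofD(2)[OF g' U(1) frame_triv[OF V'(1)] U(2) V'(2)])
    then have "taylor ?Q 0 (U, \<phi>) (\<lambda>x g (a, b). g (\<eta> a x) (\<eta> b x)) g' x {#} (a, b) =
        taylor ?Q 0 (U, \<phi>) (\<lambda>x g (a, b). g (\<eta> a x) (\<eta> b x)) g x {#} (a, b)" by (simp only:)
    then show ?thesis unfolding taylor_quadratic_forms[OF U that] .
  qed
  have "inverse_symbol k H ?p ?r = min_solution (frame_index k) (free_vectors \<eta> f' x) (form_rhs \<eta> x (g' x))"
    by (simp add: inverse_symbol_def Let_def \<eta>_def f'_def g'_def)
  also have "\<dots> = min_solution (frame_index k) (free_vectors \<eta> f x) (form_rhs \<eta> x (g x))"
  proof (rule min_solution_cong)
    fix i assume i: "i \<in> frame_index k"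
    show "free_vectors \<eta> f' x i = free_vectors \<eta> f x i"
      by (rule free_vectors_eq_of_jet_eq[OF V' f'n f jeq i])
    show "form_rhs \<eta> x (g' x) i = form_rhs \<eta> x (g x) i"
      using i gcomp by (cases i) (auto simp: form_rhs_def)
  qed
  also have "\<dots> = min_solution (frame_index k) (free_vectors \<xi> f x) (form_rhs \<xi> x (g x))"
    using f free section_near_fibre[OF g] unfolding section_near_product_bundle
    by (intro min_solution_frame_independent[OF V V']) auto
  finally show ?thesis .
qed

text \<open>Over one frame the symbol is the minimal solution of a system whose data are linear in
  the jet coordinates. It is smooth on a relatively open set of coordinates containing those of P,
  and is then restricted to them.\<close>

lemma smooth_bundle_map_inverse_symbol:
  "smooth_bundle_map \<A> (quadratic_forms \<A> k H) 2 0 (free_jets k H)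
    (inverse_symbol k H :: ('a, real^'q::finite) jet \<Rightarrow> _)"
proof -
  let ?Q = "quadratic_forms \<A> k H"
  let ?E = "product_bundle :: ('a, real^'q, 'q) vbundle"
  let ?I = "frame_index k"
  let ?W = "UNIV \<times> jet_model ?E 2 \<times> jet_model ?Q 0 ::
    ((real^'m) \<times> ('m multiset \<Rightarrow> 'q \<Rightarrow> real) \<times> ('m multiset \<Rightarrow> nat \<times> nat \<Rightarrow> real)) set"
  have "\<exists>G. smooth_on ?W (coords ` P) G \<and> (\<forall>(p, r)\<in>P. inverse_symbol k H p r = G (coords (p, r)))"
    if U: "(U, \<phi>) \<in> \<A>" and V: "local_frame \<A> H k V \<xi>" and c: "c = (\<lambda>x g (a, b). g (\<xi> a x) (\<xi> b x))"
      and P: "P = {(p, r). p \<in> free_jets k H \<and> r \<in> jet_bundle \<A> ?Q 0 \<and> fst p = fst r \<and> fst p \<in> U \<inter> V}"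
      and coords: "coords = (\<lambda>(p, r). (\<phi> (fst p), jet_fibre_coords ?E 2 (U, \<phi>) vec_triv p,
        jet_fibre_coords ?Q 0 (U, \<phi>) c r))"
    for U \<phi> V \<xi> c P coords
  proof -
    \<comment> \<open>A triple q holds the base point in the chart, the coordinates of the 2-jet of
      f, and those of the 0-jet of g.\<close>
    define v where "v = (\<lambda>(q :: (real^'m) \<times> ('m multiset \<Rightarrow> 'q \<Rightarrow> real) \<times> ('m multiset \<Rightarrow> nat \<times> nat \<Rightarrow> real)) i.
      jet_vectors \<phi> \<xi> (inv_into U \<phi> (fst q)) (fst (snd q)) i)"
    define b where "b = (\<lambda>(q :: (real^'m) \<times> ('m multiset \<Rightarrow> 'q \<Rightarrow> real) \<times> ('m multiset \<Rightarrow> nat \<times> nat \<Rightarrow> real)).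
      case_sum (\<lambda>_ :: nat. 0) (\<lambda>p. - snd (snd q) {#} p))"
    define G where "G = (\<lambda>q. min_solution ?I (v q) (b q))"
    define T where "T = {q \<in> \<phi> ` (U \<inter> V) \<times> UNIV. lin_indep_family ?I (v q)}"
    let ?S = "T \<inter> ?W"
    have oUV: "open (U \<inter> V)" using chart_open[OF U] frame_open[OF V] by auto
    have "open T" unfolding T_def
    proof (rule open_lin_indep_family[OF finite_frame_index])
      show "open (\<phi> ` (U \<inter> V) \<times> (UNIV :: (('m multiset \<Rightarrow> 'q \<Rightarrow> real) \<times> ('m multiset \<Rightarrow> nat \<times> nat \<Rightarrow> real)) set))"
        by (intro open_Times chart_image_open[OF U] frame_open[OF V] open_UNIV)
      fix i assume "i \<in> ?I"
      let ?pr = "\<lambda>q :: (real^'m) \<times> ('m multiset \<Rightarrow> 'q \<Rightarrow> real) \<times> ('m multiset \<Rightarrow> nat \<times> nat \<Rightarrow> real). (fst q, fst (snd q))"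
      have pr: "continuous_on (\<phi> ` (U \<inter> V) \<times> UNIV) ?pr"
        by (intro continuous_intros)
      have sub: "?pr ` (\<phi> ` (U \<inter> V) \<times> UNIV) \<subseteq> \<phi> ` (U \<inter> V) \<times> UNIV"
        by (auto simp del: image_Int_subset)
      from continuous_on_compose2[OF continuous_on_jet_vectors[OF V U \<open>i \<in> ?I\<close>] pr sub]
      show "continuous_on (\<phi> ` (U \<inter> V) \<times> UNIV) (\<lambda>q. v q i)"
        by (simp add: v_def)
    qed
    then have lo: "line_open ?W ?S"
      by (intro line_open_Int_open subspace_Times subspace_jet_model subspace_UNIV)
    have sm: "smooth_on ?W ?S (\<lambda>q. h (inv_into U \<phi> (fst q)))" if "smooth_fun \<A> (U \<inter> V) h" for h
    proof (rule smooth_on_precompose_linear[where L = fst and W' = UNIV])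
      show "smooth_on UNIV (\<phi> ` (U \<inter> V)) (\<lambda>z. h (inv_into U \<phi> z))"
        using smooth_funD[OF that U] by (simp add: Int_absorb)
    qed (auto simp: T_def intro!: linear_fst continuous_intros)
    have sy: "smooth_on ?W ?S (\<lambda>q. fst (snd q) \<alpha> l)" for \<alpha> l
    proof (rule smooth_on_linear[OF lo])
      show "continuous_on ?S (\<lambda>q. fst (snd q) \<alpha> l)"
        by (rule continuous_on_compose2[OF continuous_on_apply2 continuous_on_fst[OF continuous_on_snd[OF continuous_on_id]]]) auto
    qed (auto simp: linear_iff scaleR_fun_def)
    have sw: "smooth_on ?W ?S (\<lambda>q. snd (snd q) \<alpha> l)" for \<alpha> l
    proof (rule smooth_on_linear[OF lo])
      show "continuous_on ?S (\<lambda>q. snd (snd q) \<alpha> l)"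
        by (rule continuous_on_compose2[OF continuous_on_apply2 continuous_on_snd[OF continuous_on_snd[OF continuous_on_id]]]) auto
    qed (auto simp: linear_iff scaleR_fun_def)
    have cU: "smooth_fun \<A> (U \<inter> V) (\<lambda>z. \<phi> z $ j)" for j
      using smooth_fun_coord[OF U] by (rule smooth_fun_subset) auto
    have X: "smooth_fun \<A> (U \<inter> V) (\<lambda>x. \<xi> a x (\<lambda>z. \<phi> z $ j))" if "a < k" for a j
      by (rule vector_field_smooth[OF frame_vector_field[OF V that] oUV _ cU]) auto
    have Y: "smooth_fun \<A> (U \<inter> V) (\<lambda>x. \<xi> a x (\<lambda>z. \<xi> b z (\<lambda>z. \<phi> z $ j)))" if "a < k" "b < k" for a b j
      by (rule vector_field_smooth[OF frame_vector_field[OF V that(1)] oUV _ X[OF that(2)]]) auto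
    have SX: "smooth_on ?W ?S (\<lambda>q. \<xi> a (inv_into U \<phi> (fst q)) (\<lambda>z. \<phi> z $ j))" if "a < k" for a j
      using sm[OF X[OF that]] .
    have SY: "smooth_on ?W ?S (\<lambda>q. \<xi> a (inv_into U \<phi> (fst q)) (\<lambda>z. \<xi> b z (\<lambda>z. \<phi> z $ j)))"
      if "a < k" "b < k" for a b j
      using sm[OF Y[OF that]] .
    have sv: "smooth_on ?W ?S (\<lambda>q. v q i)" if "i \<in> ?I" for i
      using that
      by (intro smooth_on_vec[OF lo], cases i)
         (auto simp: v_def jet_vectors_def
           intro!: smooth_on_add[OF lo] smooth_on_sum[OF lo] smooth_on_mult[OF lo] sy SX SY)
    have sb: "smooth_on ?W ?S (\<lambda>q. b q i)" if "i \<in> ?I" for i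
    proof (cases i)
      case (Inl a)
      then show ?thesis by (simp add: b_def smooth_on_const[OF lo])
    next
      case (Inr p)
      then show ?thesis
        using smooth_on_mult[OF lo smooth_on_const[OF lo, of "-1"] sw] by (simp add: b_def)
    qed
    have "smooth_on ?W ?S (\<lambda>q. min_solution ?I (\<lambda>i. v q i) (\<lambda>i. b q i))"
      by (rule smooth_on_min_solution[OF finite_frame_index lo sv sb]) (simp_all, simp add: T_def)
    then have GS: "smooth_on ?W ?S G" by (simp add: G_def)
    have *: "coords (p, r) \<in> ?S \<and> inverse_symbol k H p r = G (coords (p, r))" if pr: "(p, r) \<in> P" for p r
    proof -
      obtain f x where f: "p = jet_of \<A> ?E 2 f x" "section_near \<A> ?E x f" "free_at k H x f"
        using pr by (auto simp: P free_jets_def)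
      obtain g where g: "r = jet_of \<A> ?Q 0 g x" "section_near \<A> ?Q x g"
        using pr f(1) by (auto simp: P jet_bundle_def)
      have x: "x \<in> U" "x \<in> V" using pr f(1) by (auto simp: P)
      have cp: "coords (p, r) = (\<phi> x, taylor ?E 2 (U, \<phi>) vec_triv f x, taylor ?Q 0 (U, \<phi>) c g x)"
        using jet_fibre_coords_jet_of[OF f(2) U _ x(1), of UNIV vec_triv 2]
          jet_fibre_coords_jet_of[OF g(2) U frame_triv[OF V] x, of 0]
        by (simp add: coords f(1) g(1) c trivs_product_bundle del: taylor.simps)
      have vv: "free_vectors \<xi> f x i = v (coords (p, r)) i" if "i \<in> ?I" for i
        using free_vectors_taylor[OF V x(2) U x(1) _ that, of f] f(2) chart_inv[OF U x(1)]
        unfolding section_near_product_bundle by (simp add: v_def cp del: taylor.simps)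
      have bb: "form_rhs \<xi> x (g x) i = b (coords (p, r)) i" if "i \<in> ?I" for i
        using that taylor_quadratic_forms[OF U x(1), of _ _ k H \<xi> g]
        by (cases i) (auto simp: form_rhs_def b_def cp c simp del: taylor.simps)
      have "lin_indep_family ?I (v (coords (p, r)))"
        using free_at_frame[OF f(3) V x(2)] f(2) vv lin_indep_family_cong[of ?I "free_vectors \<xi> f x"]
        unfolding section_near_product_bundle by blast
      then have "coords (p, r) \<in> ?S"
        using x by (auto simp: T_def cp jet_model_def)
      moreover have "inverse_symbol k H p r = G (coords (p, r))"
        unfolding f(1) g(1) inverse_symbol_eq[OF V x(2) f(2,3) g(2)]
        using min_solution_cong[OF vv bb] by (simp add: G_def f(1) g(1))
      ultimately show ?thesis by blast
    qed
    show ?thesis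
    proof (intro exI[of _ G] conjI)
      have "coords q \<in> ?S" if "q \<in> P" for q
        using conjunct1[OF *[of "fst q" "snd q"]] that by (simp only: prod.collapse)
      then have "coords ` P \<subseteq> ?S" by (rule image_subsetI)
      then show "smooth_on ?W (coords ` P) G" by (rule smooth_on_subset[OF GS])
      show "\<forall>(p, r)\<in>P. inverse_symbol k H p r = G (coords (p, r))"
        by (clarify, rule conjunct2[OF *])
    qed
  qed
  then show ?thesis
    unfolding smooth_bundle_map_def Let_def by (auto simp: trivs_quadratic_forms)
qed

section \<open>The right inverse on sections\<close>

lemma pullback_metric_frame:
  assumes "local_frame \<A> H k V \<xi>" "x \<in> V" "a < k" "b < k"
  shows "pullback_metric H f x (\<xi> a x) (\<xi> b x) = lie_derivative (\<xi> a) f x \<bullet> lie_derivative (\<xi> b) f x"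
  using frame_mem[OF assms(1) _ assms(2)] assms(3,4) by (simp add: pullback_metric_def lie_derivative_def)

lemma pullback_metric_section:
  fixes f :: "'a \<Rightarrow> real^'q::finite"
  assumes H: "smooth_distribution \<A> k H" and f: "f \<in> C_inf \<A>"
  shows "pullback_metric H f \<in> sections \<A> (quadratic_forms \<A> k H)"
proof (rule sectionI)
  fix x
  obtain V \<xi> where V: "x \<in> V" "local_frame \<A> H k V \<xi>"
    using H unfolding smooth_distribution_def by blast
  have sub: "subspace (H x)" using frame_span[OF V(2,1)] by simp
  have "(\<lambda>y. r * v y) \<in> H x" if "v \<in> H x" for r v
    using subspace_scale[OF sub that, of r] by (simp add: scaleR_fun_def)
  then show "pullback_metric H f x \<in> fibre (quadratic_forms \<A> k H) x"
    by (auto simp: quadratic_forms_def pullback_metric_def subspace_add[OF sub] subspace_scale[OF sub]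
        inner_commute differential_def inner_vec_def scaleR_fun_def sum.distrib[symmetric] sum_distrib_left
        algebra_simps)
next
  fix V \<xi> a b assume V: "local_frame \<A> H k V \<xi>" and ab: "a \<le> b" "b < k"
  have s: "smooth_fun \<A> V (\<lambda>x. \<xi> c x (\<lambda>z. f z $ l))" if "c < k" for c l
    using f by (intro vector_field_smooth[OF frame_vector_field[OF V that] frame_open[OF V] order_refl])
      (auto simp: C_inf_iff intro: smooth_fun_subset)
  show "smooth_fun \<A> V (\<lambda>x. pullback_metric H f x (\<xi> a x) (\<xi> b x))"
  proof (rule smooth_fun_cong[OF frame_open[OF V]])
    show "smooth_fun \<A> V (\<lambda>x. \<Sum>l\<in>UNIV. \<xi> a x (\<lambda>z. f z $ l) * \<xi> b x (\<lambda>z. f z $ l))"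
      using ab by (intro smooth_fun_sum smooth_fun_mult frame_open[OF V] s) auto
  qed (use pullback_metric_frame[OF V, where f = f] ab order.strict_trans1[OF ab] in \<open>auto simp: inner_vec_def lie_derivative_nth\<close>)
qed

definition right_inverse :: "nat \<Rightarrow> ('a \<Rightarrow> 'a tangent_vector set) \<Rightarrow> ('a \<Rightarrow> real^'q::finite) \<Rightarrow>
    ('a \<Rightarrow> 'a tangent_vector \<Rightarrow> 'a tangent_vector \<Rightarrow> real) \<Rightarrow> 'a \<Rightarrow> real^'q" where
  "right_inverse k H f g x =
    inverse_symbol k H (jet_of \<A> product_bundle 2 f x) (jet_of \<A> (quadratic_forms \<A> k H) 0 g x)"

lemma free_maps_free_at: "f \<in> free_maps \<A> k H \<Longrightarrow> f \<in> C_inf \<A> \<and> free_at k H x f"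
  unfolding free_maps_eq sections_with_jets_in_def
  using jet_in_free_jets_iff[OF C_inf_section_near, of f x k H] by blast

lemma right_inverse_eq:
  assumes "f \<in> free_maps \<A> k H" "g \<in> sections \<A> (quadratic_forms \<A> k H)" "local_frame \<A> H k V \<xi>" "x \<in> V"
  shows "right_inverse k H f g x = min_solution (frame_index k) (free_vectors \<xi> f x) (form_rhs \<xi> x (g x))"
  unfolding right_inverse_def
  using free_maps_free_at[OF assms(1), of x]
  by (intro inverse_symbol_eq[OF assms(3,4)] section_near_of_section[OF assms(2)]) (auto intro: C_inf_section_near)

lemma free_vectors_lin_indep:
  assumes "f \<in> free_maps \<A> k H" "local_frame \<A> H k V \<xi>" "x \<in> V"
  shows "lin_indep_family (frame_index k) (free_vectors \<xi> f x)"
  using free_maps_free_at[OF assms(1), of x] C_inf_smooth_near by (intro free_at_frame[OF _ assms(2,3)]) auto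

text \<open>The frame chosen inside \<open>inverse_symbol\<close> may jump from point to point; near
  a given point it is replaced by one fixed smooth frame, and then the minimal solution is
  smooth.\<close>

lemma right_inverse_smooth:
  fixes f :: "'a \<Rightarrow> real^'q::finite"
  assumes H: "smooth_distribution \<A> k H" and f: "f \<in> free_maps \<A> k H"
    and g: "g \<in> sections \<A> (quadratic_forms \<A> k H)"
  shows "right_inverse k H f g \<in> C_inf \<A>"
  unfolding C_inf_iff
proof (intro allI smooth_fun_locally)
  fix l x
  obtain V \<xi> where V: "x \<in> V" "local_frame \<A> H k V \<xi>"
    using H unfolding smooth_distribution_def by blast
  note oV = frame_open[OF V(2)]
  let ?I = "frame_index k"
  let ?u = "\<lambda>x. min_solution ?I (free_vectors \<xi> f x) (form_rhs \<xi> x (g x))"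
  have fs: "smooth_fun \<A> V (\<lambda>y. f y $ l)" for l
    using free_maps_free_at[OF f] by (auto simp: C_inf_iff intro: smooth_fun_subset)
  have "smooth_fun \<A> V (\<lambda>x. ?u x $ l)"
  proof (rule smooth_funI)
    fix U \<phi> assume U: "(U, \<phi>) \<in> \<A>"
    let ?S = "\<phi> ` (U \<inter> V)"
    note lo = chart_line_open[OF U oV]
    have "smooth_on UNIV ?S (\<lambda>z. min_solution ?I (\<lambda>i. free_vectors \<xi> f (inv_into U \<phi> z) i)
        (\<lambda>i. form_rhs \<xi> (inv_into U \<phi> z) (g (inv_into U \<phi> z)) i))"
    proof (rule smooth_on_min_solution[OF finite_frame_index lo])
      fix i assume i: "i \<in> ?I"
      show "smooth_on UNIV ?S (\<lambda>z. free_vectors \<xi> f (inv_into U \<phi> z) i)"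
        by (rule smooth_on_vec[OF lo], rule smooth_funD[OF _ U],
            rule smooth_fun_free_vectors[OF V(2) oV order_refl fs i])
      have "smooth_fun \<A> V (\<lambda>x. form_rhs \<xi> x (g x) i)"
      proof (cases i)
        case (Inl a)
        then show ?thesis by (simp add: form_rhs_def smooth_fun_const[OF oV])
      next
        case (Inr p)
        then obtain a b where ab: "i = Inr (a, b)" "a \<le> b" "b < k" using i by (cases p) auto
        show ?thesis
          using smooth_fun_mult[OF oV smooth_fun_const[OF oV, of "-1"] section_smooth[OF g V(2) ab(2,3)]]
          by (simp add: form_rhs_def ab(1))
      qed
      then show "smooth_on UNIV ?S (\<lambda>z. form_rhs \<xi> (inv_into U \<phi> z) (g (inv_into U \<phi> z)) i)"
        using U by (rule smooth_funD)
    next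
      show "lin_indep_family ?I (\<lambda>i. free_vectors \<xi> f (inv_into U \<phi> z) i)" if "z \<in> ?S" for z
        using that chart_inv[OF U] free_vectors_lin_indep[OF f V(2)] by auto
    qed
    then show "smooth_on UNIV ?S (\<lambda>z. ?u (inv_into U \<phi> z) $ l)"
      by (rule smooth_on_nth[OF lo])
  qed
  then have "smooth_fun \<A> V (\<lambda>x. right_inverse k H f g x $ l)"
    by (rule smooth_fun_cong[OF oV, rotated]) (simp add: right_inverse_eq[OF f g V(2)])
  then show "\<exists>T. open T \<and> x \<in> T \<and> smooth_fun \<A> (UNIV \<inter> T) (\<lambda>x. right_inverse k H f g x $ l)"
    using V(1) oV by auto
qed

text \<open>The equations \<open>u \<bullet> L\<^sub>a f = 0\<close> hold near \<open>x\<close>, so they may be differentiated: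
  \<open>L\<^sub>b u \<bullet> L\<^sub>a f = - u \<bullet> L\<^sub>b L\<^sub>a f\<close>. The linearization is therefore algebraic in \<open>u\<close>.\<close>

lemma right_inverse_linearization:
  fixes f :: "'a \<Rightarrow> real^'q::finite"
  assumes H: "smooth_distribution \<A> k H" and f: "f \<in> free_maps \<A> k H"
    and g: "g \<in> sections \<A> (quadratic_forms \<A> k H)"
  shows "is_linearization (quadratic_forms \<A> k H) (pullback_metric H) f (right_inverse k H f g) g"
proof -
  let ?Q = "quadratic_forms \<A> k H"
  let ?u = "right_inverse k H f g"
  note fn = C_inf_smooth_near[OF conjunct1[OF free_maps_free_at[OF f]]]
    and un = C_inf_smooth_near[OF right_inverse_smooth[OF assms]]
  have "((\<lambda>\<epsilon>. pullback_metric H (\<lambda>y. f y + \<epsilon> *\<^sub>R ?u y) x (\<xi> a x) (\<xi> b x)) has_real_derivative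
      g x (\<xi> a x) (\<xi> b x)) (at 0)"
    if V: "local_frame \<A> H k V \<xi>" "x \<in> V" and ab: "a \<le> b" "b < k" for V \<xi> x a b
  proof -
    have a: "a < k" using ab by simp
    note sol = min_solution(2)[OF finite_frame_index free_vectors_lin_indep[OF f V(1)]]
    \<comment> \<open>Stated at all y in V and not just at x, since it is going to be
      differentiated.\<close>
    have ortho: "?u y \<bullet> lie_derivative (\<xi> c) f y = 0" if "c < k" "y \<in> V" for c y
      using sol[OF that(2), of "Inl c" "form_rhs \<xi> y (g y)"] that
      unfolding right_inverse_eq[OF f g V(1) that(2)] by (simp add: free_vectors_def form_rhs_def)
    have second: "?u x \<bullet> second_lie \<xi> f x a b = - g x (\<xi> a x) (\<xi> b x)"
      using sol[OF V(2), of "Inr (a, b)" "form_rhs \<xi> x (g x)"] ab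
      unfolding right_inverse_eq[OF f g V] by (simp add: free_vectors_def form_rhs_def)
    have diff: "lie_derivative (\<xi> c) ?u x \<bullet> lie_derivative (\<xi> d) f x =
        - (?u x \<bullet> lie_derivative (\<xi> c) (lie_derivative (\<xi> d) f) x)" if "c < k" "d < k" for c d
    proof -
      have v: "\<xi> c x \<in> tangent_space \<A> x" using frame_tangent[OF V(1) that(1) V(2)] .
      have n: "smooth_near \<A> x (\<lambda>y. \<xi> d y (\<lambda>z. f z $ l))" for l
        by (rule smooth_near_field[OF V(1) that(2) V(2) fn])
      have "0 = \<xi> c x (\<lambda>y. \<Sum>l\<in>UNIV. ?u y $ l * \<xi> d y (\<lambda>z. f z $ l))"
      proof -
        have "\<xi> c x (\<lambda>y. 0) = \<xi> c x (\<lambda>y. \<Sum>l\<in>UNIV. ?u y $ l * \<xi> d y (\<lambda>z. f z $ l))"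
          by (rule tangent_local[OF v frame_open[OF V(1)] V(2)])
             (use ortho[OF that(2)] in \<open>simp add: inner_vec_def lie_derivative_nth\<close>)
        then show ?thesis using tangent_const[OF v] by simp
      qed
      also have "\<dots> = (\<Sum>l\<in>UNIV. \<xi> c x (\<lambda>y. ?u y $ l * \<xi> d y (\<lambda>z. f z $ l)))"
        by (intro tangent_sum[OF v] smooth_near_mult un n)
      also have "\<dots> = (\<Sum>l\<in>UNIV. ?u x $ l * \<xi> c x (\<lambda>y. \<xi> d y (\<lambda>z. f z $ l)) +
          \<xi> d x (\<lambda>z. f z $ l) * \<xi> c x (\<lambda>y. ?u y $ l))"
        by (intro sum.cong refl tangent_mult[OF v un n])
      finally show ?thesis
        by (simp add: inner_vec_def lie_derivative_nth lie_derivative_lie_derivative_nth sum.distrib mult.commute)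
    qed
    have add: "lie_derivative (\<xi> c) (\<lambda>y. f y + \<epsilon> *\<^sub>R ?u y) x =
        lie_derivative (\<xi> c) f x + \<epsilon> *\<^sub>R lie_derivative (\<xi> c) ?u x" if "c < k" for c \<epsilon>
    proof -
      have v: "\<xi> c x \<in> tangent_space \<A> x" using frame_tangent[OF V(1) that V(2)] .
      have "\<xi> c x (\<lambda>z. f z $ l + \<epsilon> * ?u z $ l) = \<xi> c x (\<lambda>z. f z $ l) + \<epsilon> * \<xi> c x (\<lambda>z. ?u z $ l)" for l
        using tangent_add[OF v fn smooth_near_mult[OF smooth_near_const un]] tangent_cmult[OF v un] by simp
      then show ?thesis by (simp add: vec_eq_iff lie_derivative_nth)
    qed
    have "g x (\<xi> a x) (\<xi> b x) = - (?u x \<bullet> second_lie \<xi> f x a b)" using second by simp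
    also have "\<dots> = lie_derivative (\<xi> a) ?u x \<bullet> lie_derivative (\<xi> b) f x
        + lie_derivative (\<xi> b) ?u x \<bullet> lie_derivative (\<xi> a) f x"
      using diff[OF a ab(2)] diff[OF ab(2) a] by (simp add: second_lie_def inner_add_right)
    finally have g_eq: "g x (\<xi> a x) (\<xi> b x) = lie_derivative (\<xi> a) ?u x \<bullet> lie_derivative (\<xi> b) f x
        + lie_derivative (\<xi> b) ?u x \<bullet> lie_derivative (\<xi> a) f x" .
    \<comment> \<open>After expansion the metric is a quadratic polynomial in \<epsilon>, and
      \<open>g_eq\<close> identifies its linear coefficient.\<close>
    show ?thesis
      unfolding pullback_metric_frame[OF V a ab(2)] add[OF a] add[OF ab(2)] g_eq inner_add_left inner_add_right
        inner_scaleR_left inner_scaleR_right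
      by (auto intro!: derivative_eq_intros simp: inner_commute)
  qed
  moreover have "g x \<in> fibre ?Q x" for x
    using g by (simp add: local_sections_def)
  ultimately show ?thesis
    unfolding is_linearization_def by (auto simp: trivs_quadratic_forms idx_quadratic_forms)
qed

lemma sections_linear_combination:
  assumes g: "g \<in> sections \<A> (quadratic_forms \<A> k H)" and h: "h \<in> sections \<A> (quadratic_forms \<A> k H)"
  shows "(\<lambda>x. a *\<^sub>R g x + b *\<^sub>R h x) \<in> sections \<A> (quadratic_forms \<A> k H)"
proof (rule sectionI)
  fix x
  have "g x \<in> fibre (quadratic_forms \<A> k H) x" "h x \<in> fibre (quadratic_forms \<A> k H) x"
    using g h by (auto simp: local_sections_def)
  then show "a *\<^sub>R g x + b *\<^sub>R h x \<in> fibre (quadratic_forms \<A> k H) x"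
    by (simp add: quadratic_forms_def scaleR_fun_def algebra_simps)
next
  fix V \<xi> c d assume V: "local_frame \<A> H k V \<xi>" "c \<le> d" "d < k"
  note oV = frame_open[OF V(1)]
  have "smooth_fun \<A> V (\<lambda>x. a * g x (\<xi> c x) (\<xi> d x) + b * h x (\<xi> c x) (\<xi> d x))"
    by (rule smooth_fun_add[OF oV smooth_fun_mult[OF oV smooth_fun_const[OF oV] section_smooth[OF g V]]
        smooth_fun_mult[OF oV smooth_fun_const[OF oV] section_smooth[OF h V]]])
  then show "smooth_fun \<A> V (\<lambda>x. (a *\<^sub>R g x + b *\<^sub>R h x) (\<xi> c x) (\<xi> d x))"
    by (simp add: scaleR_fun_def)
qed

text \<open>By uniqueness of the minimal solution: the combination of the two solutions lies in the
  span and solves the combined system.\<close>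

lemma right_inverse_linear:
  fixes f :: "'a \<Rightarrow> real^'q::finite"
  assumes H: "smooth_distribution \<A> k H" and f: "f \<in> free_maps \<A> k H"
    and g: "g \<in> sections \<A> (quadratic_forms \<A> k H)" and h: "h \<in> sections \<A> (quadratic_forms \<A> k H)"
  shows "right_inverse k H f (\<lambda>x. a *\<^sub>R g x + b *\<^sub>R h x) =
    (\<lambda>x. a *\<^sub>R right_inverse k H f g x + b *\<^sub>R right_inverse k H f h x)"
proof
  fix x
  obtain V \<xi> where V: "x \<in> V" "local_frame \<A> H k V \<xi>"
    using H unfolding smooth_distribution_def by blast
  note sol = min_solution[OF finite_frame_index free_vectors_lin_indep[OF f V(2,1)]]
  show "right_inverse k H f (\<lambda>x. a *\<^sub>R g x + b *\<^sub>R h x) x =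
      a *\<^sub>R right_inverse k H f g x + b *\<^sub>R right_inverse k H f h x"
    unfolding right_inverse_eq[OF f g V(2,1)] right_inverse_eq[OF f h V(2,1)]
      right_inverse_eq[OF f sections_linear_combination[OF g h] V(2,1)]
  proof (rule min_solution_eqI)
    fix i assume "i \<in> frame_index k"
    then show "(a *\<^sub>R min_solution (frame_index k) (free_vectors \<xi> f x) (form_rhs \<xi> x (g x)) +
        b *\<^sub>R min_solution (frame_index k) (free_vectors \<xi> f x) (form_rhs \<xi> x (h x))) \<bullet> free_vectors \<xi> f x i =
        form_rhs \<xi> x (a *\<^sub>R g x + b *\<^sub>R h x) i"
      by (cases i) (auto simp: inner_add_left sol(2) form_rhs_def scaleR_fun_def)
  qed (intro span_add span_scale sol(1))
qed

lemma infinitesimally_invertible_pullback_metric: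
  assumes H: "smooth_distribution \<A> k H"
  shows "infinitesimally_invertible \<A> (quadratic_forms \<A> k H)
    (pullback_metric H :: ('a \<Rightarrow> real^'q::finite) \<Rightarrow> _) (free_maps \<A> k H)"
  unfolding infinitesimally_invertible_def
proof (intro conjI)
  show "\<forall>f\<in>C_inf \<A>. pullback_metric H (f :: 'a \<Rightarrow> real^'q) \<in> sections \<A> (quadratic_forms \<A> k H)"
    using pullback_metric_section[OF H] by blast
  show "\<exists>d s A \<Psi> M.
      open_in_jet_bundle \<A> product_bundle d A \<and>
      (free_maps \<A> k H :: ('a \<Rightarrow> real^'q) set) = sections_with_jets_in \<A> product_bundle d A \<and>
      smooth_bundle_map \<A> (quadratic_forms \<A> k H) d s A \<Psi> \<and>
      (\<forall>f\<in>free_maps \<A> k H.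
         (\<forall>g\<in>sections \<A> (quadratic_forms \<A> k H). M f g \<in> C_inf \<A> \<and>
            (\<forall>x. M f g x = \<Psi> (jet_of \<A> product_bundle d f x) (jet_of \<A> (quadratic_forms \<A> k H) s g x)) \<and>
            is_linearization (quadratic_forms \<A> k H) (pullback_metric H) f (M f g) g) \<and>
         (\<forall>g\<in>sections \<A> (quadratic_forms \<A> k H). \<forall>h\<in>sections \<A> (quadratic_forms \<A> k H). \<forall>a b.
            M f (\<lambda>x. a *\<^sub>R g x + b *\<^sub>R h x) = (\<lambda>x. a *\<^sub>R M f g x + b *\<^sub>R M f h x)))"
    \<comment> \<open>Order d = 2 because second derivatives of f occur, and s = 0 because g is
      never differentiated.\<close>
    by (rule exI[of _ 2], rule exI[of _ 0], rule exI[of _ "free_jets k H"],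
        rule exI[of _ "inverse_symbol k H"], rule exI[of _ "right_inverse k H"],
        intro conjI ballI allI open_free_jets free_maps_eq smooth_bundle_map_inverse_symbol
          right_inverse_smooth[OF H] right_inverse_linearization[OF H] right_inverse_linear[OF H])
       (simp_all add: right_inverse_def)
qed

end

section \<open>Bump functions and generic parameters\<close>

text \<open>The family t^(-k) exp (-1/t), extended by 0, is closed under differentiation up to
  linear combinations; k = 0 is the classical smooth function that is flat at 0.\<close>

definition bump_term :: "nat \<Rightarrow> real \<Rightarrow> real" where
  "bump_term k t = (if t \<le> 0 then 0 else inverse t ^ k * exp (- inverse t))"

lemma bump_term_tendsto: "(bump_term k \<longlongrightarrow> 0) (at 0)"
proof -
  have "((\<lambda>t. inverse t ^ k / exp (inverse t)) \<longlongrightarrow> 0) (at_right (0::real))"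
    by (rule filterlim_compose[OF tendsto_power_div_exp_0 filterlim_inverse_at_top_right])
  then have "(bump_term k \<longlongrightarrow> 0) (at_right 0)"
    by (rule Lim_transform_eventually)
       (auto simp: bump_term_def exp_minus divide_inverse eventually_at_filter)
  moreover have "(bump_term k \<longlongrightarrow> 0) (at_left 0)"
    by (rule Lim_transform_eventually[of "\<lambda>_. 0"]) (auto simp: bump_term_def eventually_at_filter)
  ultimately show ?thesis by (simp add: filterlim_split_at)
qed

lemma DERIV_bump_term:
  "(bump_term k has_real_derivative - real k * bump_term (Suc k) t + bump_term (Suc (Suc k)) t) (at t)"
proof (cases t "0::real" rule: linorder_cases)
  case less
  have "((\<lambda>_. 0) has_real_derivative 0) (at t)" by simp
  then have "(bump_term k has_real_derivative 0) (at t)"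
    by (rule DERIV_cong_ev[THEN iffD1, rotated -1, OF _ refl _ refl])
       (use less eventually_nhds_in_open[of "{..<0}" t] in \<open>auto simp: bump_term_def elim!: eventually_mono\<close>)
  then show ?thesis using less by (simp add: bump_term_def)
next
  case equal
  \<comment> \<open>The difference quotient at 0 is the next member of the family, which tends to
    0.\<close>
  have "(bump_term k has_real_derivative 0) (at 0)"
    unfolding DERIV_def
  proof (rule Lim_transform_eventually[OF bump_term_tendsto[of "Suc k"]])
    show "\<forall>\<^sub>F h in at 0. bump_term (Suc k) h = (bump_term k (0 + h) - bump_term k 0) / h"
      by (auto simp: bump_term_def eventually_at_filter field_simps)
  qed
  then show ?thesis using equal by (simp add: bump_term_def)
next
  case greater
  have "((\<lambda>t. inverse t ^ k * exp (- inverse t)) has_real_derivative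
      - real k * (inverse t ^ Suc k * exp (- inverse t)) + inverse t ^ Suc (Suc k) * exp (- inverse t)) (at t)"
  proof -
    have i: "(inverse has_real_derivative - (inverse t ^ Suc (Suc 0))) (at t)"
      using greater by (intro DERIV_inverse) simp
    have "((\<lambda>t. inverse t ^ k) has_real_derivative - real k * inverse t ^ Suc k) (at t)"
      by (rule DERIV_cong[OF DERIV_power[OF i]]) (cases k; simp add: algebra_simps)
    from DERIV_mult[OF this DERIV_fun_exp[OF DERIV_minus[OF i]]]
    show ?thesis by (rule DERIV_cong) (simp add: algebra_simps)
  qed
  then have "(bump_term k has_real_derivative
      - real k * (inverse t ^ Suc k * exp (- inverse t)) + inverse t ^ Suc (Suc k) * exp (- inverse t)) (at t)"
    by (rule DERIV_cong_ev[THEN iffD1, rotated -1, OF _ refl _ refl])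
       (use greater eventually_nhds_in_open[of "{0<..}" t] in \<open>auto simp: bump_term_def elim!: eventually_mono\<close>)
  then show ?thesis using greater by (simp add: bump_term_def)
qed

lemma smooth_on_bump_term: "smooth_on UNIV UNIV (bump_term k)"
proof (rule smooth_onI)
  fix n show "Ck_on n UNIV UNIV (bump_term k)"
  proof (induction n arbitrary: k)
    case 0
    show ?case
      using DERIV_isCont[OF DERIV_bump_term] by (simp add: continuous_at_imp_continuous_on)
  next
    case (Suc n)
    have lo: "line_open UNIV (UNIV :: real set)" by (rule line_open_UNIV) simp
    show ?case
    proof (rule Ck_on_SucI[OF lo, where F' = "\<lambda>w t. w * (- real k * bump_term (Suc k) t + bump_term (Suc (Suc k)) t)"])
      show "continuous_on UNIV (bump_term k)"
        using DERIV_isCont[OF DERIV_bump_term] by (simp add: continuous_at_imp_continuous_on)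
      show "Ck_on n UNIV UNIV (\<lambda>t. w * (- real k * bump_term (Suc k) t + bump_term (Suc (Suc k)) t))" for w
        by (intro Ck_on_bounded_bilinear[OF bounded_bilinear_mult] Ck_on_add Ck_on_const lo Suc.IH)
      show "((\<lambda>s. bump_term k (t + s *\<^sub>R w)) has_vector_derivative
          w * (- real k * bump_term (Suc k) t + bump_term (Suc (Suc k)) t)) (at 0)" for w t
      proof -
        have "((\<lambda>s. t + s * w) has_real_derivative w) (at 0)"
          by (auto intro!: derivative_eq_intros)
        moreover have "(bump_term k has_real_derivative
            - real k * bump_term (Suc k) t + bump_term (Suc (Suc k)) t) (at (t + 0 * w))"
          using DERIV_bump_term by simp
        ultimately have "((\<lambda>s. bump_term k (t + s * w)) has_real_derivative
            (- real k * bump_term (Suc k) t + bump_term (Suc (Suc k)) t) * w) (at 0)"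
          by (rule DERIV_chain2[rotated])
        then show ?thesis
          by (simp add: has_real_derivative_iff_has_vector_derivative[symmetric] mult.commute)
      qed
    qed
  qed
qed

lemma smooth_plateau:
  fixes p :: "real^'m::finite"
  assumes "r > 0"
  shows "\<exists>\<rho>. smooth_on UNIV UNIV \<rho> \<and> (\<forall>z\<in>ball p (2 * r). \<rho> z = 1) \<and> (\<forall>z. z \<notin> ball p (3 * r) \<longrightarrow> \<rho> z = (0::real))"
proof -
  have lo: "line_open UNIV (UNIV :: real set)" "line_open UNIV (UNIV :: (real^'m) set)"
    by (simp_all add: line_open_UNIV)
  \<comment> \<open>A smooth step from 0 for t \<le> 0 to 1 for t \<ge> 1. The denominator is
    positive because t and 1 - t are never both \<le> 0.\<close>
  define \<psi> where "\<psi> = (\<lambda>t. bump_term 0 t * inverse (bump_term 0 t + bump_term 0 (1 - t)))"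
  have pos: "bump_term 0 t + bump_term 0 (1 - t) \<noteq> 0" for t
  proof -
    have "bump_term 0 t + bump_term 0 (1 - t) > 0"
      by (cases "t \<le> 0") (auto simp: bump_term_def add_pos_pos)
    then show ?thesis by simp
  qed
  have "smooth_on UNIV UNIV (\<lambda>t. bump_term 0 (1 - t))"
    by (rule smooth_on_compose[OF smooth_on_bump_term open_UNIV subset_UNIV _ lo(1)])
       (intro smooth_on_diff smooth_on_const smooth_on_linear lo continuous_intros linear_ident)
  then have \<psi>: "smooth_on UNIV UNIV \<psi>"
    unfolding \<psi>_def
    by (intro smooth_on_mult smooth_on_inverse smooth_on_add smooth_on_bump_term lo pos)
  have \<psi>0: "\<psi> t = 0" if "t \<le> 0" for t using that by (simp add: \<psi>_def bump_term_def)
  have \<psi>1: "\<psi> t = 1" if "t \<ge> 1" for t using that by (simp add: \<psi>_def bump_term_def)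
  \<comment> \<open>Scaled so that s = 1 at distance 2r and s = 0 at distance 3r from p, since 9 - 4
    = 5.\<close>
  define s where "s = (\<lambda>z. (9 * r\<^sup>2 - (z - p) \<bullet> (z - p)) * inverse (5 * r\<^sup>2))"
  have "smooth_on UNIV UNIV s"
    unfolding s_def
    by (intro smooth_on_mult smooth_on_diff smooth_on_inner smooth_on_const smooth_on_linear lo
        continuous_intros linear_ident)
  then have "smooth_on UNIV UNIV (\<lambda>z. \<psi> (s z))"
    by (rule smooth_on_compose[OF \<psi> open_UNIV subset_UNIV _ lo(2)])
  moreover have "\<psi> (s z) = 1" if "z \<in> ball p (2 * r)" for z
  proof (rule \<psi>1)
    have "norm (z - p) \<le> 2 * r" using that by (simp add: dist_norm norm_minus_commute)
    then have "(norm (z - p))\<^sup>2 \<le> (2 * r)\<^sup>2" by (intro power_mono) auto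
    then show "1 \<le> s z" using assms by (simp add: s_def power2_norm_eq_inner power_mult_distrib field_simps)
  qed
  moreover have "\<psi> (s z) = 0" if "z \<notin> ball p (3 * r)" for z
  proof (rule \<psi>0)
    have "3 * r \<le> norm (z - p)" using that by (simp add: dist_norm norm_minus_commute)
    then have "(3 * r)\<^sup>2 \<le> (norm (z - p))\<^sup>2" using assms by (intro power_mono) auto
    then show "s z \<le> 0" using assms by (simp add: s_def power2_norm_eq_inner power_mult_distrib field_simps)
  qed
  ultimately show ?thesis by blast
qed

text \<open>A bad parameter \<open>\<theta>\<close> is determined by a point \<open>z\<close>, a coefficient family \<open>c\<close> normalized by
  \<open>c i0 = 1\<close>, and the entries of \<open>\<theta>\<close> off one column \<open>l0\<close>. There are at most \<open>CARD('q) - 1\<close>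
  coordinates of \<open>(z, c)\<close>; they are stored in column \<open>l0\<close>, leaving an entry \<open>q0\<close> of that column
  unused. So the bad set is a smooth image of part of a hyperplane.\<close>

lemma negligible_bad_parameters:
  fixes E :: "'p::finite \<Rightarrow> 'i \<Rightarrow> real^'m::finite \<Rightarrow> real" and F :: "'q::finite \<Rightarrow> 'i \<Rightarrow> real^'m \<Rightarrow> real"
  assumes I: "finite I" "CARD('m) + card I \<le> CARD('q)" and \<Omega>: "open \<Omega>"
    and E: "\<And>l i. i \<in> I \<Longrightarrow> smooth_on UNIV \<Omega> (E l i)" and F: "\<And>q i. i \<in> I \<Longrightarrow> smooth_on UNIV \<Omega> (F q i)"
    and nondeg: "\<And>z c. z \<in> \<Omega> \<Longrightarrow> \<exists>i\<in>I. c i \<noteq> 0 \<Longrightarrow> \<exists>l. (\<Sum>i\<in>I. c i * E l i z) \<noteq> 0"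
  shows "negligible {\<theta> :: real^'p^'q. \<exists>z\<in>\<Omega>. \<exists>c. (\<exists>i\<in>I. c i \<noteq> 0) \<and>
    (\<forall>q. (\<Sum>i\<in>I. c i * (F q i z + (\<Sum>l\<in>UNIV. \<theta> $ q $ l * E l i z))) = 0)}"
proof -
  define eqs where "eqs = (\<lambda>(\<theta> :: real^'p^'q) z c. \<forall>q. (\<Sum>i\<in>I. c i * (F q i z + (\<Sum>l\<in>UNIV. \<theta> $ q $ l * E l i z))) = 0)"
  \<comment> \<open>Bad parameters are sorted by an index i0 where c can be normalized to 1 and a
    column l0 whose coefficient sum can be divided by. These are finitely many cases.\<close>
  define Bad where "Bad = (\<lambda>i0 l0. {\<theta>. \<exists>z\<in>\<Omega>. \<exists>c. c i0 = 1 \<and> (\<Sum>i\<in>I. c i * E l0 i z) \<noteq> 0 \<and> eqs \<theta> z c})"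
  have "card (UNIV <+> I :: ('m + 'i) set) \<le> card (UNIV :: 'q set)"
    using I by (simp add: card_Plus)
  from card_le_inj[OF finite_Plus[OF finite I(1)] finite this]
  obtain h :: "'m + 'i \<Rightarrow> 'q" where h: "inj_on h (UNIV <+> I)"
    by blast
  have "negligible (Bad i0 l0)" if i0: "i0 \<in> I" for i0 l0
  proof -
    define q0 where "q0 = h (Inr i0)"
    \<comment> \<open>Z and C decode the point and the coefficients from column l0 of a matrix
      \<eta>.\<close>
    define Z where "Z = (\<lambda>\<eta> :: real^'p^'q. \<chi> m. \<eta> $ h (Inl m) $ l0)"
    define C where "C = (\<lambda>(\<eta> :: real^'p^'q) i. if i = i0 then 1 else \<eta> $ h (Inr i) $ l0)"
    define D where "D = (\<lambda>\<eta>. \<Sum>i\<in>I. C \<eta> i * E l0 i (Z \<eta>))"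
    \<comment> \<open>N_q is the q-th equation without its l0 term. The equation becomes N_q +
      \<theta>_(q,l0) D = 0 and is solved for the missing entry in \<Phi>.\<close>
    define N where "N = (\<lambda>q \<eta>. \<Sum>i\<in>I. C \<eta> i * (F q i (Z \<eta>) + (\<Sum>l\<in>UNIV - {l0}. \<eta> $ q $ l * E l i (Z \<eta>))))"
    define \<Phi> where "\<Phi> = (\<lambda>\<eta>. \<chi> q. \<chi> l. if l = l0 then - 1 * (N q \<eta> * inverse (D \<eta>)) else \<eta> $ q $ l)"
    define T where "T = {\<eta>. Z \<eta> \<in> \<Omega> \<and> D \<eta> \<noteq> 0}"
    define P where "P = {\<eta> :: real^'p^'q. \<eta> $ q0 $ l0 = 0}"
    let ?T0 = "Z -` \<Omega>"
    have cZ: "continuous_on UNIV Z" unfolding Z_def by (intro continuous_intros)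
    have oT0: "open ?T0" using open_vimage[OF \<Omega> cZ] .
    have entry: "smooth_on UNIV S (\<lambda>\<eta> :: real^'p^'q. \<eta> $ q $ l)" if "open S" for S q l
      by (intro smooth_on_linear line_open_UNIV that continuous_intros) (auto simp: linear_iff)
    have C: "smooth_on UNIV S (\<lambda>\<eta>. C \<eta> i)" if "open S" for S i
      unfolding C_def using entry[OF that] smooth_on_const[OF line_open_UNIV[OF that]] by (cases "i = i0") auto
    have Zs: "smooth_on UNIV S Z" if "open S" for S
      by (rule smooth_on_vec[OF line_open_UNIV[OF that]]) (simp add: Z_def entry that)
    have comp: "smooth_on UNIV S (\<lambda>\<eta>. h (Z \<eta>))" if "smooth_on UNIV \<Omega> h" "open S" "S \<subseteq> ?T0" for S and h :: "_ \<Rightarrow> real"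
      by (rule smooth_on_compose[OF that(1) \<Omega> _ Zs[OF that(2)] line_open_UNIV[OF that(2)]]) (use that in auto)
    have D: "smooth_on UNIV S D" if "open S" "S \<subseteq> ?T0" for S
      unfolding D_def using that by (intro smooth_on_sum smooth_on_mult C comp E line_open_UNIV) auto
    have T_eq: "T = ?T0 \<inter> D -` (- {0})" by (auto simp: T_def)
    have oT: "open T" unfolding T_eq
      by (rule continuous_open_preimage[OF smooth_on_continuous[OF D] oT0]) (auto simp: oT0)
    have T0: "T \<subseteq> ?T0" by (auto simp: T_def)
    note lo = line_open_UNIV[OF oT]
    have Ns: "smooth_on UNIV T (N q)" for q
      unfolding N_def by (intro smooth_on_sum smooth_on_mult smooth_on_add C comp E F entry lo oT T0)
    have "smooth_on UNIV T (\<lambda>\<eta>. \<Phi> \<eta> $ q $ l)" for q l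
    proof (cases "l = l0")
      case True
      have "smooth_on UNIV T (\<lambda>\<eta>. - 1 * (N q \<eta> * inverse (D \<eta>)))"
        by (intro smooth_on_mult smooth_on_const smooth_on_inverse Ns D lo oT T0) (auto simp: T_def)
      then show ?thesis using True by (simp add: \<Phi>_def)
    qed (simp add: \<Phi>_def entry oT)
    then have "smooth_on UNIV T (\<lambda>\<eta>. \<Phi> \<eta> $ q)" for q
      by (intro smooth_on_vec[OF lo])
    then have \<Phi>s: "smooth_on UNIV T \<Phi>"
    proof -
      assume *: "\<And>q. smooth_on UNIV T (\<lambda>\<eta>. \<Phi> \<eta> $ q)"
      have "bounded_linear (axis q :: real^'p \<Rightarrow> real^'p^'q)" for q
        unfolding linear_conv_bounded_linear[symmetric] by (auto simp: linear_iff axis_def vec_eq_iff)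
      then have "smooth_on UNIV T (\<lambda>\<eta>. \<Sum>q\<in>UNIV. axis q (\<Phi> \<eta> $ q))"
        by (intro smooth_on_sum lo smooth_on_bounded_linear[OF _ *])
      moreover have "(\<lambda>\<eta>. \<Sum>q\<in>UNIV. axis q (\<Phi> \<eta> $ q)) = \<Phi>"
        by (simp add: fun_eq_iff vec_eq_iff axis_def if_distrib[of "\<lambda>x. x $ _"] cong: if_cong)
      ultimately show ?thesis by simp
    qed
    have "\<Phi> differentiable_on (T \<inter> P)"
      unfolding differentiable_on_def
      using Ck_on_imp_has_derivative[OF smooth_onD[OF \<Phi>s] oT]
      by (blast intro: differentiableI has_derivative_at_withinI)
    \<comment> \<open>The entry q0 of column l0 belongs to the normalized coefficient c_i0 and
      carries no information, so it is set to 0 and cuts out a hyperplane.\<close>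
    moreover have "negligible (T \<inter> P)"
    proof (rule negligible_subset)
      show "negligible {\<eta> :: real^'p^'q. axis q0 (axis l0 1) \<bullet> \<eta> = 0}"
        by (rule negligible_hyperplane) (simp add: axis_eq_0_iff)
      show "T \<inter> P \<subseteq> {\<eta>. axis q0 (axis l0 1) \<bullet> \<eta> = 0}"
        by (auto simp: P_def inner_axis inner_commute[of "axis _ _"])
    qed
    ultimately have "negligible (\<Phi> ` (T \<inter> P))"
      by (intro negligible_differentiable_image_negligible) auto
    moreover have "Bad i0 l0 \<subseteq> \<Phi> ` (T \<inter> P)"
    proof
      fix \<theta> assume "\<theta> \<in> Bad i0 l0"
      then obtain z c where z: "z \<in> \<Omega>" and c: "c i0 = 1" "(\<Sum>i\<in>I. c i * E l0 i z) \<noteq> 0" and eq: "eqs \<theta> z c"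
        by (auto simp: Bad_def)
      \<comment> \<open>The slot of i0 receives 0 to land in P; \<open>C\<close> puts the value 1
        back when decoding.\<close>
      define code where "code = (\<lambda>s. case s of Inl m \<Rightarrow> z $ m | Inr i \<Rightarrow> if i = i0 then 0 else c i)"
      define \<eta> :: "real^'p^'q" where
        "\<eta> = (\<chi> q. \<chi> l. if l = l0 then (if q \<in> h ` (UNIV <+> I) then code (the_inv_into (UNIV <+> I) h q) else 0) else \<theta> $ q $ l)"
      have col: "\<eta> $ h s $ l0 = code s" if "s \<in> UNIV <+> I" for s
        using that by (simp add: \<eta>_def the_inv_into_f_f[OF h])
      have off: "\<eta> $ q $ l = \<theta> $ q $ l" if "l \<noteq> l0" for q l
        using that by (simp add: \<eta>_def)
      have Z\<eta>: "Z \<eta> = z" by (simp add: Z_def vec_eq_iff col code_def InlI)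
      have C\<eta>: "C \<eta> i = c i" if "i \<in> I" for i
        using that c(1) by (simp add: C_def col code_def InrI)
      have D\<eta>: "D \<eta> = (\<Sum>i\<in>I. c i * E l0 i z)"
        unfolding D_def Z\<eta> by (simp add: C\<eta>)
      have N\<eta>: "N q \<eta> = - (\<theta> $ q $ l0 * D \<eta>)" for q
      proof -
        have "0 = (\<Sum>i\<in>I. c i * (F q i z + (\<Sum>l\<in>UNIV. \<theta> $ q $ l * E l i z)))"
          using eq by (simp add: eqs_def)
        also have "\<dots> = (\<Sum>i\<in>I. c i * (F q i z + (\<Sum>l\<in>UNIV - {l0}. \<eta> $ q $ l * E l i z)) + \<theta> $ q $ l0 * (c i * E l0 i z))"
          by (simp add: sum.remove[of UNIV l0] off algebra_simps)
        also have "\<dots> = N q \<eta> + \<theta> $ q $ l0 * D \<eta>"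
          unfolding N_def Z\<eta> D\<eta> by (simp add: C\<eta> sum.distrib sum_distrib_left)
        finally show ?thesis by simp
      qed
      have "\<eta> \<in> T" using z c(2) by (simp add: T_def Z\<eta> D\<eta>)
      moreover have "\<eta> \<in> P"
        using col[of "Inr i0"] i0 by (simp add: P_def q0_def code_def InrI)
      moreover have "\<Phi> \<eta> = \<theta>"
        using c(2) by (simp add: \<Phi>_def vec_eq_iff N\<eta> off D\<eta>)
      ultimately show "\<theta> \<in> \<Phi> ` (T \<inter> P)" by (metis IntI imageI)
    qed
    ultimately show ?thesis by (rule negligible_subset)
  qed
  then have "negligible (\<Union>i0\<in>I. \<Union>l0. Bad i0 l0)"
    using I(1) by (intro negligible_Union finite_imageI) (auto intro!: negligible_Union)
  then show ?thesis
  proof (rule negligible_subset, intro subsetI)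
    fix \<theta> assume "\<theta> \<in> {\<theta> :: real^'p^'q. \<exists>z\<in>\<Omega>. \<exists>c. (\<exists>i\<in>I. c i \<noteq> 0) \<and>
      (\<forall>q. (\<Sum>i\<in>I. c i * (F q i z + (\<Sum>l\<in>UNIV. \<theta> $ q $ l * E l i z))) = 0)}"
    then obtain z c i0 where z: "z \<in> \<Omega>" and i0: "i0 \<in> I" "c i0 \<noteq> 0" and eq: "eqs \<theta> z c"
      unfolding eqs_def by blast
    obtain l0 where l0: "(\<Sum>i\<in>I. c i * E l0 i z) \<noteq> 0" using nondeg[OF z] i0 by blast
    \<comment> \<open>The equations are homogeneous in c, so rescaling to c' i0 = 1 preserves
      them.\<close>
    define c' where "c' = (\<lambda>i. inverse (c i0) * c i)"
    have "(\<Sum>i\<in>I. c' i * G i) = inverse (c i0) * (\<Sum>i\<in>I. c i * G i)" for G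
      by (simp add: c'_def sum_distrib_left mult.assoc)
    then have "(\<Sum>i\<in>I. c' i * E l0 i z) \<noteq> 0" "eqs \<theta> z c'"
      using l0 i0 eq by (auto simp: eqs_def)
    moreover have "c' i0 = 1" using i0 by (simp add: c'_def)
    ultimately show "\<theta> \<in> (\<Union>i0\<in>I. \<Union>l0. Bad i0 l0)"
      using z i0 by (auto simp: Bad_def)
  qed
qed

section \<open>Jets of perturbed maps\<close>

lemma card_frame_index: "card (frame_index k) = k + k * (k + 1) div 2"
proof -
  have fin: "finite {(a, b). a \<le> b \<and> b < k}" for k :: nat
    by (rule finite_subset[of _ "{..<k} \<times> {..<k}"]) auto
  have "card {(a, b). a \<le> b \<and> b < k} = k * (k + 1) div 2" for k :: nat
  proof (induction k)
    case (Suc k)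
    have "{(a, b). a \<le> b \<and> b < Suc k} = {(a, b). a \<le> b \<and> b < k} \<union> (\<lambda>a. (a, k)) ` {..k}"
      by auto
    moreover have "card ({(a, b). a \<le> b \<and> b < k} \<union> (\<lambda>a. (a, k)) ` {..k}) =
        card {(a, b). a \<le> b \<and> b < k} + card ((\<lambda>a. (a, k)) ` {..k})"
      using fin by (intro card_Un_disjoint) auto
    moreover have "card ((\<lambda>a. (a, k)) ` {..k}) = Suc k"
      by (simp add: card_image inj_on_def)
    ultimately show ?case using Suc.IH by simp
  qed simp
  then show ?thesis
    unfolding frame_index_def by (simp add: card_Plus fin)
qed

text \<open>Contracting a symmetric product with a and b; with dual vectors for a and b this
  isolates single coefficients of a second-order symbol.\<close>

lemma symmetric_product_contraction:
  fixes a b x y :: "real^'m::finite"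
  shows "(\<Sum>j\<in>UNIV. \<Sum>m\<in>UNIV. a $ j * b $ m * (e * (x $ j * y $ m + x $ m * y $ j))) =
    e * ((a \<bullet> x) * (b \<bullet> y) + (a \<bullet> y) * (b \<bullet> x))"
proof -
  have "(a \<bullet> v) * (b \<bullet> w) = (\<Sum>j\<in>UNIV. \<Sum>m\<in>UNIV. a $ j * b $ m * (v $ j * w $ m))" for v w
    by (simp add: inner_vec_def sum_product mult_ac)
  then show ?thesis
    by (simp add: sum_distrib_left sum.distrib[symmetric] algebra_simps)
qed

text \<open>Ordered pairs list each mixed product twice, but make the index a finite type that can
  serve as the column dimension of the parameter matrix.\<close>

definition monomial :: "'m + 'm \<times> 'm \<Rightarrow> real^'m::finite \<Rightarrow> real" where
  "monomial l z = (case l of Inl i \<Rightarrow> z $ i | Inr (i, j) \<Rightarrow> z $ i * z $ j)"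

lemma smooth_on_monomial: "open S \<Longrightarrow> smooth_on UNIV S (monomial l)"
  unfolding monomial_def
  by (cases l) (auto intro!: smooth_on_mult smooth_on_vec_nth line_open_UNIV split: prod.split)

definition perturb :: "('a \<Rightarrow> real^'q::finite) \<Rightarrow> ('p::finite \<Rightarrow> 'a \<Rightarrow> real) \<Rightarrow> real^'p^'q \<Rightarrow> 'a \<Rightarrow> real^'q" where
  "perturb f u \<theta> y = f y + (\<chi> q. \<Sum>l\<in>UNIV. \<theta> $ q $ l * u l y)"

text \<open>One component of \<open>free_vectors\<close>, so that components of a map and the scalar
  perturbing functions are handled by the same operators.\<close>

definition scalar_vectors ::
    "(nat \<Rightarrow> 'a \<Rightarrow> 'a tangent_vector) \<Rightarrow> ('a \<Rightarrow> real) \<Rightarrow> 'a \<Rightarrow> nat + nat \<times> nat \<Rightarrow> real" where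
  "scalar_vectors \<xi> h x = case_sum (\<lambda>a. \<xi> a x h)
    (\<lambda>(a, b). \<xi> a x (\<lambda>z. \<xi> b z h) + \<xi> b x (\<lambda>z. \<xi> a z h))"

lemma free_vectors_nth: "free_vectors \<xi> f x i $ q = scalar_vectors \<xi> (\<lambda>z. f z $ q) x i"
  by (cases i) (auto simp: free_vectors_def scalar_vectors_def second_lie_def lie_derivative_nth)

context smooth_manifold
begin

lemma perturb_C_inf:
  assumes "f \<in> C_inf \<A>" "\<And>l. smooth_fun \<A> UNIV (u l)" shows "perturb f u \<theta> \<in> C_inf \<A>"
  using assms unfolding C_inf_iff perturb_def
  by (auto intro!: smooth_fun_add smooth_fun_sum smooth_fun_mult smooth_fun_const)

lemma taylor_perturb:
  fixes f :: "'a \<Rightarrow> real^'q::finite"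
  assumes f: "f \<in> C_inf \<A>" and u: "\<And>l. smooth_fun \<A> UNIV (u l)" and U: "(U, \<phi>) \<in> \<A>" "x \<in> U"
  shows "taylor product_bundle r (U, \<phi>) vec_triv (perturb f u \<theta>) x \<alpha> q =
    (if size \<alpha> \<le> r then pderivs (SOME is. mset is = \<alpha>) (\<lambda>z. f (inv_into U \<phi> z) $ q) (\<phi> x) +
      (\<Sum>l\<in>UNIV. \<theta> $ q $ l * pderivs (SOME is. mset is = \<alpha>) (\<lambda>z. u l (inv_into U \<phi> z)) (\<phi> x)) else 0)"
proof -
  have o: "open (\<phi> ` (U \<inter> UNIV))" "\<phi> x \<in> \<phi> ` (U \<inter> UNIV)"
    using chart_image_open[OF U(1) open_UNIV] U by auto
  have fs: "smooth_on UNIV (\<phi> ` (U \<inter> UNIV)) (\<lambda>z. f (inv_into U \<phi> z) $ q)"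
    using f unfolding C_inf_iff by (intro smooth_funD[OF _ U(1)]) auto
  have us: "smooth_on UNIV (\<phi> ` (U \<inter> UNIV)) (\<lambda>z. u l (inv_into U \<phi> z))" for l
    using smooth_funD[OF u U(1)] .
  have ss: "smooth_on UNIV (\<phi> ` (U \<inter> UNIV)) (\<lambda>z. \<Sum>l\<in>UNIV. \<theta> $ q $ l * u l (inv_into U \<phi> z))"
    by (intro smooth_on_sum smooth_on_mult smooth_on_const line_open_UNIV o us)
  show ?thesis
    using pderivs_add[OF o fs ss] pderivs_sum[OF o us, where I = UNIV and c = "\<lambda>l. \<theta> $ q $ l"]
    by (simp add: perturb_def o_def partial_deriv_pderivs)
qed

text \<open>Jet coordinates depend jointly continuously on the point and on \<theta>, so an open
  condition holding at (x, 0) holds on a product neighbourhood. Equality of coordinates in one chart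
  then identifies the perturbed jet with a member of A.\<close>

lemma perturb_jets_locally:
  fixes f :: "'a \<Rightarrow> real^'q::finite" and u :: "'p::finite \<Rightarrow> 'a \<Rightarrow> real"
  assumes f: "f \<in> C_inf \<A>" and u: "\<And>l. smooth_fun \<A> UNIV (u l)"
    and A: "open_in_jet_bundle \<A> product_bundle r A" and x: "jet_of \<A> product_bundle r f x \<in> A"
  shows "\<exists>N. open N \<and> x \<in> N \<and>
    (\<forall>\<^sub>F \<theta> in nhds 0. \<forall>y\<in>N. jet_of \<A> product_bundle r (perturb f u \<theta>) y \<in> A)"
proof -
  let ?E = "product_bundle :: ('a, real^'q, 'q) vbundle"
  obtain U \<phi> where U: "(U, \<phi>) \<in> \<A>" "x \<in> U" by (rule chart_at)
  let ?im = "(\<lambda>p. (\<phi> (fst p), jet_fibre_coords ?E r (U, \<phi>) vec_triv p)) ` {p \<in> A. fst p \<in> U \<inter> UNIV}"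
  have "openin (top_of_set (UNIV \<times> jet_model ?E r)) ?im"
    using A U(1) unfolding open_in_jet_bundle_def by (fastforce simp: trivs_product_bundle)
  then obtain T where T: "open T" "?im = (UNIV \<times> jet_model ?E r) \<inter> T"
    by (auto simp: openin_open)
  define \<Gamma> where "\<Gamma> = (\<lambda>(y, \<theta> :: real^'p^'q). (\<phi> y, taylor ?E r (U, \<phi>) vec_triv (perturb f u \<theta>) y))"
  have tc: "continuous_on (U \<times> UNIV) (\<lambda>p :: 'a \<times> (real^'p^'q). taylor ?E r (U, \<phi>) vec_triv (perturb f u (snd p)) (fst p))"
  proof (intro continuous_on_coordinatewise_then_product)
    fix \<alpha> :: "'m multiset" and q
    let ?P = "pderivs (SOME is. mset is = \<alpha>)"
    have pc: "continuous_on (U \<times> UNIV) (\<lambda>p :: 'a \<times> (real^'p^'q). ?P (\<lambda>z. h (inv_into U \<phi> z)) (\<phi> (fst p)))"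
      if "smooth_fun \<A> UNIV h" for h
    proof -
      have "continuous_on U (\<lambda>y. ?P (\<lambda>z. h (inv_into U \<phi> z)) (\<phi> y))"
        using smooth_fun_continuous[OF _ chart_pull_smooth[OF U(1) open_UNIV that]] chart_open[OF U(1)] by simp
      then show ?thesis
        by (rule continuous_on_compose2[OF _ continuous_on_fst[OF continuous_on_id]]) auto
    qed
    have "continuous_on (U \<times> UNIV) (\<lambda>p :: 'a \<times> (real^'p^'q). if size \<alpha> \<le> r then
        ?P (\<lambda>z. f (inv_into U \<phi> z) $ q) (\<phi> (fst p)) +
        (\<Sum>l\<in>UNIV. snd p $ q $ l * ?P (\<lambda>z. u l (inv_into U \<phi> z)) (\<phi> (fst p))) else 0)"
      using pc[OF u] pc[of "\<lambda>y. f y $ q"] f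
      by (cases "size \<alpha> \<le> r") (auto simp: C_inf_iff intro!: continuous_intros)
    then show "continuous_on (U \<times> UNIV) (\<lambda>p :: 'a \<times> (real^'p^'q). taylor ?E r (U, \<phi>) vec_triv (perturb f u (snd p)) (fst p) \<alpha> q)"
    proof (rule continuous_on_eq)
      fix p :: "'a \<times> (real^'p^'q)" assume "p \<in> U \<times> UNIV"
      then have "fst p \<in> U" by auto
      from taylor_perturb[where u = u, OF f u U(1) this, of r "snd p" \<alpha> q]
      show "(if size \<alpha> \<le> r then ?P (\<lambda>z. f (inv_into U \<phi> z) $ q) (\<phi> (fst p)) +
          (\<Sum>l\<in>UNIV. snd p $ q $ l * ?P (\<lambda>z. u l (inv_into U \<phi> z)) (\<phi> (fst p))) else 0) =
          taylor ?E r (U, \<phi>) vec_triv (perturb f u (snd p)) (fst p) \<alpha> q" by (rule sym)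
    qed
  qed
  have "continuous_on (U \<times> UNIV) (\<lambda>p :: 'a \<times> (real^'p^'q). \<phi> (fst p))"
    by (rule continuous_on_compose2[OF chart_continuous[OF U(1)] continuous_on_fst[OF continuous_on_id]]) auto
  then have "continuous_on (U \<times> UNIV) \<Gamma>"
    unfolding \<Gamma>_def split_def using tc by (rule continuous_on_Pair)
  moreover have "open (U \<times> (UNIV :: (real^'p^'q) set))"
    using chart_open[OF U(1)] by (intro open_Times) auto
  ultimately have "open ((U \<times> UNIV) \<inter> \<Gamma> -` T)"
    using T(1) by (intro continuous_open_preimage)
  moreover have "(x, 0) \<in> (U \<times> UNIV) \<inter> \<Gamma> -` T"
  proof -
    have p0: "perturb f u 0 = f" by (simp add: perturb_def fun_eq_iff vec_eq_iff)
    have "jet_fibre_coords ?E r (U, \<phi>) vec_triv (jet_of \<A> ?E r f x) = taylor ?E r (U, \<phi>) vec_triv f x"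
      using U by (intro jet_fibre_coords_jet_of[OF C_inf_section_near[OF f], of U \<phi> UNIV]) (auto simp: trivs_product_bundle)
    then have "(\<phi> x, taylor ?E r (U, \<phi>) vec_triv f x) \<in> ?im"
      using x U by (intro image_eqI[of _ _ "jet_of \<A> ?E r f x"]) auto
    then show ?thesis using U unfolding T(2) by (simp add: \<Gamma>_def p0 del: taylor.simps)
  qed
  ultimately obtain N \<Theta> where N: "open N" "open \<Theta>" "(x, 0) \<in> N \<times> \<Theta>" "N \<times> \<Theta> \<subseteq> (U \<times> UNIV) \<inter> \<Gamma> -` T"
    by (rule open_prod_elim)
  have "jet_of \<A> ?E r (perturb f u \<theta>) y \<in> A" if "y \<in> N" "\<theta> \<in> \<Theta>" for y \<theta>
  proof -
    have y: "y \<in> U" and \<Gamma>T: "\<Gamma> (y, \<theta>) \<in> T" using that N(4) by auto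
    have \<Gamma>E: "\<Gamma> (y, \<theta>) \<in> UNIV \<times> jet_model ?E r"
      by (auto simp: \<Gamma>_def jet_model_def)
    have "\<Gamma> (y, \<theta>) \<in> ?im" unfolding T(2) by (rule IntI[OF \<Gamma>E \<Gamma>T])
    then obtain p where p: "p \<in> A" "fst p \<in> U" "\<phi> y = \<phi> (fst p)"
      "taylor ?E r (U, \<phi>) vec_triv (perturb f u \<theta>) y = jet_fibre_coords ?E r (U, \<phi>) vec_triv p"
      by (auto simp: \<Gamma>_def simp del: taylor.simps)
    have yp: "fst p = y" using chart_inv[OF U(1) p(2)] chart_inv[OF U(1) y] p(3) by simp
    have "p \<in> jet_bundle \<A> ?E r" using p(1) A unfolding open_in_jet_bundle_def by blast
    then obtain h where h: "p = jet_of \<A> ?E r h y" "section_near \<A> ?E y h"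
      using yp by (auto simp: jet_bundle_def)
    have "jet_fibre_coords ?E r (U, \<phi>) vec_triv p = taylor ?E r (U, \<phi>) vec_triv h y"
      unfolding h(1) using U y by (intro jet_fibre_coords_jet_of[OF h(2), of U \<phi> UNIV]) (auto simp: trivs_product_bundle)
    then have "jet_of \<A> ?E r (perturb f u \<theta>) y = jet_of \<A> ?E r h y"
      using p(4) by (intro jet_of_eqI[OF C_inf_section_near[OF perturb_C_inf[OF f u]] h(2) U(1) y]) (simp only:)
    then show ?thesis using p(1) h(1) by simp
  qed
  moreover have "\<forall>\<^sub>F \<theta> in nhds 0. \<theta> \<in> \<Theta>"
    using N(2,3) by (intro eventually_nhds_in_open) auto
  ultimately show ?thesis
    using N(1,3) by (intro exI[of _ N]) (auto elim!: eventually_mono)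
qed

text \<open>A finite subcover makes the smallness of \<theta> uniform over L.\<close>

lemma perturb_jets_compact:
  fixes f :: "'a \<Rightarrow> real^'q::finite" and u :: "'p::finite \<Rightarrow> 'a \<Rightarrow> real"
  assumes f: "f \<in> C_inf \<A>" and u: "\<And>l. smooth_fun \<A> UNIV (u l)"
    and A: "open_in_jet_bundle \<A> product_bundle r A"
    and L: "compact L" "\<And>x. x \<in> L \<Longrightarrow> jet_of \<A> product_bundle r f x \<in> A"
  shows "\<forall>\<^sub>F \<theta> in nhds 0. \<forall>y\<in>L. jet_of \<A> product_bundle r (perturb f u \<theta>) y \<in> A"
proof -
  have "\<forall>x\<in>L. \<exists>N. open N \<and> x \<in> N \<and>
      (\<forall>\<^sub>F \<theta> in nhds 0. \<forall>y\<in>N. jet_of \<A> product_bundle r (perturb f u \<theta>) y \<in> A)"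
    by (intro ballI perturb_jets_locally[OF f u A] L(2))
  then obtain N where N: "\<forall>x\<in>L. open (N x) \<and> x \<in> N x \<and>
      (\<forall>\<^sub>F \<theta> in nhds 0. \<forall>y\<in>N x. jet_of \<A> product_bundle r (perturb f u \<theta>) y \<in> A)"
    by (rule bchoice[THEN exE])
  obtain D where D: "D \<subseteq> L" "finite D" "L \<subseteq> (\<Union>x\<in>D. N x)"
    by (rule compactE_image[OF L(1), of L N]) (use N in blast)+
  have "\<forall>\<^sub>F \<theta> in nhds 0. \<forall>x\<in>D. \<forall>y\<in>N x. jet_of \<A> product_bundle r (perturb f u \<theta>) y \<in> A"
    using D N by (intro eventually_ball_finite) auto
  then show ?thesis by eventually_elim (use D(3) in blast)
qed

text \<open>Two open sets cover the manifold: U, and the complement of the preimage of C, which is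
  closed since a compact subset of a Hausdorff space is. On the latter the extended function is
  0.\<close>

lemma chart_extension_smooth:
  fixes R :: "real^'m \<Rightarrow> real"
  assumes U: "(U, \<phi>) \<in> \<A>" and C: "compact C" "C \<subseteq> \<phi> ` U"
    and R: "smooth_on UNIV UNIV R" "\<And>z. z \<notin> C \<Longrightarrow> R z = 0"
  shows "smooth_fun \<A> UNIV (\<lambda>y. if y \<in> U then R (\<phi> y) else 0)"
proof (rule smooth_fun_locally)
  fix x
  let ?L = "inv_into U \<phi> ` C" and ?f = "\<lambda>y. if y \<in> U then R (\<phi> y) else 0"
  have "closed ?L"
    using C by (intro compact_imp_closed compact_continuous_image continuous_on_subset[OF chart_inv_continuous[OF U]])
  then have oL: "open (- ?L)" by auto
  have "smooth_fun \<A> U (\<lambda>y. R (\<phi> y))"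
    by (intro smooth_fun_chart_comp[OF U] chart_open[OF U] smooth_on_subset[OF R(1)]) auto
  then have fU: "smooth_fun \<A> U ?f"
    by (rule smooth_fun_cong[OF chart_open[OF U], rotated]) auto
  have fL: "smooth_fun \<A> (- ?L) ?f"
  proof (rule smooth_fun_cong[OF oL _ smooth_fun_const[OF oL, of 0]])
    fix y assume "y \<in> - ?L"
    then have "\<phi> y \<notin> C" if "y \<in> U" using chart_inv[OF U that] by (metis ComplD imageI)
    then show "0 = ?f y" using R(2) by auto
  qed
  have "x \<in> U" if "x \<in> ?L" using that C(2) by (auto simp: inv_into_into)
  then show "\<exists>T. open T \<and> x \<in> T \<and> smooth_fun \<A> (UNIV \<inter> T) ?f"
    using fU fL oL chart_open[OF U] by (cases "x \<in> ?L") auto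
qed

section \<open>First- and second-order frame operators on scalar functions\<close>

lemma scalar_vectors_local:
  assumes V: "local_frame \<A> H k V \<xi>" "x \<in> V" and S: "open S" "x \<in> S" "\<And>y. y \<in> S \<Longrightarrow> f y = g y"
    and i: "i \<in> frame_index k"
  shows "scalar_vectors \<xi> f x i = scalar_vectors \<xi> g x i"
proof -
  have 1: "\<xi> a y f = \<xi> a y g" if "a < k" "y \<in> S \<inter> V" for a y
    using that S by (intro tangent_local[OF frame_tangent[OF V(1) that(1)], of y S]) auto
  have 2: "\<xi> a x (\<lambda>z. \<xi> b z f) = \<xi> a x (\<lambda>z. \<xi> b z g)" if "a < k" "b < k" for a b
    using that 1 S V frame_open[OF V(1)]
    by (intro tangent_local[OF frame_tangent[OF V(1) that(1) V(2)], of "S \<inter> V"]) auto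
  show ?thesis
    using i 1 2 S V by (cases i) (auto simp: scalar_vectors_def)
qed

lemma scalar_vectors_linear:
  assumes V: "local_frame \<A> H k V \<xi>" "x \<in> V" and f: "smooth_fun \<A> UNIV f" and u: "\<And>l. smooth_fun \<A> UNIV (u l)"
    and i: "i \<in> frame_index k"
  shows "scalar_vectors \<xi> (\<lambda>z. f z + (\<Sum>l\<in>P. c l * u l z)) x i =
    scalar_vectors \<xi> f x i + (\<Sum>l\<in>P. c l * scalar_vectors \<xi> (u l) x i)"
proof -
  have near: "smooth_near \<A> y h" if "smooth_fun \<A> UNIV h" for y h
    using smooth_nearI[OF open_UNIV UNIV_I that] .
  have lin: "v (\<lambda>z. h z + (\<Sum>l\<in>P. c l * w l z)) = v h + (\<Sum>l\<in>P. c l * v (w l))"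
    if v: "v \<in> tangent_space \<A> y" and h: "smooth_near \<A> y h" and w: "\<And>l. smooth_near \<A> y (w l)" for v y h w
  proof -
    have cw: "smooth_near \<A> y (\<lambda>z. c l * w l z)" for l
      by (intro smooth_near_mult smooth_near_const w)
    show ?thesis
      using tangent_add[OF v h smooth_near_sum[where I = P and f = "\<lambda>l z. c l * w l z"]] cw
        tangent_sum[OF v, where I = P and f = "\<lambda>l z. c l * w l z"] tangent_cmult[OF v w] by simp
  qed
  have 1: "\<xi> a y (\<lambda>z. f z + (\<Sum>l\<in>P. c l * u l z)) = \<xi> a y f + (\<Sum>l\<in>P. c l * \<xi> a y (u l))"
    if "a < k" "y \<in> V" for a y
    by (rule lin[OF frame_tangent[OF V(1) that] near[OF f] near[OF u]])
  have 2: "\<xi> a x (\<lambda>z. \<xi> b z (\<lambda>z. f z + (\<Sum>l\<in>P. c l * u l z))) =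
      \<xi> a x (\<lambda>z. \<xi> b z f) + (\<Sum>l\<in>P. c l * \<xi> a x (\<lambda>z. \<xi> b z (u l)))" if "a < k" "b < k" for a b
  proof -
    note v = frame_tangent[OF V(1) that(1) V(2)]
    have "\<xi> a x (\<lambda>z. \<xi> b z (\<lambda>z. f z + (\<Sum>l\<in>P. c l * u l z))) = \<xi> a x (\<lambda>z. \<xi> b z f + (\<Sum>l\<in>P. c l * \<xi> b z (u l)))"
      using 1[OF that(2)] by (intro tangent_local[OF v frame_open[OF V(1)] V(2)])
    also have "\<dots> = \<xi> a x (\<lambda>z. \<xi> b z f) + (\<Sum>l\<in>P. c l * \<xi> a x (\<lambda>z. \<xi> b z (u l)))"
      by (rule lin[OF v smooth_near_field[OF V(1) that(2) V(2) near[OF f]] smooth_near_field[OF V(1) that(2) V(2) near[OF u]]])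
    finally show ?thesis .
  qed
  show ?thesis
    using i 1[OF _ V(2)] 2 by (cases i) (auto simp: scalar_vectors_def sum.distrib distrib_left)
qed

lemma scalar_vectors_product:
  assumes V: "local_frame \<A> H k V \<xi>" "x \<in> V" and S: "open S" "x \<in> S" "smooth_fun \<A> S f" "smooth_fun \<A> S g"
    and ab: "a < k" "b < k"
  shows "\<xi> a x (\<lambda>z. \<xi> b z (\<lambda>z. f z * g z)) = f x * \<xi> a x (\<lambda>z. \<xi> b z g) + g x * \<xi> a x (\<lambda>z. \<xi> b z f)
    + (\<xi> a x f * \<xi> b x g + \<xi> a x g * \<xi> b x f)"
proof -
  note v = frame_tangent[OF V(1) ab(1) V(2)]
  have n: "smooth_near \<A> y f" "smooth_near \<A> y g" if "y \<in> S" for y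
    using smooth_nearI[OF S(1) that] S(3,4) by auto
  note fn = n(1)[OF S(2)] and gn = n(2)[OF S(2)]
  note fb = smooth_near_field[OF V(1) ab(2) V(2) fn] and gb = smooth_near_field[OF V(1) ab(2) V(2) gn]
  have "\<xi> a x (\<lambda>z. \<xi> b z (\<lambda>z. f z * g z)) = \<xi> a x (\<lambda>z. f z * \<xi> b z g + g z * \<xi> b z f)"
  proof (rule tangent_local[OF v, of "S \<inter> V"])
    show "\<xi> b y (\<lambda>z. f z * g z) = f y * \<xi> b y g + g y * \<xi> b y f" if "y \<in> S \<inter> V" for y
      using that n by (intro tangent_mult frame_tangent[OF V(1) ab(2)]) auto
  qed (use S V frame_open[OF V(1)] in auto)
  also have "\<dots> = \<xi> a x (\<lambda>z. f z * \<xi> b z g) + \<xi> a x (\<lambda>z. g z * \<xi> b z f)"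
    by (rule tangent_add[OF v smooth_near_mult[OF fn gb] smooth_near_mult[OF gn fb]])
  also have "\<dots> = (f x * \<xi> a x (\<lambda>z. \<xi> b z g) + \<xi> b x g * \<xi> a x f) + (g x * \<xi> a x (\<lambda>z. \<xi> b z f) + \<xi> b x f * \<xi> a x g)"
    by (simp only: tangent_mult[OF v fn gb] tangent_mult[OF v gn fb])
  finally show ?thesis by (simp add: algebra_simps)
qed

text \<open>The operator \<open>D = \<Sum> c\<^sub>i \<xi>\<^sub>i\<close> of order two has a nonzero full symbol because the symmetric
  products of the linearly independent \<open>\<xi>\<^sub>a\<close> are linearly independent.\<close>

lemma monomials_nondegenerate:
  assumes V: "local_frame \<A> H k V \<xi>" "x \<in> V" and U: "(U, \<phi>) \<in> \<A>" "x \<in> U"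
    and c: "\<exists>i\<in>frame_index k. c i \<noteq> 0"
  shows "\<exists>l. (\<Sum>i\<in>frame_index k. c i * scalar_vectors \<xi> (\<lambda>y. monomial l (\<phi> y)) x i) \<noteq> 0"
proof (rule ccontr)
  assume "\<not> ?thesis"
  then have zero: "(\<Sum>i\<in>frame_index k. c i * scalar_vectors \<xi> (\<lambda>y. monomial l (\<phi> y)) x i) = 0" for l by blast
  let ?J = "{(a, b). a \<le> b \<and> b < k}"
  have finJ: "finite ?J" by (rule finite_subset[of _ "{..<k} \<times> {..<k}"]) auto
  define X where "X = (\<lambda>a. \<chi> j. \<xi> a x (\<lambda>y. \<phi> y $ j))"
  obtain d where d: "\<And>a b. a < k \<Longrightarrow> b < k \<Longrightarrow> d a \<bullet> X b = (if a = b then 1 else 0)"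
    using dual_family[OF finite_lessThan coord_vectors_lin_indep[OF V U]] unfolding X_def
    by (metis lessThan_iff)
  have split: "(\<Sum>i\<in>frame_index k. c i * G i) = (\<Sum>a<k. c (Inl a) * G (Inl a)) + (\<Sum>p\<in>?J. c (Inr p) * G (Inr p))" for G
    unfolding frame_index_def by (subst sum.Plus) (auto simp: finJ)
  let ?sv = "\<lambda>l. scalar_vectors \<xi> (\<lambda>y. monomial l (\<phi> y)) x"
  \<comment> \<open>The Leibniz rule for a product of two coordinates. Both orders of the two fields
    give the same cross term, hence the factor 2.\<close>
  have prod: "?sv (Inr (j, m)) i = \<phi> x $ j * ?sv (Inl m) i + \<phi> x $ m * ?sv (Inl j) i +
      (case i of Inl a \<Rightarrow> 0 | Inr (a, b) \<Rightarrow> 2 * (X a $ j * X b $ m + X a $ m * X b $ j))"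
    if "i \<in> frame_index k" for i j m
  proof -
    have oU: "open U" using chart_open[OF U(1)] .
    note cs = smooth_fun_coord[OF U(1)]
    show ?thesis
    proof (cases i)
      case (Inl a)
      then have "a < k" using that by simp
      then show ?thesis
        using tangent_mult[OF frame_tangent[OF V(1) _ V(2)] smooth_near_coord[OF U] smooth_near_coord[OF U], of a j m]
        by (simp add: Inl scalar_vectors_def monomial_def)
    next
      case (Inr p)
      obtain a b where ab: "p = (a, b)" by (cases p)
      with that Inr have "a < k" "b < k" by auto
      then show ?thesis
        using scalar_vectors_product[OF V oU U(2) cs cs, of a b j m] scalar_vectors_product[OF V oU U(2) cs cs, of b a j m]
        by (simp add: Inr ab scalar_vectors_def monomial_def X_def algebra_simps)
    qed
  qed
  \<comment> \<open>The terms with a single coordinate vanish by assumption, leaving only the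
    symmetric products with the second-order coefficients.\<close>
  have S0: "(\<Sum>p\<in>?J. c (Inr p) * (X (fst p) $ j * X (snd p) $ m + X (fst p) $ m * X (snd p) $ j)) = 0" for j m
  proof -
    have "0 = (\<Sum>i\<in>frame_index k. c i * ?sv (Inr (j, m)) i)" using zero by simp
    also have "\<dots> = \<phi> x $ j * (\<Sum>i\<in>frame_index k. c i * ?sv (Inl m) i) + \<phi> x $ m * (\<Sum>i\<in>frame_index k. c i * ?sv (Inl j) i)
        + (\<Sum>i\<in>frame_index k. c i * (case i of Inl a \<Rightarrow> 0 | Inr (a, b) \<Rightarrow> 2 * (X a $ j * X b $ m + X a $ m * X b $ j)))"
      unfolding sum_distrib_left sum.distrib[symmetric] by (intro sum.cong refl) (simp add: prod algebra_simps)
    also have "\<dots> = (\<Sum>p\<in>?J. c (Inr p) * (2 * (X (fst p) $ j * X (snd p) $ m + X (fst p) $ m * X (snd p) $ j)))"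
      unfolding zero split by (simp add: split_def)
    also have "\<dots> = 2 * (\<Sum>p\<in>?J. c (Inr p) * (X (fst p) $ j * X (snd p) $ m + X (fst p) $ m * X (snd p) $ j))"
      by (simp only: sum_distrib_left mult.left_commute)
    finally show ?thesis by simp
  qed
  \<comment> \<open>Contraction with the dual vectors d_s and d_t selects the pair (s, t); for s = t
    both summands survive, whence the 2.\<close>
  have cJ: "c (Inr (s, t)) = 0" if st: "s \<le> t" "t < k" for s t
  proof -
    have "0 = (\<Sum>j\<in>UNIV. \<Sum>m\<in>UNIV. d s $ j * d t $ m *
        (\<Sum>p\<in>?J. c (Inr p) * (X (fst p) $ j * X (snd p) $ m + X (fst p) $ m * X (snd p) $ j)))"
      by (simp add: S0)
    also have "\<dots> = (\<Sum>p\<in>?J. \<Sum>j\<in>UNIV. \<Sum>m\<in>UNIV. d s $ j * d t $ m *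
        (c (Inr p) * (X (fst p) $ j * X (snd p) $ m + X (fst p) $ m * X (snd p) $ j)))"
      unfolding sum_distrib_left by (subst sum.swap[of _ ?J], subst sum.swap[of _ ?J]) simp
    also have "\<dots> = (\<Sum>p\<in>?J. c (Inr p) * ((d s \<bullet> X (fst p)) * (d t \<bullet> X (snd p)) + (d s \<bullet> X (snd p)) * (d t \<bullet> X (fst p))))"
      by (simp only: symmetric_product_contraction)
    also have "\<dots> = (\<Sum>p\<in>?J. if p = (s, t) then c (Inr (s, t)) * (if s = t then 2 else 1) else 0)"
      using st by (intro sum.cong refl) (auto simp: d split: if_splits)
    also have "\<dots> = c (Inr (s, t)) * (if s = t then 2 else 1)"
      using st finJ by simp
    finally show ?thesis by (simp split: if_splits)
  qed
  \<comment> \<open>With the second-order coefficients gone, the linear monomials and independence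
    of the frame settle the rest.\<close>
  have cI: "c (Inl s) = 0" if s: "s < k" for s
  proof -
    have "(\<Sum>a<k. c (Inl a) * X a $ j) = 0" for j
    proof -
      have "(\<Sum>p\<in>?J. c (Inr p) * ?sv (Inl j) (Inr p)) = 0"
        using cJ by (intro sum.neutral) auto
      then show ?thesis
        using zero[of "Inl j"] unfolding split by (simp add: scalar_vectors_def monomial_def X_def)
    qed
    then have "0 = d s \<bullet> (\<Sum>a<k. c (Inl a) *\<^sub>R X a)"
      by (simp add: inner_vec_def)
    also have "\<dots> = (\<Sum>a<k. if a = s then c (Inl s) else 0)"
      unfolding inner_sum_right using s by (intro sum.cong refl) (auto simp: d)
    finally show ?thesis using s by simp
  qed
  from c obtain i where i: "i \<in> frame_index k" "c i \<noteq> 0" by blast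
  then show False using cI cJ by (cases i) auto
qed

lemma smooth_fun_scalar_vectors:
  assumes V: "local_frame \<A> H k V \<xi>" and S: "open S" "S \<subseteq> V" "smooth_fun \<A> S h" and i: "i \<in> frame_index k"
  shows "smooth_fun \<A> S (\<lambda>y. scalar_vectors \<xi> h y i)"
  \<comment> \<open>The scalar function is repeated as all components of a vector map, over any
    finite index type at hand.\<close>
  using smooth_fun_free_vectors[OF V S(1,2) _ i, of "\<lambda>z. \<chi> _ :: 'm. h z"] S(3)
  by (simp add: free_vectors_nth)

text \<open>The only use of the dimension hypothesis: \<open>frame_index k\<close> has k + k (k + 1)
  / 2 elements, so the coordinates of point and coefficients fit into one column of length
  q.\<close>

lemma negligible_non_free:
  fixes g :: "'a \<Rightarrow> real^'q::finite"
  assumes dim: "CARD('m) + k + k * (k + 1) div 2 \<le> CARD('q)" and g: "g \<in> C_inf \<A>"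
    and V: "local_frame \<A> H k V \<xi>" and U: "(U, \<phi>) \<in> \<A>" and \<Omega>: "open \<Omega>" "\<Omega> \<subseteq> \<phi> ` (U \<inter> V)"
  shows "negligible {\<theta> :: real^('m + 'm \<times> 'm)^'q. \<exists>x\<in>U. \<phi> x \<in> \<Omega> \<and> \<not> lin_indep_family (frame_index k)
    (\<lambda>i. \<chi> q. scalar_vectors \<xi> (\<lambda>y. g y $ q) x i + (\<Sum>l\<in>UNIV. \<theta> $ q $ l * scalar_vectors \<xi> (\<lambda>y. monomial l (\<phi> y)) x i))}"
    (is "negligible ?N")
proof -
  let ?I = "frame_index k"
  define E where "E = (\<lambda>l i z. scalar_vectors \<xi> (\<lambda>y. monomial l (\<phi> y)) (inv_into U \<phi> z) i)"
  define F where "F = (\<lambda>q i z. scalar_vectors \<xi> (\<lambda>y. g y $ q) (inv_into U \<phi> z) i)"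
  have oUV: "open (U \<inter> V)" using chart_open[OF U] frame_open[OF V] by auto
  have sm: "smooth_on UNIV \<Omega> (\<lambda>z. scalar_vectors \<xi> h (inv_into U \<phi> z) i)"
    if "smooth_fun \<A> (U \<inter> V) h" "i \<in> ?I" for h i
  proof -
    have "smooth_fun \<A> (U \<inter> V) (\<lambda>y. scalar_vectors \<xi> h y i)"
      by (rule smooth_fun_scalar_vectors[OF V oUV _ that]) auto
    from smooth_on_subset[OF smooth_funD[OF this U]] show ?thesis
      using \<Omega>(2) by (simp add: Int_absorb)
  qed
  have "smooth_fun \<A> (U \<inter> V) (\<lambda>y. monomial l (\<phi> y))" for l
    using chart_image_open[OF U frame_open[OF V]]
    by (intro smooth_fun_chart_comp[OF U oUV] smooth_on_monomial) auto
  then have E: "smooth_on UNIV \<Omega> (E l i)" if "i \<in> ?I" for l i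
    unfolding E_def using that by (intro sm)
  have F: "smooth_on UNIV \<Omega> (F q i)" if "i \<in> ?I" for q i
    unfolding F_def using g that by (intro sm) (auto simp: C_inf_iff intro: smooth_fun_subset)
  have nd: "\<exists>l. (\<Sum>i\<in>?I. c i * E l i z) \<noteq> 0" if z: "z \<in> \<Omega>" and c: "\<exists>i\<in>?I. c i \<noteq> 0" for z c
  proof -
    obtain x where "x \<in> U" "x \<in> V" "z = \<phi> x" using z \<Omega>(2) by auto
    then show ?thesis
      using monomials_nondegenerate[OF V _ U _ c, of x] chart_inv[OF U] by (simp add: E_def)
  qed
  have "negligible {\<theta> :: real^('m + 'm \<times> 'm)^'q. \<exists>z\<in>\<Omega>. \<exists>c. (\<exists>i\<in>?I. c i \<noteq> 0) \<and>
      (\<forall>q. (\<Sum>i\<in>?I. c i * (F q i z + (\<Sum>l\<in>UNIV. \<theta> $ q $ l * E l i z))) = 0)}"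
    using dim by (intro negligible_bad_parameters finite_frame_index \<Omega>(1) E F nd) (auto simp: card_frame_index)
  then show ?thesis
  proof (rule negligible_subset, intro subsetI)
    fix \<theta> assume "\<theta> \<in> ?N"
    then obtain x c where x: "x \<in> U" "\<phi> x \<in> \<Omega>" and c: "\<exists>i\<in>?I. c i \<noteq> 0"
      and eq: "(\<Sum>i\<in>?I. c i *\<^sub>R (\<chi> q. scalar_vectors \<xi> (\<lambda>y. g y $ q) x i +
        (\<Sum>l\<in>UNIV. \<theta> $ q $ l * scalar_vectors \<xi> (\<lambda>y. monomial l (\<phi> y)) x i))) = 0"
      unfolding lin_indep_family_def by blast
    have "(\<Sum>i\<in>?I. c i * (F q i (\<phi> x) + (\<Sum>l\<in>UNIV. \<theta> $ q $ l * E l i (\<phi> x)))) = 0" for q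
      using arg_cong[OF eq, of "\<lambda>v. v $ q"] by (simp add: E_def F_def chart_inv[OF U x(1)])
    then show "\<theta> \<in> {\<theta>. \<exists>z\<in>\<Omega>. \<exists>c. (\<exists>i\<in>?I. c i \<noteq> 0) \<and>
        (\<forall>q. (\<Sum>i\<in>?I. c i * (F q i z + (\<Sum>l\<in>UNIV. \<theta> $ q $ l * E l i z))) = 0)}"
      using x c by blast
  qed
qed

end

section \<open>Density of free maps\<close>

context smooth_manifold
begin

text \<open>Charts give local compactness, and second countability reduces a cover by relatively
  compact open sets to a countable one; the exhaustion then absorbs finitely many of these sets at a
  time.\<close>

lemma compact_exhaustion:
  obtains X :: "nat \<Rightarrow> 'a set" where "X 0 = {}" "\<And>n. compact (X n)"
    "\<And>n. X n \<subseteq> interior (X (Suc n))" "(\<Union>n. X n) = UNIV"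
proof -
  have loc: "\<exists>N K. open N \<and> x \<in> N \<and> N \<subseteq> K \<and> compact K" for x :: 'a
  proof -
    obtain U \<phi> where U: "(U, \<phi>) \<in> \<A>" "x \<in> U" by (rule chart_at)
    have "open (\<phi> ` (U \<inter> UNIV))" "\<phi> x \<in> \<phi> ` (U \<inter> UNIV)"
      using chart_image_open[OF U(1) open_UNIV] U by auto
    then obtain r where r: "r > 0" "cball (\<phi> x) r \<subseteq> \<phi> ` (U \<inter> UNIV)"
      using open_contains_cball by blast
    have "open (U \<inter> \<phi> -` ball (\<phi> x) r)"
      using continuous_open_preimage[OF chart_continuous[OF U(1)] chart_open[OF U(1)] open_ball] .
    moreover have "compact (inv_into U \<phi> ` cball (\<phi> x) r)"
      using r by (intro compact_continuous_image continuous_on_subset[OF chart_inv_continuous[OF U(1)]]) auto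
    moreover have "U \<inter> \<phi> -` ball (\<phi> x) r \<subseteq> inv_into U \<phi> ` cball (\<phi> x) r"
    proof
      fix y assume y: "y \<in> U \<inter> \<phi> -` ball (\<phi> x) r"
      then show "y \<in> inv_into U \<phi> ` cball (\<phi> x) r"
        using chart_inv[OF U(1), of y] by (intro image_eqI[of _ _ "\<phi> y"]) auto
    qed
    moreover have "x \<in> U \<inter> \<phi> -` ball (\<phi> x) r" using U r by simp
    ultimately show ?thesis by blast
  qed
  define \<F> where "\<F> = {N :: 'a set. open N \<and> (\<exists>K. N \<subseteq> K \<and> compact K)}"
  obtain \<F>' where \<F>': "\<F>' \<subseteq> \<F>" "countable \<F>'" "\<Union>\<F>' = \<Union>\<F>"
    by (rule Lindelof[of \<F>]) (auto simp: \<F>_def)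
  have "x \<in> \<Union>\<F>" for x
    using loc[of x] unfolding \<F>_def by blast
  then have U\<F>: "\<Union>\<F>' = UNIV" unfolding \<F>'(3) by blast
  then have ne: "\<F>' \<noteq> {}" by auto
  define e where "e = from_nat_into \<F>'"
  have e: "e n \<in> \<F>" for n using from_nat_into[OF ne] \<F>'(1) by (auto simp: e_def)
  then obtain K where K: "\<And>n. e n \<subseteq> K n" "\<And>n. compact (K n)"
    unfolding \<F>_def mem_Collect_eq by metis
  have Ue: "(\<Union>n. e n) = UNIV"
    unfolding e_def using range_from_nat_into[OF ne \<F>'(2)] U\<F> by simp
  \<comment> \<open>Absorbing K_0, ..., K_(n-1) at step n forces the union to be everything, while
    the condition at n = 0 starts the exhaustion at the empty set.\<close>
  have "\<exists>X. \<forall>n::nat. (compact (X n) \<and> (n = 0 \<longrightarrow> X n = {})) \<and> X n \<union> (\<Union>i<n. K i) \<subseteq> interior (X (Suc n))"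
  proof (rule dependent_nat_choice)
    show "\<exists>x :: 'a set. compact x \<and> (0 = (0::nat) \<longrightarrow> x = {})" by auto
    fix x :: "'a set" and n :: nat assume x: "compact x \<and> (n = 0 \<longrightarrow> x = {})"
    have "compact (x \<union> (\<Union>i<n. K i))" using x K(2) by (intro compact_Un compact_UN) auto
    then obtain D where D: "finite D" "x \<union> (\<Union>i<n. K i) \<subseteq> (\<Union>i\<in>D. e i)"
      using e Ue by (elim compactE_image[of _ UNIV e]) (auto simp: \<F>_def)
    have "compact (\<Union>i\<in>D. K i)" using D(1) K(2) by (intro compact_UN) auto
    moreover have eD: "(\<Union>i\<in>D. e i) \<subseteq> interior (\<Union>i\<in>D. K i)"
      using e by (intro interior_maximal UN_mono order_refl K(1) open_UN) (auto simp: \<F>_def)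
    ultimately show "\<exists>y. (compact y \<and> (Suc n = 0 \<longrightarrow> y = {})) \<and> x \<union> (\<Union>i<n. K i) \<subseteq> interior y"
      using order_trans[OF D(2) eD] by (intro exI[of _ "\<Union>i\<in>D. K i"] conjI) (simp_all only: nat.distinct simp_thms)
  qed
  then obtain X where X': "\<forall>n::nat. (compact (X n) \<and> (n = 0 \<longrightarrow> X n = {})) \<and>
      X n \<union> (\<Union>i<n. K i) \<subseteq> interior (X (Suc n))" ..
  have X: "compact (X n)" "X 0 = {}" "X n \<union> (\<Union>i<n. K i) \<subseteq> interior (X (Suc n))" for n
    using X'[rule_format, of n] X'[rule_format, of 0] by simp_all
  have "(\<Union>n. X n) = UNIV"
  proof (intro equalityI subset_UNIV subsetI)
    fix x :: 'a
    obtain n where "x \<in> e n" using Ue by blast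
    then have "x \<in> X (Suc (Suc n))"
      using K(1)[of n] X(3)[of "Suc n"] interior_subset[of "X (Suc (Suc n))"] by blast
    then show "x \<in> (\<Union>n. X n)" by blast
  qed
  with X show ?thesis by (intro that[of X]) auto
qed

text \<open>A finite set C of pairs, order and open set of jets, represents a basic Whitney
  neighbourhood without bringing its conditions to a common order.\<close>

definition jets_within :: "(nat \<times> ('a, real^'q::finite) jet set) set \<Rightarrow> ('a \<Rightarrow> real^'q) \<Rightarrow> 'a \<Rightarrow> bool" where
  "jets_within C g x \<longleftrightarrow> (\<forall>(r, A)\<in>C. jet_of \<A> product_bundle r g x \<in> A)"

lemma jets_within_local:
  "open S \<Longrightarrow> x \<in> S \<Longrightarrow> (\<And>y. y \<in> S \<Longrightarrow> f y = g y) \<Longrightarrow> jets_within C f x \<longleftrightarrow> jets_within C g x"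
  unfolding jets_within_def using jet_of_local[of S x f g] by simp

lemma free_at_local:
  assumes "open S" "x \<in> S" "\<And>y. y \<in> S \<Longrightarrow> f y = g y" "f \<in> C_inf \<A>" "g \<in> C_inf \<A>" "free_at k H x f"
  shows "free_at k H x g"
  using jet_in_free_jets_iff[OF C_inf_section_near[OF assms(4)], of x k H]
    jet_in_free_jets_iff[OF C_inf_section_near[OF assms(5)], of x k H]
    jet_of_local[OF assms(1-3)] assms(6) by simp

text \<open>The neighbourhoods N and K are fixed before g and Q, so a finite subcover can be chosen
  first and the corrections made one after another. Small \<theta> keep the freeness already gained
  on Q, and almost every \<theta> yields it on K.\<close>

lemma free_perturbation_near_point:
  fixes C :: "(nat \<times> ('a, real^'q::finite) jet set) set"
  assumes H: "smooth_distribution \<A> k H" and dim: "CARD('m) + k + k * (k + 1) div 2 \<le> CARD('q)"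
    and C: "finite C" "\<And>r A. (r, A) \<in> C \<Longrightarrow> open_in_jet_bundle \<A> product_bundle r A"
    and x0: "open W" "x0 \<in> W"
  shows "\<exists>N K. open N \<and> x0 \<in> N \<and> N \<subseteq> K \<and> compact K \<and>
    (\<forall>g Q. g \<in> C_inf \<A> \<longrightarrow> (\<forall>x. jets_within C g x) \<longrightarrow> compact Q \<longrightarrow> (\<forall>x\<in>Q. free_at k H x g) \<longrightarrow>
      (\<exists>g'\<in>C_inf \<A>. (\<forall>x. jets_within C g' x) \<and> (\<forall>x\<in>Q \<union> K. free_at k H x g') \<and> (\<forall>x. x \<notin> W \<longrightarrow> g' x = g x)))"
proof -
  obtain U \<phi> where U: "(U, \<phi>) \<in> \<A>" "x0 \<in> U" by (rule chart_at)
  obtain V \<xi> where V: "x0 \<in> V" "local_frame \<A> H k V \<xi>"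
    using H unfolding smooth_distribution_def by blast
  define p where "p = \<phi> x0"
  have "open (\<phi> ` (U \<inter> (V \<inter> W)))" "p \<in> \<phi> ` (U \<inter> (V \<inter> W))"
    using chart_image_open[OF U(1), of "V \<inter> W"] frame_open[OF V(2)] x0 U V by (auto simp: p_def)
  then obtain R where R: "R > 0" "cball p R \<subseteq> \<phi> ` (U \<inter> (V \<inter> W))"
    using open_contains_cball by blast
  \<comment> \<open>Three concentric balls: freeness is achieved over the closed ball of radius r,
    the perturbation is exactly a monomial on radius 2r, and it vanishes beyond 3r.\<close>
  define r where "r = R / 3"
  have r: "r > 0" and big: "cball p (3 * r) \<subseteq> \<phi> ` (U \<inter> (V \<inter> W))"
    using R by (auto simp: r_def)
  have balls: "cball p r \<subseteq> ball p (2 * r)" "ball p (2 * r) \<subseteq> cball p (3 * r)" "ball p (3 * r) \<subseteq> cball p (3 * r)"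
    using r by (auto simp: subset_iff)
  let ?inv = "inv_into U \<phi>"
  define N where "N = U \<inter> \<phi> -` ball p r"
  define K where "K = ?inv ` cball p r"
  define L where "L = ?inv ` cball p (3 * r)"
  have cpt: "compact (?inv ` S)" if "compact S" "S \<subseteq> cball p (3 * r)" for S
    using that big by (intro compact_continuous_image continuous_on_subset[OF chart_inv_continuous[OF U(1)]]) auto
  have N: "open N" "x0 \<in> N"
    using continuous_open_preimage[OF chart_continuous[OF U(1)] chart_open[OF U(1)] open_ball] U r
    by (auto simp: N_def p_def)
  have NK: "N \<subseteq> K"
  proof
    fix y assume "y \<in> N"
    then show "y \<in> K"
      using chart_inv[OF U(1), of y] by (auto simp: N_def K_def intro!: image_eqI[of _ _ "\<phi> y"])
  qed
  have K: "compact K" unfolding K_def using balls by (intro cpt) auto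
  have L: "compact L" unfolding L_def by (intro cpt) auto
  have LW: "L \<subseteq> W" using big chart_inv[OF U(1)] by (fastforce simp: L_def)
  obtain \<rho> :: "real^'m \<Rightarrow> real" where \<rho>: "smooth_on UNIV UNIV \<rho>" "\<And>z. z \<in> ball p (2 * r) \<Longrightarrow> \<rho> z = 1"
    "\<And>z. z \<notin> ball p (3 * r) \<Longrightarrow> \<rho> z = 0"
    using smooth_plateau[OF r, of p] by blast
  define u where "u = (\<lambda>l y. if y \<in> U then \<rho> (\<phi> y) * monomial l (\<phi> y) else 0)"
  have u: "smooth_fun \<A> UNIV (u l)" for l
    unfolding u_def
  proof (rule chart_extension_smooth[OF U(1)])
    show "smooth_on UNIV UNIV (\<lambda>z. \<rho> z * monomial l z)"
      by (intro smooth_on_mult line_open_UNIV \<rho>(1) smooth_on_monomial) auto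
    show "\<rho> z * monomial l z = 0" if "z \<notin> cball p (3 * r)" for z
      using that balls(3) \<rho>(3) by auto
  qed (use big in auto)
  have uL: "u l y = 0" if "y \<notin> L" for l y
  proof (cases "y \<in> U")
    case True
    then have "\<phi> y \<notin> cball p (3 * r)"
      using that chart_inv[OF U(1) True] unfolding L_def by (metis imageI)
    then show ?thesis using balls(3) \<rho>(3) by (auto simp: u_def)
  qed (simp add: u_def)
  have step: "\<exists>g'\<in>C_inf \<A>. (\<forall>x. jets_within C g' x) \<and> (\<forall>x\<in>Q \<union> K. free_at k H x g') \<and> (\<forall>x. x \<notin> W \<longrightarrow> g' x = g x)"
    if g: "g \<in> C_inf \<A>" "\<And>x. jets_within C g x" and Q: "compact Q" "\<And>x. x \<in> Q \<Longrightarrow> free_at k H x g" for g Q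
  proof -
    let ?p = "\<lambda>\<theta> :: real^('m + 'm \<times> 'm)^'q. perturb g u \<theta>"
    have pC: "?p \<theta> \<in> C_inf \<A>" for \<theta> by (rule perturb_C_inf[OF g(1) u])
    \<comment> \<open>Only the compact set L has to be controlled, because the map is unchanged
      outside it.\<close>
    have "\<forall>\<^sub>F \<theta> in nhds 0. \<forall>c\<in>C. \<forall>y\<in>L. jet_of \<A> product_bundle (fst c) (?p \<theta>) y \<in> snd c"
    proof (rule eventually_ball_finite[OF C(1)], rule ballI)
      fix c assume "c \<in> C"
      then show "\<forall>\<^sub>F \<theta> in nhds 0. \<forall>y\<in>L. jet_of \<A> product_bundle (fst c) (?p \<theta>) y \<in> snd c"
        using g(2) C(2)[of "fst c" "snd c"]
        by (intro perturb_jets_compact[OF g(1) u _ L]) (auto simp: jets_within_def split_beta)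
    qed
    moreover have "\<forall>\<^sub>F \<theta> in nhds 0. \<forall>y\<in>Q. jet_of \<A> product_bundle 2 (?p \<theta>) y \<in> free_jets k H"
      using Q(2) jet_in_free_jets_iff[OF C_inf_section_near[OF g(1)], of _ k H]
      by (intro perturb_jets_compact[OF g(1) u open_free_jets Q(1)]) auto
    ultimately have "\<forall>\<^sub>F \<theta> in nhds 0. (\<forall>c\<in>C. \<forall>y\<in>L. jet_of \<A> product_bundle (fst c) (?p \<theta>) y \<in> snd c) \<and>
        (\<forall>y\<in>Q. jet_of \<A> product_bundle 2 (?p \<theta>) y \<in> free_jets k H)"
      by (rule eventually_conj)
    then obtain \<Theta> where \<Theta>: "open \<Theta>" "0 \<in> \<Theta>" "\<And>\<theta>. \<theta> \<in> \<Theta> \<Longrightarrow> \<forall>c\<in>C. \<forall>y\<in>L. jet_of \<A> product_bundle (fst c) (?p \<theta>) y \<in> snd c"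
        "\<And>\<theta>. \<theta> \<in> \<Theta> \<Longrightarrow> \<forall>y\<in>Q. jet_of \<A> product_bundle 2 (?p \<theta>) y \<in> free_jets k H"
      unfolding eventually_nhds by blast
    let ?bad = "{\<theta> :: real^('m + 'm \<times> 'm)^'q. \<exists>x\<in>U. \<phi> x \<in> ball p (2 * r) \<and> \<not> lin_indep_family (frame_index k)
      (\<lambda>i. \<chi> q. scalar_vectors \<xi> (\<lambda>y. g y $ q) x i + (\<Sum>l\<in>UNIV. \<theta> $ q $ l * scalar_vectors \<xi> (\<lambda>y. monomial l (\<phi> y)) x i))}"
    have "negligible ?bad"
      using balls(2) big by (intro negligible_non_free[OF dim g(1) V(2) U(1)]) auto
    \<comment> \<open>A nonempty open set is not negligible, so arbitrarily small good parameters
      exist.\<close>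
    then have "\<not> \<Theta> \<subseteq> ?bad"
      using \<Theta>(1,2) negligible_subset open_not_negligible by blast
    then obtain \<theta> where \<theta>: "\<theta> \<in> \<Theta>" "\<theta> \<notin> ?bad" by blast
    have offL: "?p \<theta> y = g y" if "y \<notin> L" for y
      using uL[OF that] by (simp add: perturb_def vec_eq_iff)
    have oL: "open (- L)" using compact_imp_closed[OF L] by auto
    have "jets_within C (?p \<theta>) x" for x
    proof (cases "x \<in> L")
      case True
      then show ?thesis using \<Theta>(3)[OF \<theta>(1)] by (auto simp: jets_within_def)
    next
      case False
      then show ?thesis using g(2) jets_within_local[OF oL, of x "?p \<theta>" g C] offL by simp
    qed
    moreover have "free_at k H x (?p \<theta>)" if "x \<in> Q" for x
      using \<Theta>(4)[OF \<theta>(1)] that jet_in_free_jets_iff[OF C_inf_section_near[OF pC[of \<theta>]], of x k H] by blast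
    moreover have "free_at k H x (?p \<theta>)" if "x \<in> K" for x
    proof -
      obtain z where z: "z \<in> cball p r" "x = ?inv z" using \<open>x \<in> K\<close> by (auto simp: K_def)
      then obtain y where y: "y \<in> U" "y \<in> V" "z = \<phi> y" using balls big by blast
      then have xy: "x = y" using z(2) chart_inv[OF U(1)] by simp
      have x: "x \<in> U" "x \<in> V" "\<phi> x \<in> ball p (2 * r)" using y z balls(1) xy by auto
      \<comment> \<open>On this neighbourhood of x the cut-off is 1, so the perturbing functions
        have the germs of the bare monomials.\<close>
      define S where "S = U \<inter> \<phi> -` ball p (2 * r)"
      have S: "open S" "x \<in> S"
        using continuous_open_preimage[OF chart_continuous[OF U(1)] chart_open[OF U(1)] open_ball] x
        by (auto simp: S_def)
      have "\<forall>i\<in>frame_index k. free_vectors \<xi> (?p \<theta>) x i = (\<chi> q. scalar_vectors \<xi> (\<lambda>y. g y $ q) x i +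
          (\<Sum>l\<in>UNIV. \<theta> $ q $ l * scalar_vectors \<xi> (\<lambda>y. monomial l (\<phi> y)) x i))"
      proof
        fix i assume i: "i \<in> frame_index k"
        have "scalar_vectors \<xi> (u l) x i = scalar_vectors \<xi> (\<lambda>y. monomial l (\<phi> y)) x i" for l
          by (rule scalar_vectors_local[OF V(2) x(2) S _ i]) (simp add: u_def S_def \<rho>(2))
        then have "scalar_vectors \<xi> (\<lambda>z. g z $ q + (\<Sum>l\<in>UNIV. \<theta> $ q $ l * u l z)) x i =
            scalar_vectors \<xi> (\<lambda>y. g y $ q) x i +
            (\<Sum>l\<in>UNIV. \<theta> $ q $ l * scalar_vectors \<xi> (\<lambda>y. monomial l (\<phi> y)) x i)" for q
          using scalar_vectors_linear[OF V(2) x(2) _ u i, where f = "\<lambda>y. g y $ q" and P = UNIV and c = "\<lambda>l. \<theta> $ q $ l"] g(1)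
          by (simp add: C_inf_iff)
        then show "free_vectors \<xi> (?p \<theta>) x i = (\<chi> q. scalar_vectors \<xi> (\<lambda>y. g y $ q) x i +
            (\<Sum>l\<in>UNIV. \<theta> $ q $ l * scalar_vectors \<xi> (\<lambda>y. monomial l (\<phi> y)) x i))"
          by (simp add: vec_eq_iff free_vectors_nth perturb_def)
      qed
      then have "lin_indep_family (frame_index k) (free_vectors \<xi> (?p \<theta>) x) \<longleftrightarrow> lin_indep_family (frame_index k)
          (\<lambda>i. \<chi> q. scalar_vectors \<xi> (\<lambda>y. g y $ q) x i +
            (\<Sum>l\<in>UNIV. \<theta> $ q $ l * scalar_vectors \<xi> (\<lambda>y. monomial l (\<phi> y)) x i))"
        by (rule lin_indep_family_cong)
      then have "lin_indep_family (frame_index k) (free_vectors \<xi> (?p \<theta>) x)"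
        using \<theta>(2) x(1,3) by simp
      then show ?thesis using V(2) x(2) by (auto simp: free_at_def)
    qed
    moreover have "?p \<theta> x = g x" if "x \<notin> W" for x
      using offL[of x] that LW by blast
    ultimately show ?thesis
      using pC by (intro bexI[of _ "?p \<theta>"]) auto
  qed
  show ?thesis
    using N NK K step by (intro exI[of _ N] exI[of _ K]) blast
qed

text \<open>Finitely many local corrections are made in turn; the compact set where freeness must be
  preserved grows by one K at each of them.\<close>

lemma free_perturbation_compact:
  fixes C :: "(nat \<times> ('a, real^'q::finite) jet set) set"
  assumes H: "smooth_distribution \<A> k H" and dim: "CARD('m) + k + k * (k + 1) div 2 \<le> CARD('q)"
    and C: "finite C" "\<And>r A. (r, A) \<in> C \<Longrightarrow> open_in_jet_bundle \<A> product_bundle r A"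
    and R: "compact R" "R \<subseteq> W" "open W"
    and g: "g \<in> C_inf \<A>" "\<And>x. jets_within C g x" and Q: "compact Q" "\<And>x. x \<in> Q \<Longrightarrow> free_at k H x g"
  shows "\<exists>g'\<in>C_inf \<A>. (\<forall>x. jets_within C g' x) \<and> (\<forall>x\<in>Q \<union> R. free_at k H x g') \<and> (\<forall>x. x \<notin> W \<longrightarrow> g' x = g x)"
proof -
  define good where "good = (\<lambda>N K. open N \<and> N \<subseteq> K \<and> compact K \<and>
    (\<forall>g Q. g \<in> C_inf \<A> \<longrightarrow> (\<forall>x. jets_within C g x) \<longrightarrow> compact Q \<longrightarrow> (\<forall>x\<in>Q. free_at k H x g) \<longrightarrow>
      (\<exists>g'\<in>C_inf \<A>. (\<forall>x. jets_within C g' x) \<and> (\<forall>x\<in>Q \<union> K. free_at k H x g') \<and> (\<forall>x. x \<notin> W \<longrightarrow> g' x = g x))))"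
  have "\<forall>x\<in>R. \<exists>NK. x \<in> fst NK \<and> good (fst NK) (snd NK)"
  proof
    fix x assume "x \<in> R"
    then have "x \<in> W" using R(2) by blast
    from free_perturbation_near_point[OF H dim C R(3) this]
    show "\<exists>NK. x \<in> fst NK \<and> good (fst NK) (snd NK)"
      unfolding good_def by auto
  qed
  then obtain NK where NK: "\<forall>x\<in>R. x \<in> fst (NK x) \<and> good (fst (NK x)) (snd (NK x))"
    by (rule bchoice[THEN exE])
  obtain D where D: "D \<subseteq> R" "finite D" "R \<subseteq> (\<Union>x\<in>D. fst (NK x))"
    by (rule compactE_image[OF R(1), of R "\<lambda>x. fst (NK x)"]) (use NK in \<open>auto simp: good_def\<close>)
  have "\<exists>g'\<in>C_inf \<A>. (\<forall>x. jets_within C g' x) \<and> (\<forall>x\<in>Q \<union> (\<Union>y\<in>D. snd (NK y)). free_at k H x g') \<and>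
      (\<forall>x. x \<notin> W \<longrightarrow> g' x = g x)"
    using D(2,1)
  proof (induction D rule: finite_induct)
    case empty
    then show ?case using g Q by auto
  next
    case (insert y D)
    then obtain h where h: "h \<in> C_inf \<A>" "\<forall>x. jets_within C h x"
      "\<forall>x\<in>Q \<union> (\<Union>y\<in>D. snd (NK y)). free_at k H x h" "\<forall>x. x \<notin> W \<longrightarrow> h x = g x" by auto
    have "good (fst (NK z)) (snd (NK z))" if "z \<in> insert y D" for z
      using that insert.prems NK by auto
    then have "compact (Q \<union> (\<Union>y\<in>D. snd (NK y)))"
      using insert.hyps Q(1) by (intro compact_Un compact_UN) (auto simp: good_def)
    moreover have "\<exists>g'\<in>C_inf \<A>. (\<forall>x. jets_within C g' x) \<and>
        (\<forall>x\<in>(Q \<union> (\<Union>y\<in>D. snd (NK y))) \<union> snd (NK y). free_at k H x g') \<and> (\<forall>x. x \<notin> W \<longrightarrow> g' x = h x)"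
      if "compact (Q \<union> (\<Union>y\<in>D. snd (NK y)))"
    proof -
      have "good (fst (NK y)) (snd (NK y))" using insert.prems NK by auto
      from this[unfolded good_def, THEN conjunct2, THEN conjunct2, THEN conjunct2, rule_format, OF h(1) _ that]
      show ?thesis using h(2,3) by blast
    qed
    ultimately obtain h' where "h' \<in> C_inf \<A>" "\<forall>x. jets_within C h' x"
      "\<forall>x\<in>(Q \<union> (\<Union>y\<in>D. snd (NK y))) \<union> snd (NK y). free_at k H x h'" "\<forall>x. x \<notin> W \<longrightarrow> h' x = h x"
      by blast
    then show ?case using h(4) by (intro bexI[of _ h']) auto
  qed
  then obtain g' where g': "g' \<in> C_inf \<A>" "\<forall>x. jets_within C g' x"
    "\<forall>x\<in>Q \<union> (\<Union>y\<in>D. snd (NK y)). free_at k H x g'" "\<forall>x. x \<notin> W \<longrightarrow> g' x = g x" by blast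
  have "fst (NK y) \<subseteq> snd (NK y)" if "y \<in> D" for y
    using NK D(1) that unfolding good_def by (meson subsetD)
  with D(3) have "R \<subseteq> (\<Union>y\<in>D. snd (NK y))" by blast
  then show ?thesis using g' by (intro bexI[of _ g']) auto
qed

text \<open>The map is corrected on \<open>X (Suc n)\<close> away from \<open>X (n - 1)\<close>, so the corrections stabilize locally
  and the open conditions on jets survive in the limit.\<close>

lemma free_perturbation:
  fixes C :: "(nat \<times> ('a, real^'q::finite) jet set) set"
  assumes H: "smooth_distribution \<A> k H" and dim: "CARD('m) + k + k * (k + 1) div 2 \<le> CARD('q)"
    and C: "finite C" "\<And>r A. (r, A) \<in> C \<Longrightarrow> open_in_jet_bundle \<A> product_bundle r A"
    and f: "f \<in> C_inf \<A>" "\<And>x. jets_within C f x"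
  shows "\<exists>g\<in>free_maps \<A> k H. \<forall>x. jets_within C g x"
proof -
  obtain X :: "nat \<Rightarrow> 'a set" where X: "X 0 = {}" "\<And>n. compact (X n)"
    "\<And>n. X n \<subseteq> interior (X (Suc n))" "(\<Union>n. X n) = UNIV"
    by (rule compact_exhaustion) blast
  have XSuc: "X n \<subseteq> X (Suc n)" for n using X(3)[of n] interior_subset by blast
  have mono: "X m \<subseteq> X n" if "m \<le> n" for m n using lift_Suc_mono_le[of X, OF XSuc that] .
  \<comment> \<open>At n = 0 truncated subtraction gives X 0 = {}, so the first step is
    unconstrained.\<close>
  have "\<exists>G. \<forall>n. (G n \<in> C_inf \<A> \<and> (\<forall>x. jets_within C (G n) x) \<and> (\<forall>x\<in>X n. free_at k H x (G n))) \<and>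
      (\<forall>x\<in>X (n - 1). G (Suc n) x = G n x)"
  proof (rule dependent_nat_choice)
    show "\<exists>g. g \<in> C_inf \<A> \<and> (\<forall>x. jets_within C g x) \<and> (\<forall>x\<in>X 0. free_at k H x g)"
      using f X(1) by auto
    fix g n assume g: "g \<in> C_inf \<A> \<and> (\<forall>x. jets_within C g x) \<and> (\<forall>x\<in>X n. free_at k H x g)"
    \<comment> \<open>The shell to be corrected avoids X (n - 1), which therefore can be left
      untouched.\<close>
    have "X (n - 1) \<subseteq> interior (X n)"
      using X(1) X(3)[of "n - 1"] by (cases n) auto
    then have "X (Suc n) - interior (X n) \<subseteq> - X (n - 1)" by blast
    moreover have "compact (X (Suc n) - interior (X n))" using X(2) by (intro compact_diff) auto
    moreover have "open (- X (n - 1))" using compact_imp_closed[OF X(2)] by auto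
    ultimately obtain g' where "g' \<in> C_inf \<A>" "\<forall>x. jets_within C g' x"
      "\<forall>x\<in>X n \<union> (X (Suc n) - interior (X n)). free_at k H x g'" "\<forall>x. x \<notin> - X (n - 1) \<longrightarrow> g' x = g x"
      using free_perturbation_compact[OF H dim C, of "X (Suc n) - interior (X n)" "- X (n - 1)" g "X n"] g X(2)
      by blast
    moreover have "X (Suc n) \<subseteq> X n \<union> (X (Suc n) - interior (X n))" using interior_subset by blast
    ultimately show "\<exists>g'. (g' \<in> C_inf \<A> \<and> (\<forall>x. jets_within C g' x) \<and> (\<forall>x\<in>X (Suc n). free_at k H x g')) \<and>
        (\<forall>x\<in>X (n - 1). g' x = g x)"
      by (intro exI[of _ g']) auto
  qed
  then obtain G where G: "\<And>n. G n \<in> C_inf \<A>" "\<And>n x. jets_within C (G n) x"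
    "\<And>n x. x \<in> X n \<Longrightarrow> free_at k H x (G n)" "\<And>n x. x \<in> X (n - 1) \<Longrightarrow> G (Suc n) x = G n x"
    by blast
  \<comment> \<open>On X m the sequence is constant from index \<open>Suc m\<close> on, so the limit
    can be read off at the first n with x in X n.\<close>
  have stable: "G (Suc n) x = G (Suc m) x" if "m \<le> n" "x \<in> X m" for m n x
    using that(1)
  proof (induction n rule: dec_induct)
    case (step n)
    then show ?case using G(4)[of x "Suc n"] mono[of m n] that(2) by auto
  qed simp
  define g where "g = (\<lambda>x. G (Suc (LEAST n. x \<in> X n)) x)"
  have gX: "g x = G (Suc n) x" if "x \<in> X n" for x n
  proof -
    have "x \<in> X (LEAST n. x \<in> X n)" "(LEAST n. x \<in> X n) \<le> n"
      using that by (auto intro: LeastI Least_le)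
    then show ?thesis using stable[of "LEAST n. x \<in> X n" n x] by (simp add: g_def)
  qed
  \<comment> \<open>Near such an x the limit equals \<open>G (Suc n)\<close>, which is known to be
    free on X (Suc n); both memberships are used.\<close>
  have near: "\<exists>n. x \<in> interior (X n) \<and> x \<in> X (Suc n)" for x
    using X(3,4) XSuc by blast
  have loc: "g y = G (Suc n) y" if "y \<in> interior (X n)" for y n
    using gX that interior_subset by blast
  have gC: "g \<in> C_inf \<A>"
    unfolding C_inf_iff
  proof (intro allI smooth_fun_locally)
    fix l x
    obtain n where n: "x \<in> interior (X n)" using near by blast
    have "smooth_fun \<A> (interior (X n)) (\<lambda>x. G (Suc n) x $ l)"
      using G(1)[of "Suc n"] by (auto simp: C_inf_iff intro: smooth_fun_subset)
    then have "smooth_fun \<A> (interior (X n)) (\<lambda>x. g x $ l)"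
      by (rule smooth_fun_cong[OF open_interior, rotated]) (simp add: loc)
    then show "\<exists>T. open T \<and> x \<in> T \<and> smooth_fun \<A> (UNIV \<inter> T) (\<lambda>x. g x $ l)"
      using n by (intro exI[of _ "interior (X n)"]) auto
  qed
  have "jets_within C g x \<and> free_at k H x g" for x
  proof -
    obtain n where n: "x \<in> interior (X n)" "x \<in> X (Suc n)" using near by blast
    have "jets_within C g x"
      using jets_within_local[OF open_interior n(1), of "G (Suc n)" g C] loc G(2) by simp
    moreover have "free_at k H x g"
      by (rule free_at_local[OF open_interior n(1) _ G(1) gC G(3)[OF n(2)]]) (simp add: loc)
    ultimately show ?thesis ..
  qed
  moreover from this have "g \<in> free_maps \<A> k H"
    unfolding free_maps_eq sections_with_jets_in_def
    using gC jet_in_free_jets_iff[OF C_inf_section_near[OF gC]] by blast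
  ultimately show ?thesis by blast
qed

section \<open>Basic neighbourhoods of the Whitney topology\<close>

lemma jet_bundle_0_open:
  "open_in_jet_bundle \<A> product_bundle 0 (jet_bundle \<A> (product_bundle :: ('a, real^'q::finite, 'q) vbundle) 0)"
  unfolding open_in_jet_bundle_def
proof (intro conjI ballI order_refl)
  let ?E = "product_bundle :: ('a, real^'q, 'q) vbundle"
  fix ch assume "ch \<in> \<A>"
  then obtain U \<phi> where ch: "ch = (U, \<phi>)" and U: "(U, \<phi>) \<in> \<A>" by (cases ch) auto
  let ?im = "(\<lambda>p. (\<phi> (fst p), jet_fibre_coords ?E 0 (U, \<phi>) vec_triv p)) ` {p \<in> jet_bundle \<A> ?E 0. fst p \<in> U \<inter> UNIV}"
  have coords: "jet_fibre_coords ?E 0 (U, \<phi>) vec_triv (jet_of \<A> ?E 0 f x) = taylor ?E 0 (U, \<phi>) vec_triv f x"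
    if "x \<in> U" "section_near \<A> ?E x f" for x f
    using that U by (intro jet_fibre_coords_jet_of[where V = UNIV]) (auto simp: trivs_product_bundle)
  have "?im = (UNIV \<times> jet_model ?E 0) \<inter> (\<phi> ` (U \<inter> UNIV) \<times> UNIV)"
  proof (intro equalityI subsetI)
    fix q assume "q \<in> ?im"
    then obtain f x where "x \<in> U" "section_near \<A> ?E x f"
      "q = (\<phi> x, jet_fibre_coords ?E 0 (U, \<phi>) vec_triv (jet_of \<A> ?E 0 f x))"
      by (auto simp: jet_bundle_def)
    then show "q \<in> (UNIV \<times> jet_model ?E 0) \<inter> (\<phi> ` (U \<inter> UNIV) \<times> UNIV)"
      using coords by (auto simp: jet_model_def)
  next
    fix q :: "(real^'m) \<times> ('m multiset \<Rightarrow> 'q \<Rightarrow> real)"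
    assume "q \<in> (UNIV \<times> jet_model ?E 0) \<inter> (\<phi> ` (U \<inter> UNIV) \<times> UNIV)"
    then obtain x y where xy: "x \<in> U" "q = (\<phi> x, y)" "y \<in> jet_model ?E 0" by auto
    define f where "f = (\<lambda>_ :: 'a. \<chi> l. y {#} l)"
    have f: "section_near \<A> ?E x f"
      unfolding section_near_product_bundle f_def by (simp add: smooth_near_const)
    have "taylor ?E 0 (U, \<phi>) vec_triv f x = y"
      using xy(3) by (auto simp: fun_eq_iff jet_model_def f_def partial_deriv_empty)
    then show "q \<in> ?im"
      using xy f coords[OF xy(1) f] by (intro image_eqI[of _ _ "jet_of \<A> ?E 0 f x"]) (auto simp: jet_bundle_def)
  qed
  then have "openin (top_of_set (UNIV \<times> jet_model ?E 0)) ?im"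
    using chart_image_open[OF U open_UNIV] by (simp only:) (intro openin_open_Int open_Times open_UNIV)
  then show "case ch of (U, \<phi>) \<Rightarrow> \<forall>(V, c)\<in>trivs ?E. openin (top_of_set (UNIV \<times> jet_model ?E 0))
      ((\<lambda>p. (\<phi> (fst p), jet_fibre_coords ?E 0 (U, \<phi>) c p)) ` {p \<in> jet_bundle \<A> ?E 0. fst p \<in> U \<inter> V})"
    by (simp add: ch trivs_product_bundle)
qed

text \<open>All generating sets consist of smooth maps, and the open set of all 0-jets makes the set
  of all smooth maps a generator itself.\<close>

lemma topspace_whitney: "topspace (whitney_topology \<A> product_bundle) = (C_inf \<A> :: ('a \<Rightarrow> real^'q::finite) set)"
proof -
  have "(C_inf \<A> :: ('a \<Rightarrow> real^'q) set) = sections_with_jets_in \<A> product_bundle 0 (jet_bundle \<A> product_bundle 0)"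
    using C_inf_section_near by (fastforce simp: sections_with_jets_in_def jet_bundle_def)
  then have "(C_inf \<A> :: ('a \<Rightarrow> real^'q) set) \<in>
      {sections_with_jets_in \<A> product_bundle r A | r A. open_in_jet_bundle \<A> product_bundle r A}"
    using jet_bundle_0_open by blast
  then show ?thesis
    unfolding whitney_topology_def topology_generated_by_topspace
    by (auto simp: sections_with_jets_in_def)
qed

text \<open>Induction over the generation of open sets: an intersection joins the two finite
  families of conditions, and a union keeps the family of a member containing f.\<close>

lemma whitney_neighbourhood:
  fixes f :: "'a \<Rightarrow> real^'q::finite"
  assumes "openin (whitney_topology \<A> product_bundle) T" "f \<in> T"
  shows "\<exists>C. finite C \<and> (\<forall>(r, A)\<in>C. open_in_jet_bundle \<A> product_bundle r A) \<and> (\<forall>x. jets_within C f x) \<and>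
    (\<forall>g\<in>C_inf \<A>. (\<forall>x. jets_within C g x) \<longrightarrow> g \<in> T)"
proof -
  have "generate_topology_on {sections_with_jets_in \<A> product_bundle r A | r A.
      open_in_jet_bundle \<A> product_bundle r A} T"
    using assms(1) unfolding whitney_topology_def by (rule openin_topology_generated_by)
  then show ?thesis
    using assms(2)
  proof (induction rule: generate_topology_on.induct)
    case (Int S T)
    then obtain C D where "finite C" "\<forall>(r, A)\<in>C. open_in_jet_bundle \<A> product_bundle r A" "\<forall>x. jets_within C f x"
        "\<forall>g\<in>C_inf \<A>. (\<forall>x. jets_within C g x) \<longrightarrow> g \<in> S"
      "finite D" "\<forall>(r, A)\<in>D. open_in_jet_bundle \<A> product_bundle r A" "\<forall>x. jets_within D f x"
        "\<forall>g\<in>C_inf \<A>. (\<forall>x. jets_within D g x) \<longrightarrow> g \<in> T"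
      by auto
    then show ?case
      by (intro exI[of _ "C \<union> D"]) (auto simp: jets_within_def)
  next
    case (UN \<K>)
    then obtain S where S: "S \<in> \<K>" "f \<in> S" by auto
    from UN.IH[OF S] obtain C where C: "finite C" "\<forall>(r, A)\<in>C. open_in_jet_bundle \<A> product_bundle r A"
      "\<forall>x. jets_within C f x" "\<forall>g\<in>C_inf \<A>. (\<forall>x. jets_within C g x) \<longrightarrow> g \<in> S"
      by (elim exE conjE)
    then show ?case
      using S(1) by (intro exI[of _ C] conjI ballI impI UnionI[OF S(1)]) auto
  next
    case (Basis S)
    then obtain r A where "S = sections_with_jets_in \<A> product_bundle r A" "open_in_jet_bundle \<A> product_bundle r A"
      by auto
    with Basis show ?case
      by (intro exI[of _ "{(r, A)}"]) (auto simp: jets_within_def sections_with_jets_in_def)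
  qed simp
qed

lemma open_dense_free_maps:
  assumes H: "smooth_distribution \<A> k H" and dim: "CARD('m) + k + k * (k + 1) div 2 \<le> CARD('q)"
  shows "openin (whitney_topology \<A> product_bundle) (free_maps \<A> k H :: ('a \<Rightarrow> real^'q::finite) set)"
    and "whitney_topology \<A> product_bundle closure_of (free_maps \<A> k H :: ('a \<Rightarrow> real^'q) set) = C_inf \<A>"
proof -
  let ?F = "free_maps \<A> k H :: ('a \<Rightarrow> real^'q) set"
  \<comment> \<open>The set of free maps is one of the generating sets, with r = 2.\<close>
  show "openin (whitney_topology \<A> product_bundle) ?F"
    unfolding whitney_topology_def openin_topology_generated_by_iff
    using free_maps_eq open_free_jets by (intro generate_topology_on.Basis) blast
  have "f \<in> whitney_topology \<A> product_bundle closure_of ?F" if f: "f \<in> C_inf \<A>" for f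
    unfolding in_closure_of
  proof (intro conjI allI impI)
    show "f \<in> topspace (whitney_topology \<A> product_bundle)" using f by (simp only: topspace_whitney)
    fix T assume T: "f \<in> T \<and> openin (whitney_topology \<A> product_bundle) T"
    then obtain C where C: "finite C" "\<forall>(r, A)\<in>C. open_in_jet_bundle \<A> product_bundle r A"
      "\<forall>x. jets_within C f x" "\<forall>g\<in>C_inf \<A>. (\<forall>x. jets_within C g x) \<longrightarrow> g \<in> T"
      using whitney_neighbourhood[of T f] by blast
    obtain g where "g \<in> ?F" "\<forall>x. jets_within C g x"
      using free_perturbation[OF H dim C(1) _ f] C(2,3) by blast
    then show "\<exists>y. y \<in> ?F \<and> y \<in> T"
      using C(4) by (auto simp: free_maps_def)
  qed
  then show "whitney_topology \<A> product_bundle closure_of ?F = C_inf \<A>"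
    using closure_of_subset_topspace[of "whitney_topology \<A> product_bundle" ?F]
    unfolding topspace_whitney by blast
qed

end

theorem theorem2p5:
  fixes \<A> :: "('a::{t2_space,second_countable_topology}, 'm::finite) chart set"
    and k :: nat
    and H :: "'a \<Rightarrow> 'a tangent_vector set"
  assumes "smooth_atlas \<A>" and "smooth_distribution \<A> k H"
  shows "infinitesimally_invertible \<A> (quadratic_forms \<A> k H)
           (pullback_metric H :: ('a \<Rightarrow> real^'q::finite) \<Rightarrow> _) (free_maps \<A> k H) \<and>
         (CARD('q) \<ge> CARD('m) + k + k * (k + 1) div 2 \<longrightarrow>
            openin (whitney_topology \<A> product_bundle)
              (free_maps \<A> k H :: ('a \<Rightarrow> real^'q) set) \<and>
            whitney_topology \<A> product_bundle closure_of (free_maps \<A> k H :: ('a \<Rightarrow> real^'q) set)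
              = C_inf \<A>)"
proof -
  interpret smooth_manifold \<A>
    by unfold_locales (rule assms(1))
  show ?thesis
    using infinitesimally_invertible_pullback_metric[OF assms(2)] open_dense_free_maps[OF assms(2)]
    by blast
qed

end
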